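(* Let $W,V,\lambda,\nu,\widehat\nu_N,s,q$ and the event $\Xi$ be as in the context, with $\lambda>0$. The following holds on the event $\Xi$. (1) Define a probability measure $\widetilde\nu_N^{\lambda}$ by (density notation) $$\widetilde\nu_N^{\lambda}(v)=\frac1{2\lambda}\left[\widehat\nu_N\Big(\tfrac1\lambda\big(v+\tfrac{\sqrt s}{q}\big)\Big)+\widehat\nu_N\Big(\tfrac1\lambda\big(v-\tfrac{\sqrt s}{q}\big)\Big)\right],$$ i.e. $\widetilde\nu_N^\lambda$ is the classical convolution of the push-forward of $\widehat\nu_N$ under $x\mapsto\lambda x$ with $\frac12(\delta_{\sqrt s/q}+\delta_{-\sqrt s/q})$. Then $\widetilde\nu_N^\lambda$ is supported on a compact interval $I^{\lambda}_{\widetilde\nu}$ (the smallest interval containing its support), and there exists $\varpi>0$ such that $$\inf_{x\in I^{\lambda}_{\widetilde\nu}}\int\frac{1}{(v-x)^2}\,d\widetilde\nu_N^{\lambda}(v)\ge 1+\varpi \qquad (\ast)$$ for $N$ sufficiently large in case $V$ is deterministic; in case $V$ is random, $(\ast)$ holds with high probability. The first moment of $\widetilde\nu_N^\lambda$ is zero ($\widehat\nu_N$ and $\nu$ being centered), and its second, third and fourth moments are $$m^{(2)}(\widetilde\nu_N^\lambda)=\lambda^2m^{(2)}(\widehat\nu_N)+\frac{s}{q^2},\qquad m^{(3)}(\widetilde\nu_N^\lambda)=\lambda^3m^{(3)}(\widehat\nu_N),$$ $$m^{(4)}(\widetilde\nu_N^\lambda)=\lambda^4m^{(4)}(\widehat\nu_N)+\frac{6s\lambda^2}{q^2}m^{(2)}(\widehat\nu_N)+\frac{s^2}{q^4}.$$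 (2) Let $\widetilde\rho_{fc}$ be the free additive convolution of the standard semicircle law and $\widetilde\nu_N^\lambda$. Its Stieltjes transform $\widetilde m_{fc}:\mathbb C^+\to\mathbb C^+$ satisfies $$\widetilde m_{fc}(z)=\int\left(\lambda v-z-\widetilde m_{fc}(z)-\frac{s}{q^2}\,\frac{1}{\lambda v-z-\widetilde m_{fc}(z)}\right)^{-1}d\widehat\nu_N(v).$$ There exist $\widetilde L_-,\widetilde L_+\in\mathbb R$ such that $\operatorname{supp}\widetilde\rho_{fc}=[\widetilde L_-,\widetilde L_+]$, with strictly positive density on $(\widetilde L_-,\widetilde L_+)$. In particular, when $\lambda\ll1$, $$\widetilde L_+=2+m^{(1)}(\widetilde\nu_N^\lambda)+m^{(2)}(\widetilde\nu_N^\lambda)+m^{(3)}(\widetilde\nu_N^\lambda)+\Big(m^{(4)}(\widetilde\nu_N^\lambda)-\tfrac94\big(m^{(2)}(\widetilde\nu_N^\lambda)\big)^2\Big)+O(\lambda^5+q^{-6}),$$ and analogously at the lower edge, $$\widetilde L_-=-2+m^{(1)}(\widetilde\nu_N^\lambda)-m^{(2)}(\widetilde\nu_N^\lambda)+m^{(3)}(\widetilde\nu_N^\lambda)-\Big(m^{(4)}(\widetilde\nu_N^\lambda)-\tfrac94\big(m^{(2)}(\widetilde\nu_N^\lambda)\big)^2\Big)+O(\lambda^5+q^{-6}).$$ Likewise, let $\breve\nu^\lambda$ be the deterministic probability measure $$\breve\nu^{\lambda}(v)=\frac1{2\lambda}\left[\nu\Big(\tfrac1\lambda\big(v+\tfrac{\sqrt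 s}{q}\big)\Big)+\nu\Big(\tfrac1\lambda\big(v-\tfrac{\sqrt s}{q}\big)\Big)\right].$$ Then $\breve\nu^\lambda$ is supported on a compact interval and satisfies the analogue of $(\ast)$ (with $\breve\nu^\lambda$ in place of $\widetilde\nu_N^\lambda$ and the smallest interval containing its support in place of $I^\lambda_{\widetilde\nu}$) for $N$ sufficiently large; its moments are given by the formulas above with $m^{(k)}(\widehat\nu_N)$ replaced by $m^{(k)}(\nu)$. Let $\breve\rho_{fc}$ be the free additive convolution of the standard semicircle law and $\breve\nu^\lambda$. There exist $\breve L_-,\breve L_+\in\mathbb R$ such that $\operatorname{supp}\breve\rho_{fc}=[\breve L_-,\breve L_+]$, with strictly positive density on $(\breve L_-,\breve L_+)$, and its Stieltjes transform $\breve m_{fc}$ satisfies $$\breve m_{fc}(z)=\int\left(\lambda v-z-\breve m_{fc}(z)-\frac{s}{q^2}\,\frac{1}{\lambda v-z-\breve m_{fc}(z)}\right)^{-1}d\nu(v).$$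
   Context: All objects depend on $N$ and asymptotic notation refers to $N\to\infty$; $a\ll b$ means $a=o(b)$. $\mathbb C^+$ is the upper half plane. For a probability measure $\mu$ on $\mathbb R$, $m_\mu(z)=\int\frac{d\mu(v)}{v-z}$ is its Stieltjes transform and $m^{(k)}(\mu)$ its $k$-th moment. An event holds with high probability if for every $D>0$ its probability is at least $1-N^{-D}$ for $N\ge N_0(D)$; statements made "on $\Xi$" are understood as: the exceptional part of $\Xi$ is negligible in this sense (empty for deterministic statements). Sparse matrix. Fix $\delta>0$. $W=(W_{ij})$ is a real symmetric $N\times N$ random matrix with entries independent up to symmetry, $\mathbb E W_{ij}=0$, $\mathbb E W_{ij}^2=\frac{1+O(\delta_{ij})}{N}$, $\mathbb E|W_{ij}|^k\le\frac{(Ck)^{ck}}{Nq^{k-2}}$ for $k\ge3$, with sparsity parameter $q=N^{\phi}$, $\phi\in[\delta,1/2]$ fixed. The $(W_{ij})_{i<j}$ are i.i.d. with $k$-th cumulant $\mathcal C_k$; $s^{(k)}=Nq^{k-2}\mathcal C_k$ satisfies $|s^{(k)}|\le C_k$, and $s:=s^{(4)}\ge c_4>0$. The diagonal of $W$ is set to zero. Potential. $V=\operatorname{diag}(V_1,\dots,V_N)$ is real with uniformly bounded entries and $\widehat\nu_N=\frac1N\sum_i\delta_{V_i}$; $\widehat\nu_N$ converges weakly (in probability if $V$ is random) to a deterministic, centered, compactly supported probability measure $\nu$. If $V$ is random, the $V_i$ are i.i.d. with law $\nu$ and independent of $W$. If $V$ is deterministic, there is $\mathfrak a_0>0$ with $\max_{z\in\mathcal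 D}|m_{\widehat\nu_N}(z)-m_\nu(z)|=O(N^{-\mathfrak a_0})$ for every fixed compact $\mathcal D\subset\mathbb C^+\cup\mathbb R$ with $\mathcal D\cap\operatorname{supp}\nu=\emptyset$. Coupling and stability. $\lambda=\lambda_0N^{-\beta}$ with constants $\beta\ge0,\lambda_0\ge0$, and $\Theta_\varpi=[0,\lambda']$ for an appropriate $\lambda'\geq 0$ ($\lambda'=\lambda_0$ if $\beta=0$). Let $I_\nu$, $I_{\widehat\nu_N}$ be the smallest intervals containing $\operatorname{supp}\nu$, $\operatorname{supp}\widehat\nu_N$. There is $\varpi>0$ independent of $N$ with $\inf_{x\in I_\nu}\int\frac{d\nu(v)}{(v-x)^2}\ge(1+\varpi)\lambda^2$ for $N$ large, and $\inf_{x\in I_{\widehat\nu_N}}\int\frac{d\widehat\nu_N(v)}{(v-x)^2}\ge(1+\varpi)\lambda^2$ for $N$ large (deterministic $V$), respectively with probability at least $1-N^{-\mathfrak t}$ for some constant $\mathfrak t>0$ (random $V$), uniformly in $\lambda\in\Theta_\varpi$; the integrals may be infinite. Event $\Xi$. $\Xi_N(\mathfrak a)$ is the event on which: (1) $\inf_{x\in I_{\widehat\nu_N}}\int\frac{d\widehat\nu_N(v)}{(v-x)^2}\ge(1+\varpi)\lambda^2$; (2) for every fixed compact $\mathcal D\subset\mathbb C^+\cup\mathbb R$ disjoint from $\operatorname{supp}\nu$ there is $C$ with $\sup_{z\in\mathcal D}|m_{\widehat\nu_N}(z)-m_\nu(z)|\le CN^{-\mathfrak a}$ for $N$ large; (3)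 if $V$ is random: for every fixed compact $\Theta\times\mathcal D\subset\Theta_\varpi\times(\mathbb C^+\cup\mathbb R)$ with $\inf_{(\lambda,z)\in\Theta\times\mathcal D,\,v\in I_\nu}|\lambda v-z|>0$ there is $C$ with $\sup_{(\lambda,z)\in\Theta\times\mathcal D,\lambda\ne0}\lambda^{-1}|m^\lambda_{\widehat\nu_N}(z)-m^\lambda_\nu(z)|\le CN^{-\mathfrak a}$ for $N$ large, where $m^\lambda_\mu(z)=\int\frac{d\mu(v)}{\lambda v-z}$. Set $\Xi=\Xi_N(\mathfrak a_0)$ for deterministic $V$ and $\Xi=\Xi_N(\frac12-\epsilon_0)$ for random $V$, with $\epsilon_0>0$ small and fixed.
   Formalization: The edge error O(λ^5+q^{-6}) fails if the third moment is nonzero; |m3|/q^2 and |m1|(|m1|+m2) (m_k moments of the smeared measure) are added to it. As random ν̂_N is not exactly centered, printed first and third moments are given for centered measures, with corrected formulas otherwise. *)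

theory Defs
  imports "HOL-Probability.Probability" "HOL-Computational_Algebra.Formal_Power_Series"
begin

section \<open>Measures on the real line\<close>

definition msupp :: "real measure \<Rightarrow> real set" where
  "msupp \<mu> = {x. \<forall>U. open U \<longrightarrow> x \<in> U \<longrightarrow> 0 < emeasure \<mu> U}"

text \<open>The smallest interval containing the support.\<close>

definition supp_hull :: "real measure \<Rightarrow> real set" where
  "supp_hull \<mu> = is_interval hull (msupp \<mu>)"

definition moment :: "real measure \<Rightarrow> nat \<Rightarrow> real" where
  "moment \<mu> k = (\<integral>v. v ^ k \<partial>\<mu>)"

definition stieltjes :: "real measure \<Rightarrow> complex \<Rightarrow> complex" where
  "stieltjes \<mu> z = (\<integral>v. 1 / (complex_of_real v - z) \<partial>\<mu>)"

definition stieltjes_scaled :: "real \<Rightarrow> real measure \<Rightarrow> complex \<Rightarrow> complex" where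
  "stieltjes_scaled l \<mu> z = (\<integral>v. 1 / (complex_of_real (l * v) - z) \<partial>\<mu>)"

text \<open>
  The infimum of the integral of \<open>1 / (v - x)\<^sup>2\<close> over \<open>x\<close> in the hull of the support is at
  least \<open>c\<close>. The integral is taken in the extended nonnegative reals, where the inverse of \<open>0\<close>
  is \<open>\<infinity>\<close>, so that it may be infinite; in particular it is \<open>\<infinity>\<close> at every atom.
\<close>

definition stable_at_level :: "real \<Rightarrow> real measure \<Rightarrow> bool" where
  "stable_at_level c \<mu> \<longleftrightarrow>
     ennreal c \<le> (INF x\<in>supp_hull \<mu>. \<integral>\<^sup>+v. inverse (ennreal ((v - x)\<^sup>2)) \<partial>\<mu>)"

definition supported_on_compact_interval :: "real measure \<Rightarrow> bool" where
  "supported_on_compact_interval \<mu> \<longleftrightarrow>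
     prob_space \<mu> \<and> sets \<mu> = sets borel \<and> compact (supp_hull \<mu>) \<and> measure \<mu> (supp_hull \<mu>) = 1"

definition empirical :: "nat \<Rightarrow> (nat \<Rightarrow> real) \<Rightarrow> real measure" where
  "empirical N v = distr (uniform_count_measure {..<N}) borel v"

text \<open>
  The measure \<open>(\<delta>\<^bsub>e\<^esub> + \<delta>\<^bsub>-e\<^esub>) / 2\<close>, and the classical convolution of the push-forward of
  \<open>\<mu>\<close> under multiplication by \<open>l\<close> with it.
\<close>

definition two_point :: "real \<Rightarrow> real measure" where
  "two_point e = distr (uniform_count_measure {-1, 1::real}) borel (\<lambda>\<sigma>. \<sigma> * e)"

definition smeared :: "real \<Rightarrow> real \<Rightarrow> real measure \<Rightarrow> real measure" where
  "smeared l e \<mu> = convolution (distr \<mu> borel (\<lambda>x. l * x)) (two_point e)"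

definition semicircle :: "real measure" where
  "semicircle = density lborel (\<lambda>x. ennreal (sqrt (max 0 (4 - x\<^sup>2)) / (2 * pi)))"

abbreviation upper_half :: "complex set" where
  "upper_half \<equiv> {z. 0 < Im z}"

definition recip_stieltjes :: "real measure \<Rightarrow> complex \<Rightarrow> complex" where
  "recip_stieltjes \<mu> z = - 1 / stieltjes \<mu> z"

text \<open>
  Free additive convolution through analytic subordination. For Borel probability measures
  \<open>\<mu>\<close> and \<open>\<nu>\<close> on the line there are unique subordination functions as below, and
  \<open>z \<mapsto> F\<^bsub>\<mu>\<^esub> (\<omega>\<^sub>2 z)\<close> is then the negative reciprocal Stieltjes transform of a unique
  probability measure, which is the free additive convolution of \<open>\<mu>\<close> and \<open>\<nu>\<close>.
\<close>

definition is_free_add_conv :: "real measure \<Rightarrow> real measure \<Rightarrow> real measure \<Rightarrow> bool" where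
  "is_free_add_conv \<mu> \<nu> \<rho> \<longleftrightarrow>
     prob_space \<rho> \<and> sets \<rho> = sets borel \<and>
     (\<exists>\<omega>\<^sub>1 \<omega>\<^sub>2.
        \<omega>\<^sub>1 holomorphic_on upper_half \<and> \<omega>\<^sub>2 holomorphic_on upper_half \<and>
        (\<forall>z\<in>upper_half. Im z \<le> Im (\<omega>\<^sub>1 z) \<and> Im z \<le> Im (\<omega>\<^sub>2 z)) \<and>
        ((\<lambda>\<eta>::real. \<omega>\<^sub>1 (\<i> * \<eta>) / (\<i> * \<eta>)) \<longlongrightarrow> 1) at_top \<and>
        ((\<lambda>\<eta>::real. \<omega>\<^sub>2 (\<i> * \<eta>) / (\<i> * \<eta>)) \<longlongrightarrow> 1) at_top \<and>
        (\<forall>z\<in>upper_half.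
           recip_stieltjes \<mu> (\<omega>\<^sub>2 z) = recip_stieltjes \<nu> (\<omega>\<^sub>1 z) \<and>
           \<omega>\<^sub>1 z + \<omega>\<^sub>2 z - z = recip_stieltjes \<mu> (\<omega>\<^sub>2 z) \<and>
           recip_stieltjes \<rho> z = recip_stieltjes \<mu> (\<omega>\<^sub>2 z)))"

text \<open>
  The support is \<open>[a, b]\<close> and there is a density that is strictly positive on \<open>(a, b)\<close>.
  Continuity on \<open>(a, b)\<close> singles out the version of the density there, so that positivity at
  every point is meaningful.
\<close>

definition one_cut :: "real measure \<Rightarrow> real \<Rightarrow> real \<Rightarrow> bool" where
  "one_cut \<rho> a b \<longleftrightarrow>
     msupp \<rho> = {a..b} \<and>
     (\<exists>f. f \<in> borel_measurable borel \<and> (\<forall>x. 0 \<le> f x) \<and>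
          \<rho> = density lborel (\<lambda>x. ennreal (f x)) \<and>
          continuous_on {a<..<b} f \<and> (\<forall>x\<in>{a<..<b}. 0 < f x))"


section \<open>The sparse matrix\<close>

text \<open>
  \<open>fps_ln 1\<close> is the series of \<open>ln (1 + X)\<close>, so this is \<open>k!\<close> times the \<open>k\<close>-th coefficient of the
  logarithm of the formal moment generating function.
\<close>

definition cumulant :: "'w measure \<Rightarrow> ('w \<Rightarrow> real) \<Rightarrow> nat \<Rightarrow> real" where
  "cumulant M X k =
     fact k * fps_nth (fps_ln 1 oo (Abs_fps (\<lambda>n. (\<integral>\<omega>. X \<omega> ^ n \<partial>M) / fact n) - 1)) k"

definition sparsity :: "real \<Rightarrow> nat \<Rightarrow> real" where
  "sparsity \<phi> N = real N powr \<phi>"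

text \<open>The common cumulant of the entries above the diagonal is read off from the entry \<open>(0, 1)\<close>.\<close>

definition scaled_cumulant ::
  "(nat \<Rightarrow> 'w measure) \<Rightarrow> (nat \<Rightarrow> nat \<Rightarrow> nat \<Rightarrow> 'w \<Rightarrow> real) \<Rightarrow> real \<Rightarrow> nat \<Rightarrow> nat \<Rightarrow> real" where
  "scaled_cumulant M W \<phi> k N =
     real N * sparsity \<phi> N powr (real k - 2) * cumulant (M N) (W N 0 1) k"

definition sparse_matrix ::
  "(nat \<Rightarrow> 'w measure) \<Rightarrow> (nat \<Rightarrow> nat \<Rightarrow> nat \<Rightarrow> 'w \<Rightarrow> real) \<Rightarrow> real \<Rightarrow> bool" where
  "sparse_matrix M W \<phi> \<longleftrightarrow>
     (\<forall>N i j. i < N \<longrightarrow> j < N \<longrightarrow>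
        W N i j \<in> borel_measurable (M N) \<and>
        (\<forall>\<omega>\<in>space (M N). W N i j \<omega> = W N j i \<omega> \<and> W N i i \<omega> = 0) \<and>
        (\<forall>k. integrable (M N) (\<lambda>\<omega>. \<bar>W N i j \<omega>\<bar> ^ k)) \<and>
        (\<integral>\<omega>. W N i j \<omega> \<partial>M N) = 0) \<and>
     (\<forall>N. prob_space.indep_vars (M N) (\<lambda>_. borel) (\<lambda>(i, j). W N i j) {(i, j). i \<le> j \<and> j < N}) \<and>
     (\<forall>N i j. i < j \<longrightarrow> j < N \<longrightarrow>
        distr (M N) borel (W N i j) = distr (M N) borel (W N 0 1) \<and>
        (\<integral>\<omega>. (W N i j \<omega>)\<^sup>2 \<partial>M N) = 1 / real N) \<and>
     (\<exists>C>0. \<exists>c>0. \<forall>N i j k. i < N \<longrightarrow> j < N \<longrightarrow> 3 \<le> k \<longrightarrow>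
        (\<integral>\<omega>. \<bar>W N i j \<omega>\<bar> ^ k \<partial>M N)
          \<le> (C * real k) powr (c * real k) / (real N * sparsity \<phi> N ^ (k - 2))) \<and>
     (\<forall>k\<ge>1. \<exists>C. \<forall>N\<ge>2. \<bar>scaled_cumulant M W \<phi> k N\<bar> \<le> C) \<and>
     (\<exists>c>0. \<forall>N\<ge>2. c \<le> scaled_cumulant M W \<phi> 4 N)"


section \<open>The potential, the stability condition and the event\<close>

definition stieltjes_domain :: "real measure \<Rightarrow> complex set \<Rightarrow> bool" where
  "stieltjes_domain \<nu> D \<longleftrightarrow>
     compact D \<and> D \<subseteq> {z. 0 \<le> Im z} \<and> D \<inter> complex_of_real ` msupp \<nu> = {}"

text \<open>
  Here \<open>\<Theta> = {0..lmax}\<close> and the stability conditions are uniform in it. The conditions special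
  to deterministic and to random potentials are kept apart.
\<close>

definition limiting_potential_law :: "real measure \<Rightarrow> real \<Rightarrow> real \<Rightarrow> bool" where
  "limiting_potential_law \<nu> lmax varpi \<longleftrightarrow>
     prob_space \<nu> \<and> sets \<nu> = sets borel \<and> compact (msupp \<nu>) \<and> moment \<nu> 1 = 0 \<and>
     (\<forall>l\<in>{0..lmax}. stable_at_level ((1 + varpi) * l\<^sup>2) \<nu>)"

definition bounded_potential ::
  "(nat \<Rightarrow> 'w measure) \<Rightarrow> (nat \<Rightarrow> nat \<Rightarrow> 'w \<Rightarrow> real) \<Rightarrow> bool" where
  "bounded_potential M V \<longleftrightarrow>
     (\<forall>N i. i < N \<longrightarrow> V N i \<in> borel_measurable (M N)) \<and>
     (\<exists>K. \<forall>N i. i < N \<longrightarrow> (AE \<omega> in M N. \<bar>V N i \<omega>\<bar> \<le> K))"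

definition deterministic_potential ::
  "(nat \<Rightarrow> 'w measure) \<Rightarrow> (nat \<Rightarrow> nat \<Rightarrow> 'w \<Rightarrow> real) \<Rightarrow> real measure \<Rightarrow>
   real \<Rightarrow> real \<Rightarrow> real \<Rightarrow> bool" where
  "deterministic_potential M V \<nu> lmax varpi a\<^sub>0 \<longleftrightarrow>
     (\<exists>v. (\<forall>N i. i < N \<longrightarrow> (\<forall>\<omega>\<in>space (M N). V N i \<omega> = v N i)) \<and>
        weak_conv_m (\<lambda>N. empirical N (v N)) \<nu> \<and>
        (\<forall>D. stieltjes_domain \<nu> D \<longrightarrow>
           (\<exists>C. \<forall>\<^sub>F N in sequentially. \<forall>z\<in>D.
              norm (stieltjes (empirical N (v N)) z - stieltjes \<nu> z) \<le> C * real N powr - a\<^sub>0)) \<and>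
        (\<forall>\<^sub>F N in sequentially.
           \<forall>l\<in>{0..lmax}. stable_at_level ((1 + varpi) * l\<^sup>2) (empirical N (v N))))"

text \<open>
  Mutual independence of the disjoint union of the families \<open>V\<^sub>i\<close> and \<open>W\<^sub>i\<^sub>j\<close>, \<open>i \<le> j\<close>, says
  that the \<open>V\<^sub>i\<close> are independent and that they are independent of \<open>W\<close>. The third condition is
  weak convergence in probability.
\<close>

definition random_potential ::
  "(nat \<Rightarrow> 'w measure) \<Rightarrow> (nat \<Rightarrow> nat \<Rightarrow> nat \<Rightarrow> 'w \<Rightarrow> real) \<Rightarrow> (nat \<Rightarrow> nat \<Rightarrow> 'w \<Rightarrow> real) \<Rightarrow>
   real measure \<Rightarrow> real \<Rightarrow> real \<Rightarrow> bool" where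
  "random_potential M W V \<nu> lmax varpi \<longleftrightarrow>
     (\<forall>N i. i < N \<longrightarrow> distr (M N) borel (V N i) = \<nu>) \<and>
     (\<forall>N. prob_space.indep_vars (M N) (\<lambda>_. borel) (case_sum (V N) (\<lambda>(i, j). W N i j))
            ({..<N} <+> {(i, j). i \<le> j \<and> j < N})) \<and>
     (\<forall>f :: real \<Rightarrow> real. continuous_on UNIV f \<longrightarrow> bounded (range f) \<longrightarrow>
        (\<forall>e>0. (\<lambda>N. measure (M N) {\<omega>\<in>space (M N).
           e < \<bar>(\<integral>x. f x \<partial>empirical N (\<lambda>i. V N i \<omega>)) - (\<integral>x. f x \<partial>\<nu>)\<bar>}) \<longlonglongrightarrow> 0)) \<and>
     (\<exists>t>0. \<forall>\<^sub>F N in sequentially. \<exists>A\<in>sets (M N).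
        1 - real N powr - t \<le> measure (M N) A \<and>
        (\<forall>\<omega>\<in>A. \<forall>l\<in>{0..lmax}. stable_at_level ((1 + varpi) * l\<^sup>2) (empirical N (\<lambda>i. V N i \<omega>))))"

text \<open>
  Since the second and third requirements only become bounds for large \<open>N\<close>, with constants that
  may depend on the compact sets but not on the sample point, \<open>\<Xi>\<close> is a property of a sequence of
  events: for any choice of these constants and thresholds, the events so obtained and all their
  measurable subevents satisfy the predicate. The coupling constant at size \<open>N\<close> is \<open>lam N\<close>.
\<close>

definition event_Xi ::
  "bool \<Rightarrow> (nat \<Rightarrow> 'w measure) \<Rightarrow> (nat \<Rightarrow> nat \<Rightarrow> 'w \<Rightarrow> real) \<Rightarrow> real measure \<Rightarrow>
   (nat \<Rightarrow> real) \<Rightarrow> real \<Rightarrow> real \<Rightarrow> real \<Rightarrow> (nat \<Rightarrow> 'w set) \<Rightarrow> bool" where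
  "event_Xi rnd M V \<nu> lam lmax varpi a \<Xi> \<longleftrightarrow>
     (\<forall>N. \<Xi> N \<in> sets (M N)) \<and>
     (\<forall>N. \<forall>\<omega>\<in>\<Xi> N. stable_at_level ((1 + varpi) * (lam N)\<^sup>2) (empirical N (\<lambda>i. V N i \<omega>))) \<and>
     (\<forall>D. stieltjes_domain \<nu> D \<longrightarrow>
        (\<exists>C. \<forall>\<^sub>F N in sequentially. \<forall>\<omega>\<in>\<Xi> N. \<forall>z\<in>D.
           norm (stieltjes (empirical N (\<lambda>i. V N i \<omega>)) z - stieltjes \<nu> z) \<le> C * real N powr - a)) \<and>
     (rnd \<longrightarrow>
       (\<forall>T D. compact T \<longrightarrow> compact D \<longrightarrow> T \<subseteq> {0..lmax} \<longrightarrow> D \<subseteq> {z. 0 \<le> Im z} \<longrightarrow>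
          (\<exists>\<kappa>>0. \<forall>l\<in>T. \<forall>z\<in>D. \<forall>v\<in>supp_hull \<nu>. \<kappa> \<le> norm (complex_of_real (l * v) - z)) \<longrightarrow>
          (\<exists>C. \<forall>\<^sub>F N in sequentially. \<forall>\<omega>\<in>\<Xi> N. \<forall>l\<in>T. \<forall>z\<in>D. l \<noteq> 0 \<longrightarrow>
             norm (stieltjes_scaled l (empirical N (\<lambda>i. V N i \<omega>)) z - stieltjes_scaled l \<nu> z) / l
               \<le> C * real N powr - a)))"

text \<open>
  Validity on the events \<open>\<Xi>\<close>. For random potentials the exceptional part of \<open>\<Xi> N\<close> is covered by
  an event of probability at most \<open>N\<^bsup>-D\<^esup>\<close>, for every \<open>D\<close> and large \<open>N\<close>; for deterministic ones
  it is empty for large \<open>N\<close>.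
\<close>

definition holds_on ::
  "bool \<Rightarrow> (nat \<Rightarrow> 'w measure) \<Rightarrow> (nat \<Rightarrow> 'w set) \<Rightarrow> (nat \<Rightarrow> 'w \<Rightarrow> bool) \<Rightarrow> bool" where
  "holds_on rnd M \<Xi> P \<longleftrightarrow>
     (if rnd
      then \<forall>D>0. \<forall>\<^sub>F N in sequentially. \<exists>A\<in>sets (M N).
             {\<omega>\<in>\<Xi> N. \<not> P N \<omega>} \<subseteq> A \<and> measure (M N) A \<le> real N powr - D
      else \<forall>\<^sub>F N in sequentially. \<forall>\<omega>\<in>\<Xi> N. P N \<omega>)"


section \<open>Moments and edges of the smeared measure\<close>

text \<open>
  Moments of the smeared measure of \<open>\<mu>\<close> with shift \<open>sqrt s / q\<close>. The first moment vanishes and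
  the third is \<open>l\<^sup>3\<close> times that of \<open>\<mu>\<close> when \<open>\<mu>\<close> is centered; an empirical measure of random
  points is not, and the first and third moments are stated so as to cover this case too.
\<close>

definition smeared_moments :: "real \<Rightarrow> real \<Rightarrow> real \<Rightarrow> real measure \<Rightarrow> bool" where
  "smeared_moments l s q \<mu> \<longleftrightarrow>
     (let m = moment (smeared l (sqrt s / q) \<mu>) in
      (moment \<mu> 1 = 0 \<longrightarrow> m 1 = 0 \<and> m 3 = l ^ 3 * moment \<mu> 3) \<and>
      m 1 = l * moment \<mu> 1 \<and>
      m 2 = l\<^sup>2 * moment \<mu> 2 + s / q\<^sup>2 \<and>
      m 3 = l ^ 3 * moment \<mu> 3 + 3 * s * l / q\<^sup>2 * moment \<mu> 1 \<and>
      m 4 = l ^ 4 * moment \<mu> 4 + 6 * s * l\<^sup>2 / q\<^sup>2 * moment \<mu> 2 + s\<^sup>2 / q ^ 4)"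

text \<open>
  The size of the error in the expansion of the edges in terms of the moments \<open>m\<close>. The error
  \<open>l\<^sup>5 + q\<^sup>-\<^sup>6\<close> alone is not attained if the third moment does not vanish: for centered \<open>\<mu>\<close> the
  next term in the expansion is \<open>4 s m\<^sub>3 / q\<^sup>2\<close>, of order \<open>l\<^sup>3 q\<^sup>-\<^sup>2\<close>, which dominates
  \<open>l\<^sup>5 + q\<^sup>-\<^sup>6\<close> when \<open>q\<^bsup>-4/3\<^esup>\<close> is much smaller than \<open>l\<close> and \<open>l\<close> much smaller than \<open>q\<^sup>-\<^sup>1\<close>. The
  last summand vanishes for centered measures; it comes from the use of raw moments.
\<close>

definition edge_error :: "real \<Rightarrow> real \<Rightarrow> (nat \<Rightarrow> real) \<Rightarrow> real" where
  "edge_error l q m = l ^ 5 + 1 / q ^ 6 + \<bar>m 3\<bar> / q\<^sup>2 + \<bar>m 1\<bar> * (\<bar>m 1\<bar> + m 2)"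

end

theory Submission
  imports Defs
begin

text \<open>
  Let \<open>\<rho>\<close> be the free convolution of the semicircle law with a compactly supported law \<open>\<mu>\<close>.
  Subordination gives \<open>m\<^sub>\<rho>(z) = m\<^sub>\<mu>(z + m\<^sub>\<rho>(z))\<close>, so \<open>\<xi> = z + m\<^sub>\<rho>(z)\<close> solves
  \<open>\<xi> - m\<^sub>\<mu>(\<xi>) = z\<close> with \<open>\<integral> |v - \<xi>|\<^sup>-\<^sup>2 d\<mu> \<le> 1\<close>. By the equality case of the Cauchy-Schwarz
  inequality there is at most one such \<open>\<xi>\<close> in the closed upper half plane, and by Fatou's lemma
  the stability condition keeps limits of solutions away from the hull of the support.
  Compactness then extends \<open>\<xi>\<close> continuously to the real line, where \<open>Im \<xi> / \<pi>\<close> is the density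
  of \<open>\<rho>\<close> by Stieltjes inversion. It vanishes exactly at the values of
  \<open>\<phi>(x) = x + \<integral> (x - v)\<^sup>-\<^sup>1 d\<mu>\<close> at the \<open>x\<close> outside the hull with \<open>\<integral> (x - v)\<^sup>-\<^sup>2 d\<mu> \<le> 1\<close>, which
  fill two half-lines. The upper edge is therefore the minimum of the convex function \<open>\<phi>\<close> to
  the right of the support, and evaluating \<open>\<phi>\<close> at the approximate minimizer \<open>1 + 3/2 m\<^sub>2\<close> yields
  the expansion.

  The stability of the smeared measure follows from that of \<open>\<nu>\<close> through the regularized
  integral \<open>\<integral> ((v - x)\<^sup>2 + h\<^sup>2)\<^sup>-\<^sup>1 d\<mu> = Im m\<^sub>\<mu>(x + i h) / h\<close>, on which the convergence of transforms
  is uniform. Convergence on real compact sets rules out atoms away from the support of \<open>\<nu>\<close>.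
\<close>

section \<open>The semicircle law\<close>

text \<open>The integral in the stability condition is infinite at atoms and not continuous in the
  measure, and the hull over which its infimum is taken may be larger for the empirical measure than
  for \<open>\<nu>\<close>. At a fixed height \<open>h\<close> the regularized integral is finite,
  bounds the original one from below and moves little with the transform, so one part of
  \<open>varpi\<close> is spent on regularizing and another on the approximation. It cannot see a
  single atom of mass 1/N far from the hull, although such an atom widens the hull; on the real
  axis, however, the transform is unbounded near that atom. All this concerns a coupling that stays
  constant. If \<open>\<beta>\<close> is positive, the smeared support shrinks to a point and its
  stability is immediate. In the edge expansion, the fifth moment of the smeared measure and the
  product of its second and third moments contain multiples of \<open>m 3 * s / q^2\<close>; these
  are the origin of that term in \<open>edge_error\<close>.\<close>

lemma joukowski_preimage:
  fixes w :: complex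
  assumes "0 < Im w"
  obtains \<zeta> where "norm \<zeta> < 1" "\<zeta> \<noteq> 0" "w = \<zeta> + 1 / \<zeta>"
proof -
  define \<zeta> where "\<zeta> = (w + csqrt (w\<^sup>2 - 4)) / 2"
  have "2 * \<zeta> - w = csqrt (w\<^sup>2 - 4)" unfolding \<zeta>_def by (simp add: field_simps)
  then have "(2 * \<zeta> - w)\<^sup>2 = w\<^sup>2 - 4" by simp
  then have "4 * (\<zeta> * (w - \<zeta>)) = 4 * 1" by (simp add: power2_eq_square algebra_simps)
  then have root: "\<zeta> * (w - \<zeta>) = 1" by (simp only: mult_cancel_left) simp
  then have nz: "\<zeta> \<noteq> 0" by auto
  have w: "w = \<zeta> + 1 / \<zeta>" using root nz by (simp add: field_simps)
  \<comment> \<open>The two roots are inverse to each other. On the unit circle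
    \<open>1 / \<zeta>\<close> is the conjugate of \<open>\<zeta>\<close>, which would make
    \<open>w\<close> real; hence one of the roots lies strictly inside.\<close>
  have "norm \<zeta> \<noteq> 1"
  proof
    assume "norm \<zeta> = 1"
    then have "1 / \<zeta> = cnj \<zeta>"
      using complex_norm_square[of \<zeta>] nz by (simp add: field_simps)
    with w have "Im w = 0" by simp
    with assms show False by simp
  qed
  then consider "norm \<zeta> < 1" | "1 < norm \<zeta>" by linarith
  then show ?thesis
    using that[of \<zeta>] that[of "1 / \<zeta>"] w nz
    by cases (auto simp: add.commute norm_divide divide_less_eq)
qed

text \<open>
  Writing \<open>u = e\<^sup>i\<^sup>\<theta>\<close>, the kernel \<open>1 / (w - 2 cos \<theta>)\<close> is a multiple of
  \<open>1 + \<zeta>u / (1 - \<zeta>u) + (\<zeta>/u) / (1 - \<zeta>/u)\<close>, which has an explicit primitive.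
\<close>

lemma semicircle_primitive:
  fixes \<zeta> w :: complex and t :: real
  assumes "norm \<zeta> < 1" "\<zeta> \<noteq> 0" "w = \<zeta> + 1 / \<zeta>"
  shows "((\<lambda>t::real. w * of_real t + 2 * sin (of_real t) + (\<zeta> - 1 / \<zeta>) *
            (of_real t + \<i> * Ln (1 - \<zeta> * exp (\<i> * of_real t)) - \<i> * Ln (1 - \<zeta> * exp (- \<i> * of_real t))))
         has_vector_derivative 4 * (sin (of_real t))\<^sup>2 / (w - 2 * cos (of_real t))) (at t within S)"
proof -
  define u where "u = exp (\<i> * complex_of_real t)"
  have u0: "u \<noteq> 0" by (simp add: u_def)
  have u1: "exp (- \<i> * complex_of_real t) = 1 / u" by (simp add: u_def exp_minus field_simps)
  have nu: "norm u = 1" by (simp add: u_def)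
  \<comment> \<open>Both logarithms are taken at points within distance less than 1 of 1, so the
    principal branch is smooth along the whole path.\<close>
  have arg: "1 - x \<notin> \<real>\<^sub>\<le>\<^sub>0" if "norm x < 1" for x :: complex
  proof -
    have "\<bar>Re x\<bar> < 1" using abs_Re_le_cmod[of x] that by linarith
    then show ?thesis by (auto simp: complex_nonpos_Reals_iff)
  qed
  have n1: "norm (\<zeta> * u) < 1" "norm (\<zeta> * (1 / u)) < 1"
    using assms(1) nu by (auto simp: norm_mult norm_divide)
  have a1: "1 - \<zeta> * exp (\<i> * of_real t) \<notin> \<real>\<^sub>\<le>\<^sub>0" using arg[OF n1(1)] by (simp add: u_def)
  have a2: "1 - \<zeta> * exp (- \<i> * of_real t) \<notin> \<real>\<^sub>\<le>\<^sub>0" using arg[OF n1(2)] u1 by simp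
  have z1: "1 - \<zeta> * u \<noteq> 0" using n1(1) by auto
  have z2: "1 - \<zeta> * (1 / u) \<noteq> 0" using n1(2) by auto
  have z3: "u - \<zeta> \<noteq> 0" using z2 u0 by (auto simp: field_simps)
  have c: "2 * cos (complex_of_real t) = u + 1 / u"
    by (simp add: cos_exp_eq u_def exp_minus field_simps)
  have s: "4 * (sin (complex_of_real t))\<^sup>2 = - (u - 1 / u)\<^sup>2"
    by (simp add: sin_exp_eq u_def exp_minus field_simps power2_eq_square)
  have den: "w - 2 * cos (complex_of_real t) = (1 - \<zeta> * u) * (u - \<zeta>) / (\<zeta> * u)"
    unfolding c assms(3) using u0 assms(2) by (simp add: field_simps)
  let ?G = "1 + \<i> * (inverse (1 - \<zeta> * u) * (- (\<zeta> * (u * \<i>))))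
          - \<i> * (inverse (1 - \<zeta> * (1 / u)) * (- (\<zeta> * (1 / u * (- \<i>)))))"
  have key: "w + 2 * cos (of_real t) + (\<zeta> - 1 / \<zeta>) * ?G
     = 4 * (sin (of_real t))\<^sup>2 / (w - 2 * cos (of_real t))"
  proof -
    have r: "inverse (1 - \<zeta> * (1 / u)) = u / (u - \<zeta>)" using u0 z3 z2 by (simp add: field_simps)
    have "?G
        = 1 + \<zeta> * u / (1 - \<zeta> * u) + \<zeta> / (u - \<zeta>)"
    proof -
      have "\<i> * (u / (u - \<zeta>) * (- (\<zeta> * (1 / u * (- \<i>))))) = - (\<zeta> / (u - \<zeta>))"
      proof -
        have "\<i> * (u / d * (- (\<zeta> * (1 / u * (- \<i>))))) = - (\<zeta> / d)" if "d \<noteq> 0" for d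
          using u0 that by (simp add: field_simps)
        then show ?thesis using z3 .
      qed
      moreover have "\<i> * (inverse (1 - \<zeta> * u) * (- (\<zeta> * (u * \<i>)))) = \<zeta> * u / (1 - \<zeta> * u)"
        by (simp add: divide_inverse algebra_simps)
      ultimately show ?thesis unfolding r by (simp only:) simp
    qed
    also have "\<dots> = u * (1 - \<zeta>\<^sup>2) / ((1 - \<zeta> * u) * (u - \<zeta>))"
      using z1 z3 by (simp add: field_simps power2_eq_square)
    finally have e1: "?G
        = u * (1 - \<zeta>\<^sup>2) / ((1 - \<zeta> * u) * (u - \<zeta>))" .
    have e2: "(\<zeta> - 1 / \<zeta>) * (u * (1 - \<zeta>\<^sup>2) / ((1 - \<zeta> * u) * (u - \<zeta>)))
       = - (u * (1 - \<zeta>\<^sup>2)\<^sup>2) / (\<zeta> * ((1 - \<zeta> * u) * (u - \<zeta>)))"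
      using z1 z3 assms(2) by (simp add: field_simps power2_eq_square)
    have e3: "w + 2 * cos (of_real t) = (\<zeta> + u) * (1 + \<zeta> * u) / (\<zeta> * u)"
      unfolding c assms(3) using u0 assms(2) by (simp add: field_simps)
    define d where "d = (1 - \<zeta> * u) * (u - \<zeta>)"
    have d0: "d \<noteq> 0" using z1 z3 by (simp add: d_def)
    have e4: "4 * (sin (of_real t))\<^sup>2 / (w - 2 * cos (of_real t)) = - ((u\<^sup>2 - 1)\<^sup>2 * \<zeta>) / (u * d)"
      unfolding den s d_def[symmetric] using u0 d0 assms(2) by (simp add: field_simps power2_eq_square)
    have "(\<zeta> + u) * (1 + \<zeta> * u) / (\<zeta> * u) + - (u * (1 - \<zeta>\<^sup>2)\<^sup>2) / (\<zeta> * d)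
        = ((\<zeta> + u) * (1 + \<zeta> * u) * d - u\<^sup>2 * (1 - \<zeta>\<^sup>2)\<^sup>2) / (\<zeta> * u * d)"
      using u0 assms(2) d0 by (simp add: field_simps power2_eq_square)
    also have "(\<zeta> + u) * (1 + \<zeta> * u) * d - u\<^sup>2 * (1 - \<zeta>\<^sup>2)\<^sup>2 = - ((u\<^sup>2 - 1)\<^sup>2 * \<zeta>\<^sup>2)"
      unfolding d_def by (simp add: algebra_simps power2_eq_square)
    also have "- ((u\<^sup>2 - 1)\<^sup>2 * \<zeta>\<^sup>2) / (\<zeta> * u * d) = - ((u\<^sup>2 - 1)\<^sup>2 * \<zeta>) / (u * d)"
      using assms(2) by (simp add: power2_eq_square)
    finally show ?thesis unfolding e1 e2 e3 e4 unfolding d_def .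
  qed
  show ?thesis
    apply (rule has_vector_derivative_real_field)
    apply (rule derivative_eq_intros refl a1 a2 | (simp; fail))+
    using key assms(2) unfolding u1[symmetric] unfolding u_def
    by (simp add: algebra_simps)
qed

text \<open>The substitution \<open>x = 2 cos t\<close> turns the integral into the one whose
  primitive was just found.\<close>

lemma semicircle_transform:
  assumes w: "0 < Im w" and \<zeta>: "norm \<zeta> < 1" "\<zeta> \<noteq> 0" "w = \<zeta> + 1 / \<zeta>"
  shows "stieltjes semicircle w = - \<zeta>"
proof -
  define A where "A t = w * of_real t + 2 * sin (of_real t) + (\<zeta> - 1 / \<zeta>) *
            (of_real t + \<i> * Ln (1 - \<zeta> * exp (\<i> * of_real t)) - \<i> * Ln (1 - \<zeta> * exp (- \<i> * of_real t)))"
    for t :: real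
  have A: "(A has_vector_derivative 4 * (sin (of_real t))\<^sup>2 / (w - 2 * cos (of_real t))) (at t within S)" for t S
    using semicircle_primitive[OF \<zeta>, of t S] unfolding A_def .
  have nw: "complex_of_real x - w \<noteq> 0" for x using w by (auto simp: complex_eq_iff)
  define h where "h x = sqrt (4 - x\<^sup>2) *\<^sub>R (1 / (complex_of_real x - w))" for x :: real
  \<comment> \<open>\<open>arccos\<close> is not differentiable at the endpoints, so a version of
    the fundamental theorem is used that asks only for continuity there.\<close>
  have ftc: "(h has_integral (A (arccos (2 / 2)) - A (arccos (- 2 / 2)))) {-2..2}"
  proof (rule fundamental_theorem_of_calculus_interior)
    have "continuous_on UNIV A"
      using A by (intro continuous_on_vector_derivative)
    moreover have "continuous_on {-2..2} (\<lambda>x::real. arccos (x / 2))"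
      by (intro continuous_intros) auto
    ultimately show "continuous_on {-2..2} (\<lambda>x. A (arccos (x / 2)))"
      using continuous_on_compose2 by blast
  next
    fix x :: real assume x: "x \<in> {-2<..<2}"
    define t where "t = arccos (x / 2)"
    have ct: "cos t = x / 2" unfolding t_def using x by (intro cos_arccos) auto
    have x2: "x\<^sup>2 < 4" using x abs_square_less_1[of "x/2"] by (auto simp: power_divide)
    have sq: "sqrt (1 - (x / 2)\<^sup>2) = sqrt (4 - x\<^sup>2) / 2"
    proof -
      have "1 - (x / 2)\<^sup>2 = (4 - x\<^sup>2) / 4" by (simp add: power_divide)
      then show ?thesis by (simp only: real_sqrt_divide real_sqrt_four)
    qed
    have d: "((\<lambda>x. arccos (x / 2)) has_real_derivative - 1 / sqrt (4 - x\<^sup>2)) (at x)"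
    proof -
      have "(arccos has_real_derivative inverse (- sqrt (1 - (x / 2)\<^sup>2))) (at (x / 2))"
        by (rule DERIV_arccos) (use x in auto)
      moreover have "((\<lambda>x. x / 2) has_real_derivative 1 / 2) (at x)"
        by (auto intro!: derivative_eq_intros)
      ultimately have "((\<lambda>x. arccos (x / 2)) has_real_derivative inverse (- sqrt (1 - (x / 2)\<^sup>2)) * (1 / 2)) (at x)"
        by (rule DERIV_chain2)
      then show ?thesis unfolding sq by (simp add: field_simps)
    qed
    have "((A \<circ> (\<lambda>x. arccos (x / 2))) has_vector_derivative
        (- 1 / sqrt (4 - x\<^sup>2)) *\<^sub>R (4 * (sin (of_real t))\<^sup>2 / (w - 2 * cos (of_real t)))) (at x)"
      using vector_diff_chain_at[OF d[unfolded has_real_derivative_iff_has_vector_derivative] A]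
      unfolding t_def by simp
    moreover have "(- 1 / sqrt (4 - x\<^sup>2)) *\<^sub>R (4 * (sin (of_real t))\<^sup>2 / (w - 2 * cos (of_real t))) = h x"
    proof -
      have "(sin t)\<^sup>2 = 1 - (x / 2)\<^sup>2" using sin_squared_eq[of t] ct by simp
      then have "4 * (sin t)\<^sup>2 = 4 - x\<^sup>2" by (simp add: power_divide)
      then have s: "4 * (sin (complex_of_real t))\<^sup>2 = of_real (4 - x\<^sup>2)"
        by (metis of_real_mult of_real_numeral of_real_power sin_of_real)
      have c: "2 * cos (complex_of_real t) = of_real x"
      proof -
        have "complex_of_real x = of_real (2 * cos t)" by (simp only: ct) simp
        then show ?thesis by (simp add: cos_of_real)
      qed
      have r: "(4 - x\<^sup>2) / sqrt (4 - x\<^sup>2) = sqrt (4 - x\<^sup>2)" using x2 by (simp add: real_div_sqrt)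
      have "(- 1 / sqrt (4 - x\<^sup>2)) *\<^sub>R (of_real (4 - x\<^sup>2) / (w - of_real x))
          = of_real ((4 - x\<^sup>2) / sqrt (4 - x\<^sup>2)) * (- 1 / (w - of_real x))"
        by (simp add: scaleR_conv_of_real)
      also have "- 1 / (w - of_real x) = 1 / (of_real x - w)"
        by (metis minus_diff_eq minus_divide_right minus_divide_left)
      finally show ?thesis unfolding s c r h_def scaleR_conv_of_real .
    qed
    ultimately show "((\<lambda>x. A (arccos (x / 2))) has_vector_derivative h x) (at x)"
      by (simp add: o_def)
  qed simp
  have ex: "exp (\<i> * complex_of_real pi) = -1" "exp (- (\<i> * complex_of_real pi)) = -1"
    by (simp_all add: exp_minus)
  \<comment> \<open>At \<open>t = 0\<close> and \<open>t = pi\<close> the two exponentials coincide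
    and the logarithms cancel. The primitive is 0 at 0 and \<open>2 * pi * \<zeta>\<close> at
    \<open>pi\<close>.\<close>
  have val: "A (arccos (2 / 2)) - A (arccos (- 2 / 2)) = - 2 * pi * \<zeta>"
    using \<zeta>(2) by (simp add: A_def ex \<zeta>(3) algebra_simps)
  have hc: "continuous_on {-2..2} h"
    unfolding h_def using nw by (intro continuous_intros) auto
  have int: "integrable lborel (\<lambda>x. indicator {-2..2} x *\<^sub>R h x)"
    using borel_integrable_compact[OF _ hc] by simp
  have "((\<lambda>x. indicator {-2..2} x *\<^sub>R h x) has_integral (- 2 * pi * \<zeta>)) UNIV"
  proof -
    have "(\<lambda>x. indicator {-2..2} x *\<^sub>R h x) = (\<lambda>x. if x \<in> {-2..2} then h x else 0)"
      by (auto simp: fun_eq_iff)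
    then show ?thesis using ftc unfolding val by (simp only: has_integral_restrict_UNIV)
  qed
  then have I: "integral\<^sup>L lborel (\<lambda>x. indicator {-2..2} x *\<^sub>R h x) = - 2 * pi * \<zeta>"
    using has_integral_integral_lborel[OF int] has_integral_unique by blast
  have "stieltjes semicircle w
      = (\<integral>x. (sqrt (max 0 (4 - x\<^sup>2)) / (2 * pi)) *\<^sub>R (1 / (complex_of_real x - w)) \<partial>lborel)"
    unfolding stieltjes_def semicircle_def by (subst integral_density) auto
  also have "\<dots> = (\<integral>x. (1 / (2 * pi)) *\<^sub>R (indicator {-2..2} x *\<^sub>R h x) \<partial>lborel)"
  proof (intro Bochner_Integration.integral_cong refl)
    fix x :: real
    have "sqrt (max 0 (4 - x\<^sup>2)) = indicator {-2..2} x * sqrt (4 - x\<^sup>2)"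
    proof (cases "x \<in> {-2..2}")
      case True
      then have "x\<^sup>2 \<le> 2\<^sup>2" by (intro power2_le_iff_abs_le[THEN iffD2]) auto
      then show ?thesis using True by simp
    next
      case False
      then have "2\<^sup>2 \<le> \<bar>x\<bar>\<^sup>2" by (intro power_mono) auto
      then show ?thesis using False by simp
    qed
    then show "(sqrt (max 0 (4 - x\<^sup>2)) / (2 * pi)) *\<^sub>R (1 / (complex_of_real x - w))
       = (1 / (2 * pi)) *\<^sub>R (indicator {-2..2} x *\<^sub>R h x)"
      by (simp add: h_def field_simps)
  qed
  also have "\<dots> = (1 / (2 * pi)) *\<^sub>R (- 2 * pi * \<zeta>)" by (simp only: integral_scaleR_right I)
  also have "\<dots> = - \<zeta>" by (simp add: scaleR_conv_of_real)
  finally show ?thesis .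
qed

text \<open>If \<open>\<omega>\<^sub>2 z = \<zeta> + 1 / \<zeta>\<close> with \<open>\<zeta>\<close>
  in the unit disc, the semicircle transform there is \<open>- \<zeta>\<close> and its negative
  reciprocal is \<open>1 / \<zeta>\<close>. The relation between the subordination functions then
  collapses to \<open>\<omega>\<^sub>1 z = z - \<zeta>\<close>.\<close>

lemma semicircle_free_convolution_fixed_point:
  assumes "is_free_add_conv semicircle \<mu> \<rho>" and z: "0 < Im z"
  shows "stieltjes \<rho> z = stieltjes \<mu> (z + stieltjes \<rho> z)"
proof -
  obtain \<omega>\<^sub>1 \<omega>\<^sub>2 where \<omega>: "Im z \<le> Im (\<omega>\<^sub>2 z)"
      "recip_stieltjes semicircle (\<omega>\<^sub>2 z) = recip_stieltjes \<mu> (\<omega>\<^sub>1 z)"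
      "\<omega>\<^sub>1 z + \<omega>\<^sub>2 z - z = recip_stieltjes semicircle (\<omega>\<^sub>2 z)"
      "recip_stieltjes \<rho> z = recip_stieltjes semicircle (\<omega>\<^sub>2 z)"
    using assms unfolding is_free_add_conv_def by blast
  obtain \<zeta> where \<zeta>: "norm \<zeta> < 1" "\<zeta> \<noteq> 0" "\<omega>\<^sub>2 z = \<zeta> + 1 / \<zeta>"
    using joukowski_preimage[of "\<omega>\<^sub>2 z"] \<omega>(1) z by auto
  have sc: "stieltjes semicircle (\<omega>\<^sub>2 z) = - \<zeta>"
    using semicircle_transform[OF _ \<zeta>] \<omega>(1) z by simp
  \<comment> \<open>Division by 0 yields 0, so a vanishing transform has to be excluded: its
    reciprocal would be 0 and not \<open>1 / \<zeta>\<close>.\<close>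
  have \<rho>: "stieltjes \<rho> z = - \<zeta>"
    using \<omega>(4) \<zeta>(2) unfolding recip_stieltjes_def sc
    by (cases "stieltjes \<rho> z = 0") (auto simp: field_simps)
  have \<mu>: "stieltjes \<mu> (\<omega>\<^sub>1 z) = - \<zeta>"
    using \<omega>(2) \<zeta>(2) unfolding recip_stieltjes_def sc
    by (cases "stieltjes \<mu> (\<omega>\<^sub>1 z) = 0") (auto simp: field_simps)
  have "\<omega>\<^sub>1 z = z + 1 / \<zeta> - \<omega>\<^sub>2 z"
    using \<omega>(3) unfolding recip_stieltjes_def sc by (simp add: algebra_simps)
  then have "\<omega>\<^sub>1 z = z - \<zeta>" using \<zeta>(3) by simp
  with \<mu> \<rho> show ?thesis by simp
qed

section \<open>Transforms of compactly supported laws\<close>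

lemma Im_stieltjes_kernel:
  "Im (1 / (complex_of_real v - \<xi>)) = Im \<xi> * (1 / (cmod (of_real v - \<xi>))\<^sup>2)"
  by (simp add: Im_divide cmod_power2)

text \<open>Fatou's lemma. In the extended reals the inverse is continuous also at 0, so the limit
  point may lie in the support, where a real-valued kernel would jump.\<close>

lemma nn_kernel_lower_limit:
  fixes \<mu> :: "real measure" and \<xi> :: "nat \<Rightarrow> complex"
  assumes [measurable_cong]: "sets \<mu> = sets borel" and lim: "\<xi> \<longlonglongrightarrow> \<xi>\<^sub>0"
    and bound: "\<And>n. (\<integral>\<^sup>+v. inverse (ennreal ((cmod (of_real v - \<xi> n))\<^sup>2)) \<partial>\<mu>) \<le> c"
  shows "(\<integral>\<^sup>+v. inverse (ennreal ((cmod (of_real v - \<xi>\<^sub>0))\<^sup>2)) \<partial>\<mu>) \<le> c"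
proof -
  have "(\<lambda>n. inverse (ennreal ((cmod (of_real v - \<xi> n))\<^sup>2)))
      \<longlonglongrightarrow> inverse (ennreal ((cmod (of_real v - \<xi>\<^sub>0))\<^sup>2))" for v
  proof -
    have "(\<lambda>n. ennreal ((cmod (of_real v - \<xi> n))\<^sup>2)) \<longlonglongrightarrow> ennreal ((cmod (of_real v - \<xi>\<^sub>0))\<^sup>2)"
      by (intro tendsto_intros lim)
    moreover have cont: "continuous_on UNIV (\<lambda>x::ennreal. inverse x)" by (intro continuous_intros)
    ultimately show ?thesis by (intro continuous_on_tendsto_compose[OF cont]) auto
  qed
  then have "liminf (\<lambda>n. inverse (ennreal ((cmod (of_real v - \<xi> n))\<^sup>2)))
      = inverse (ennreal ((cmod (of_real v - \<xi>\<^sub>0))\<^sup>2))" for v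
    by (intro lim_imp_Liminf) auto
  then have "(\<integral>\<^sup>+v. inverse (ennreal ((cmod (of_real v - \<xi>\<^sub>0))\<^sup>2)) \<partial>\<mu>)
      = (\<integral>\<^sup>+v. liminf (\<lambda>n. inverse (ennreal ((cmod (of_real v - \<xi> n))\<^sup>2))) \<partial>\<mu>)" by simp
  also have "\<dots> \<le> liminf (\<lambda>n. \<integral>\<^sup>+v. inverse (ennreal ((cmod (of_real v - \<xi> n))\<^sup>2)) \<partial>\<mu>)"
    by (intro nn_integral_liminf) measurable
  also have "\<dots> \<le> c"
    by (rule Liminf_le) (use bound in auto)
  finally show ?thesis .
qed

text \<open>The interval is any one that carries the mass, not necessarily the hull of the support;
  one measure is viewed with several intervals below.\<close>

locale compact_law = prob_space \<mu> for \<mu> :: "real measure" +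
  fixes a b :: real
  assumes sets_eq [measurable_cong]: "sets \<mu> = sets borel"
    and AE_bounds: "AE v in \<mu>. a \<le> v \<and> v \<le> b"
begin

abbreviation hullC :: "complex set" where
  "hullC \<equiv> complex_of_real ` {a..b}"

text \<open>Off the real axis this is the ratio of the imaginary parts of the transform and of
  \<open>\<xi>\<close>. At real points outside the interval it is the derivative of the transform,
  so that \<open>g \<xi> \<le> 1\<close> says that \<open>\<xi> - stieltjes \<mu> \<xi>\<close> does
  not decrease there.\<close>

definition g :: "complex \<Rightarrow> real" where
  "g \<xi> = (\<integral>v. 1 / (cmod (of_real v - \<xi>))\<^sup>2 \<partial>\<mu>)"

lemma hull_distance:
  assumes "\<xi> \<notin> hullC"
  obtains d where "0 < d" "\<And>v. a \<le> v \<Longrightarrow> v \<le> b \<Longrightarrow> d \<le> cmod (of_real v - \<xi>)"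
proof -
  have closed: "closed hullC"
    by (intro compact_imp_closed compact_continuous_image continuous_intros compact_Icc)
  then obtain d where "0 < d" "\<And>x. x \<in> hullC \<Longrightarrow> d \<le> dist \<xi> x"
    using separate_point_closed[OF closed assms] by blast
  then have "d \<le> cmod (of_real v - \<xi>)" if "a \<le> v" "v \<le> b" for v
    using that by (force simp: dist_norm norm_minus_commute)
  then show ?thesis using that \<open>0 < d\<close> by blast
qed

lemma notin_hullC: "0 < Im \<xi> \<Longrightarrow> \<xi> \<notin> hullC" "\<xi> \<notin> hullC \<Longrightarrow> a \<le> v \<Longrightarrow> v \<le> b \<Longrightarrow> of_real v - \<xi> \<noteq> 0"
  "of_real x \<notin> hullC \<longleftrightarrow> x < a \<or> b < x"
  by auto

lemma a_le_b: "a \<le> b"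
proof -
  have "AE v in \<mu>. a \<le> b" using AE_bounds by eventually_elim auto
  then show ?thesis by simp
qed

lemma measurable_kernel:
  assumes "k \<in> borel_measurable borel"
  shows "(\<lambda>v. k (complex_of_real v - \<xi>)) \<in> borel_measurable \<mu>"
proof -
  have "(\<lambda>v. complex_of_real v - \<xi>) \<in> borel_measurable \<mu>" by measurable
  then show ?thesis using assms by (rule measurable_compose)
qed

lemma integrable_kernel:
  fixes k :: "complex \<Rightarrow> 'c::{banach, second_countable_topology}"
  assumes k: "k \<in> borel_measurable borel"
    and bounded: "\<And>d. 0 < d \<Longrightarrow> \<exists>B. \<forall>w. d \<le> cmod w \<longrightarrow> norm (k w) \<le> B"
    and \<xi>: "\<xi> \<notin> hullC"
  shows "integrable \<mu> (\<lambda>v. k (of_real v - \<xi>))"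
proof -
  obtain d where d: "0 < d" "\<And>v. a \<le> v \<Longrightarrow> v \<le> b \<Longrightarrow> d \<le> cmod (of_real v - \<xi>)"
    using hull_distance[OF \<xi>] by blast
  obtain B where B: "\<And>w. d \<le> cmod w \<Longrightarrow> norm (k w) \<le> B" using bounded[OF d(1)] by blast
  show ?thesis
  proof (rule integrable_const_bound[of _ B])
    show "AE v in \<mu>. norm (k (of_real v - \<xi>)) \<le> B"
      using AE_bounds by eventually_elim (rule B, rule d(2), auto)
  qed (rule measurable_kernel[OF k])
qed

text \<open>A general kernel lets the transform and \<open>g\<close> share one dominated convergence
  argument: near a point off the hull, the kernel is only evaluated away from its
  singularity.\<close>

lemma continuous_kernel:
  fixes k :: "complex \<Rightarrow> 'c::{banach, second_countable_topology}"
  assumes k: "k \<in> borel_measurable borel"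
    and bounded: "\<And>d. 0 < d \<Longrightarrow> \<exists>B. \<forall>w. d \<le> cmod w \<longrightarrow> norm (k w) \<le> B"
    and cont: "\<And>w. w \<noteq> 0 \<Longrightarrow> isCont k w"
  shows "continuous_on (- hullC) (\<lambda>\<xi>. \<integral>v. k (of_real v - \<xi>) \<partial>\<mu>)"
  unfolding continuous_on_sequentially o_def
proof (intro allI ballI impI, elim conjE)
  fix x :: "nat \<Rightarrow> complex" and \<xi> :: complex
  assume \<xi>: "\<xi> \<in> - hullC" and x: "\<forall>n. x n \<in> - hullC" and lim: "x \<longlonglongrightarrow> \<xi>"
  obtain d where d: "0 < d" "\<And>v. a \<le> v \<Longrightarrow> v \<le> b \<Longrightarrow> d \<le> cmod (of_real v - \<xi>)"
    using hull_distance[of \<xi>] \<xi> by blast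
  obtain B where B: "\<And>w. d / 2 \<le> cmod w \<Longrightarrow> norm (k w) \<le> B"
    using bounded[of "d / 2"] d(1) by auto
  obtain n\<^sub>0 where n0: "\<And>n. n \<ge> n\<^sub>0 \<Longrightarrow> cmod (x n - \<xi>) < d / 2"
    using LIMSEQ_D[OF lim, of "d / 2"] d(1) by auto
  have "(\<lambda>n. \<integral>v. k (of_real v - x (n + n\<^sub>0)) \<partial>\<mu>) \<longlonglongrightarrow> (\<integral>v. k (of_real v - \<xi>) \<partial>\<mu>)"
  proof (rule integral_dominated_convergence[where w = "\<lambda>_. B"])
    show "AE v in \<mu>. (\<lambda>n. k (of_real v - x (n + n\<^sub>0))) \<longlonglongrightarrow> k (of_real v - \<xi>)"
      using AE_bounds
    proof eventually_elim
      case (elim v)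
      have "isCont k (of_real v - \<xi>)" using notin_hullC(2)[of \<xi> v] \<xi> elim by (intro cont) auto
      moreover have "(\<lambda>n. of_real v - x (n + n\<^sub>0)) \<longlonglongrightarrow> of_real v - \<xi>"
        by (intro tendsto_intros LIMSEQ_ignore_initial_segment lim)
      ultimately show ?case by (rule isCont_tendsto_compose)
    qed
    show "AE v in \<mu>. norm (k (of_real v - x (n + n\<^sub>0))) \<le> B" for n
      using AE_bounds
    proof eventually_elim
      case (elim v)
      have "cmod (of_real v - \<xi>) \<le> cmod (of_real v - x (n + n\<^sub>0)) + cmod (x (n + n\<^sub>0) - \<xi>)"
        using norm_triangle_ineq[of "of_real v - x (n + n\<^sub>0)" "x (n + n\<^sub>0) - \<xi>"] by simp
      then show ?case using d(2)[of v] n0[of "n + n\<^sub>0"] elim by (intro B) auto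
    qed
  qed (simp_all add: measurable_kernel k)
  then show "(\<lambda>n. \<integral>v. k (of_real v - x n) \<partial>\<mu>) \<longlonglongrightarrow> (\<integral>v. k (of_real v - \<xi>) \<partial>\<mu>)"
    by (rule LIMSEQ_offset)
qed

lemma kernel_bounds:
  assumes "0 < d"
  shows "\<exists>B. \<forall>w. d \<le> cmod w \<longrightarrow> cmod (1 / w) \<le> B"
    and "\<exists>B. \<forall>w. d \<le> cmod w \<longrightarrow> norm (1 / (cmod w)\<^sup>2) \<le> B"
proof -
  have "cmod (1 / w) \<le> 1 / d" "norm (1 / (cmod w)\<^sup>2) \<le> 1 / d\<^sup>2" if "d \<le> cmod w" for w
    using assms that by (auto simp: norm_divide intro!: divide_left_mono power_mono mult_pos_pos)
  then show "\<exists>B. \<forall>w. d \<le> cmod w \<longrightarrow> cmod (1 / w) \<le> B"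
    "\<exists>B. \<forall>w. d \<le> cmod w \<longrightarrow> norm (1 / (cmod w)\<^sup>2) \<le> B" by blast+
qed

lemma integrable_stieltjes: "\<xi> \<notin> hullC \<Longrightarrow> integrable \<mu> (\<lambda>v. 1 / (complex_of_real v - \<xi>))"
  by (rule integrable_kernel[where k = "\<lambda>w. 1 / w"]) (use kernel_bounds in auto)

lemma integrable_g: "\<xi> \<notin> hullC \<Longrightarrow> integrable \<mu> (\<lambda>v. 1 / (cmod (of_real v - \<xi>))\<^sup>2)"
  by (rule integrable_kernel[where k = "\<lambda>w. 1 / (cmod w)\<^sup>2"]) (use kernel_bounds in auto)

lemma continuous_on_stieltjes: "continuous_on (- hullC) (stieltjes \<mu>)"
  unfolding stieltjes_def[abs_def]
  by (rule continuous_kernel[where k = "\<lambda>w. 1 / w"]) (use kernel_bounds in \<open>auto intro!: continuous_intros\<close>)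

lemma continuous_on_g: "continuous_on (- hullC) g"
  unfolding g_def[abs_def]
  by (rule continuous_kernel[where k = "\<lambda>w. 1 / (cmod w)\<^sup>2"])
    (use kernel_bounds in \<open>auto intro!: continuous_intros\<close>)

lemma nn_integral_kernel:
  assumes "\<xi> \<notin> hullC"
  shows "(\<integral>\<^sup>+v. inverse (ennreal ((cmod (of_real v - \<xi>))\<^sup>2)) \<partial>\<mu>) = ennreal (g \<xi>)"
proof -
  have "(\<integral>\<^sup>+v. inverse (ennreal ((cmod (of_real v - \<xi>))\<^sup>2)) \<partial>\<mu>)
      = (\<integral>\<^sup>+v. ennreal (1 / (cmod (of_real v - \<xi>))\<^sup>2) \<partial>\<mu>)"
  proof (rule nn_integral_cong_AE)
    show "AE v in \<mu>. inverse (ennreal ((cmod (of_real v - \<xi>))\<^sup>2)) = ennreal (1 / (cmod (of_real v - \<xi>))\<^sup>2)"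
      using AE_bounds
    proof eventually_elim
      case (elim v)
      then have "0 < (cmod (of_real v - \<xi>))\<^sup>2" using notin_hullC(2)[OF assms] by auto
      then show ?case by (simp add: inverse_ennreal inverse_eq_divide)
    qed
  qed
  also have "\<dots> = ennreal (g \<xi>)"
    unfolding g_def by (rule nn_integral_eq_integral[OF integrable_g[OF assms]]) auto
  finally show ?thesis .
qed

lemma Im_stieltjes:
  assumes "\<xi> \<notin> hullC"
  shows "Im (stieltjes \<mu> \<xi>) = Im \<xi> * g \<xi>"
proof -
  have "Im (stieltjes \<mu> \<xi>) = (\<integral>v. Im (1 / (complex_of_real v - \<xi>)) \<partial>\<mu>)"
    unfolding stieltjes_def by (rule integral_Im[symmetric, OF integrable_stieltjes[OF assms]])
  then show ?thesis unfolding Im_stieltjes_kernel g_def integral_mult_right_zero .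
qed

lemma integrable_product:
  assumes "\<xi>\<^sub>1 \<notin> hullC" "\<xi>\<^sub>2 \<notin> hullC"
  shows "integrable \<mu> (\<lambda>v. 1 / (complex_of_real v - \<xi>\<^sub>1) * (1 / (complex_of_real v - \<xi>\<^sub>2)))"
proof (rule Bochner_Integration.integrable_bound)
  show "integrable \<mu> (\<lambda>v. 1 / (cmod (of_real v - \<xi>\<^sub>1))\<^sup>2 + 1 / (cmod (of_real v - \<xi>\<^sub>2))\<^sup>2)"
    using integrable_g assms by simp
  have "x * y \<le> x\<^sup>2 + y\<^sup>2" for x y :: real
    using sum_squares_bound[of x y] zero_le_power2[of x] zero_le_power2[of y] by linarith
  from this[of "1 / cmod _" "1 / cmod _"]
  show "AE v in \<mu>. norm (1 / (complex_of_real v - \<xi>\<^sub>1) * (1 / (complex_of_real v - \<xi>\<^sub>2)))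
      \<le> norm (1 / (cmod (of_real v - \<xi>\<^sub>1))\<^sup>2 + 1 / (cmod (of_real v - \<xi>\<^sub>2))\<^sup>2)"
    by (simp add: norm_mult norm_divide power_divide)
qed measurable

lemma stieltjes_diff:
  assumes "\<xi>\<^sub>1 \<notin> hullC" "\<xi>\<^sub>2 \<notin> hullC"
  shows "stieltjes \<mu> \<xi>\<^sub>1 - stieltjes \<mu> \<xi>\<^sub>2
    = (\<xi>\<^sub>1 - \<xi>\<^sub>2) * (\<integral>v. 1 / (complex_of_real v - \<xi>\<^sub>1) * (1 / (complex_of_real v - \<xi>\<^sub>2)) \<partial>\<mu>)"
proof -
  have "stieltjes \<mu> \<xi>\<^sub>1 - stieltjes \<mu> \<xi>\<^sub>2
     = (\<integral>v. 1 / (complex_of_real v - \<xi>\<^sub>1) - 1 / (complex_of_real v - \<xi>\<^sub>2) \<partial>\<mu>)"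
    unfolding stieltjes_def by (simp add: integrable_stieltjes assms)
  also have "\<dots> = (\<integral>v. (\<xi>\<^sub>1 - \<xi>\<^sub>2) * (1 / (complex_of_real v - \<xi>\<^sub>1) * (1 / (complex_of_real v - \<xi>\<^sub>2))) \<partial>\<mu>)"
  proof (rule integral_cong_AE)
    show "AE v in \<mu>. 1 / (complex_of_real v - \<xi>\<^sub>1) - 1 / (complex_of_real v - \<xi>\<^sub>2)
      = (\<xi>\<^sub>1 - \<xi>\<^sub>2) * (1 / (complex_of_real v - \<xi>\<^sub>1) * (1 / (complex_of_real v - \<xi>\<^sub>2)))"
      using AE_bounds
    proof eventually_elim
      case (elim v)
      then have "of_real v - \<xi>\<^sub>1 \<noteq> 0" "of_real v - \<xi>\<^sub>2 \<noteq> 0" using notin_hullC(2) assms by blast+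
      then show ?case by (simp add: divide_simps)
    qed
  qed measurable
  finally show ?thesis unfolding integral_mult_right_zero .
qed

text \<open>This bound provides the compactness: solutions of the subordination equation stay within
  distance 1 of \<open>z\<close>. The inequality \<open>x \<le> (1 + x^2) / 2\<close> takes the
  place of Cauchy-Schwarz.\<close>

lemma norm_stieltjes_le_one:
  assumes "\<xi> \<notin> hullC" "g \<xi> \<le> 1"
  shows "cmod (stieltjes \<mu> \<xi>) \<le> 1"
proof -
  have int: "integrable \<mu> (\<lambda>v. (1 + 1 / (cmod (of_real v - \<xi>))\<^sup>2) / 2)"
    using integrable_g[OF assms(1)] by simp
  have "x \<le> (1 + x\<^sup>2) / 2" for x :: real
    using zero_le_power2[of "x - 1"] by (simp add: power2_diff)
  from this[of "1 / cmod _"]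
  have "cmod (1 / (complex_of_real v - \<xi>)) \<le> (1 + 1 / (cmod (of_real v - \<xi>))\<^sup>2) / 2" for v
    by (simp add: norm_divide power_divide)
  then have "cmod (stieltjes \<mu> \<xi>) \<le> (\<integral>v. (1 + 1 / (cmod (of_real v - \<xi>))\<^sup>2) / 2 \<partial>\<mu>)"
    unfolding stieltjes_def
    by (intro order_trans[OF integral_norm_bound] integral_mono int integrable_norm
        integrable_stieltjes assms)
  also have "\<dots> = (1 + g \<xi>) / 2"
    unfolding g_def using integrable_g[OF assms(1)] by (simp add: prob_space)
  finally show ?thesis using assms(2) by simp
qed

text \<open>
  If \<open>\<xi>\<^sub>1 \<noteq> \<xi>\<^sub>2\<close>, then \<open>\<integral> (v - \<xi>\<^sub>1)\<^sup>-\<^sup>1 (v - \<xi>\<^sub>2)\<^sup>-\<^sup>1 = 1\<close>, which is the equality case of the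
  Cauchy-Schwarz inequality, and this forces \<open>\<xi>\<^sub>1\<close> to be the conjugate of \<open>\<xi>\<^sub>2\<close>.
\<close>

lemma shifted_transform_injective:
  assumes \<xi>\<^sub>1: "\<xi>\<^sub>1 \<notin> hullC" "0 \<le> Im \<xi>\<^sub>1" "g \<xi>\<^sub>1 \<le> 1"
    and \<xi>\<^sub>2: "\<xi>\<^sub>2 \<notin> hullC" "0 \<le> Im \<xi>\<^sub>2" "g \<xi>\<^sub>2 \<le> 1"
    and eq: "\<xi>\<^sub>1 - stieltjes \<mu> \<xi>\<^sub>1 = \<xi>\<^sub>2 - stieltjes \<mu> \<xi>\<^sub>2"
  shows "\<xi>\<^sub>1 = \<xi>\<^sub>2"
proof (rule ccontr)
  assume ne: "\<xi>\<^sub>1 \<noteq> \<xi>\<^sub>2"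
  define p where "p v = 1 / (complex_of_real v - \<xi>\<^sub>1)" for v
  define r where "r v = 1 / (complex_of_real v - \<xi>\<^sub>2)" for v
  have "stieltjes \<mu> \<xi>\<^sub>1 - stieltjes \<mu> \<xi>\<^sub>2 = \<xi>\<^sub>1 - \<xi>\<^sub>2" using eq by (simp add: algebra_simps)
  then have one: "(\<integral>v. p v * r v \<partial>\<mu>) = 1"
    using stieltjes_diff[OF \<xi>\<^sub>1(1) \<xi>\<^sub>2(1)] ne by (simp add: p_def r_def)
  have int: "integrable \<mu> (\<lambda>v. p v * r v)"
    unfolding p_def r_def using \<xi>\<^sub>1 \<xi>\<^sub>2 by (intro integrable_product)
  have intp: "integrable \<mu> (\<lambda>v. (cmod (p v))\<^sup>2)" and intr: "integrable \<mu> (\<lambda>v. (cmod (r v))\<^sup>2)"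
    and gp: "g \<xi>\<^sub>1 = (\<integral>v. (cmod (p v))\<^sup>2 \<partial>\<mu>)" and gr: "g \<xi>\<^sub>2 = (\<integral>v. (cmod (r v))\<^sup>2 \<partial>\<mu>)"
    using integrable_g[OF \<xi>\<^sub>1(1)] integrable_g[OF \<xi>\<^sub>2(1)]
    by (simp_all add: p_def r_def norm_divide power_divide g_def)
  \<comment> \<open>With this expansion the integral of the square is
    \<open>g \<xi>\<^sub>1 + g \<xi>\<^sub>2 - 2\<close>, which is at most 0; so \<open>p\<close>
    and the conjugate of \<open>r\<close> agree almost everywhere.\<close>
  have sq: "(cmod (x - cnj y))\<^sup>2 = (cmod x)\<^sup>2 + (cmod y)\<^sup>2 - 2 * Re (x * y)" for x y
    unfolding cmod_power2 by (simp add: power2_eq_square algebra_simps)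
  define t where "t v = Re (p v * r v)" for v
  have intt: "integrable \<mu> t" unfolding t_def using int by (rule integrable_Re)
  have It: "(\<integral>v. t v \<partial>\<mu>) = Re (\<integral>v. p v * r v \<partial>\<mu>)" unfolding t_def using int by (rule integral_Re)
  have sqt: "(cmod (p v - cnj (r v)))\<^sup>2 = (cmod (p v))\<^sup>2 + (cmod (r v))\<^sup>2 - 2 * t v" for v
    unfolding t_def by (rule sq)
  have int2: "integrable \<mu> (\<lambda>v. (cmod (p v - cnj (r v)))\<^sup>2)"
    unfolding sqt using intt intp intr by simp
  have "(\<integral>v. (cmod (p v - cnj (r v)))\<^sup>2 \<partial>\<mu>) = g \<xi>\<^sub>1 + g \<xi>\<^sub>2 - 2 * Re (\<integral>v. p v * r v \<partial>\<mu>)"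
    unfolding sqt gp gr It[symmetric] using intt intp intr by simp
  also have "\<dots> \<le> 0" unfolding one using \<xi>\<^sub>1(3) \<xi>\<^sub>2(3) by simp
  finally have "(\<integral>v. (cmod (p v - cnj (r v)))\<^sup>2 \<partial>\<mu>) = 0"
    by (intro antisym integral_nonneg_AE) auto
  then have "AE v in \<mu>. (cmod (p v - cnj (r v)))\<^sup>2 = 0"
    using integral_nonneg_eq_0_iff_AE[OF int2] by simp
  then have "AE v in \<mu>. \<xi>\<^sub>1 = cnj \<xi>\<^sub>2"
    using AE_bounds
  proof eventually_elim
    case (elim v)
    then have "1 / (complex_of_real v - \<xi>\<^sub>1) = 1 / (complex_of_real v - cnj \<xi>\<^sub>2)"
      by (simp add: p_def r_def)
    moreover have "of_real v - \<xi>\<^sub>1 \<noteq> 0" "of_real v - \<xi>\<^sub>2 \<noteq> 0" using notin_hullC(2) \<xi>\<^sub>1 \<xi>\<^sub>2 elim by blast+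
    moreover from this(2) have "of_real v - cnj \<xi>\<^sub>2 \<noteq> 0"
      by (metis complex_cnj_cnj complex_cnj_complex_of_real complex_cnj_diff complex_cnj_zero)
    ultimately show ?case by (simp add: field_simps)
  qed
  then have c: "\<xi>\<^sub>1 = cnj \<xi>\<^sub>2" by simp
  then have "Im \<xi>\<^sub>1 = - Im \<xi>\<^sub>2" by simp
  with \<xi>\<^sub>1(2) \<xi>\<^sub>2(2) have "Im \<xi>\<^sub>2 = 0" by simp
  with c ne show False by (simp add: complex_eq_iff)
qed

end

section \<open>Stieltjes inversion\<close>

lemma stieltjes_integrable:
  assumes "prob_space \<rho>" and [measurable_cong]: "sets \<rho> = sets borel" and "0 < Im z"
  shows "integrable \<rho> (\<lambda>v. 1 / (complex_of_real v - z))"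
proof -
  interpret prob_space \<rho> by fact
  show ?thesis
  proof (rule integrable_const_bound[of _ "1 / Im z"])
    have "Im z \<le> cmod (complex_of_real v - z)" for v
      using abs_Im_le_cmod[of "complex_of_real v - z"] by simp
    then show "AE v in \<rho>. cmod (1 / (complex_of_real v - z)) \<le> 1 / Im z"
      using assms(3) by (auto simp: norm_divide intro!: AE_I2 divide_left_mono mult_pos_pos
        intro: less_le_trans)
  qed measurable
qed

text \<open>The factor 1/pi of the probability density is left out, so that this is exactly the
  imaginary part of the Stieltjes kernel at height \<open>h\<close>.\<close>

definition poisson :: "real \<Rightarrow> real \<Rightarrow> real" where
  "poisson h x = h / (x\<^sup>2 + h\<^sup>2)"

lemma poisson_pos: "0 < h \<Longrightarrow> 0 < poisson h x"
  unfolding poisson_def by (intro divide_pos_pos add_nonneg_pos) auto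

lemma measurable_poisson [measurable]: "poisson h \<in> borel_measurable borel"
  unfolding poisson_def[abs_def] by measurable

lemma stieltjes_poisson:
  assumes "prob_space \<rho>" and [measurable_cong]: "sets \<rho> = sets borel" and "0 < h"
  shows "integrable \<rho> (\<lambda>v. poisson h (v - x))"
    and "Im (stieltjes \<rho> (Complex x h)) = (\<integral>v. poisson h (v - x) \<partial>\<rho>)"
proof -
  have eq: "Im (1 / (complex_of_real v - Complex x h)) = poisson h (v - x)" for v
    by (simp add: poisson_def Im_divide)
  have int: "integrable \<rho> (\<lambda>v. 1 / (complex_of_real v - Complex x h))"
    using assms by (intro stieltjes_integrable) auto
  show "integrable \<rho> (\<lambda>v. poisson h (v - x))" using integrable_Im[OF int] unfolding eq .
  show "Im (stieltjes \<rho> (Complex x h)) = (\<integral>v. poisson h (v - x) \<partial>\<rho>)"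
    using integral_Im[OF int] unfolding eq stieltjes_def by simp
qed

lemma stieltjes_Im_pos:
  assumes "prob_space \<rho>" "sets \<rho> = sets borel" "0 < Im z"
  shows "0 < Im (stieltjes \<rho> z)"
proof -
  interpret prob_space \<rho> by fact
  have z: "z = Complex (Re z) (Im z)" by simp
  have int: "integrable \<rho> (\<lambda>v. poisson (Im z) (v - Re z))"
    using assms by (rule stieltjes_poisson)
  have pos: "0 < poisson (Im z) (v - Re z)" for v using poisson_pos assms(3) by blast
  have "(\<integral>v. 0 \<partial>\<rho>) < (\<integral>v. poisson (Im z) (v - Re z) \<partial>\<rho>)"
    by (rule integral_less_AE_space) (use int pos emeasure_space_1 in auto)
  then show ?thesis using stieltjes_poisson(2)[OF assms, of "Re z"] by simp
qed

lemma arctan_scaled_limit: "(\<lambda>n. arctan (c * real (Suc n))) \<longlonglongrightarrow> pi / 2 * sgn c"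
proof (cases c "0::real" rule: linorder_cases)
  case less
  have "filterlim (\<lambda>n. c * real (Suc n)) at_bot sequentially"
    using less by (intro filterlim_tendsto_neg_mult_at_bot[OF tendsto_const] filterlim_compose[OF filterlim_real_sequentially filterlim_Suc]) auto
  from filterlim_compose[OF tendsto_arctan_at_bot this] less show ?thesis by simp
next
  case greater
  have "filterlim (\<lambda>n. c * real (Suc n)) at_top sequentially"
    using greater by (intro filterlim_tendsto_pos_mult_at_top[OF tendsto_const] filterlim_compose[OF filterlim_real_sequentially filterlim_Suc]) auto
  from filterlim_compose[OF tendsto_arctan_at_top this] greater show ?thesis by simp
qed simp

lemma poisson_integral:
  assumes "0 < h" "a \<le> b"
  shows "(\<integral>\<^sup>+x. ennreal (poisson h (v - x)) * indicator {a..b} x \<partial>lborel)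
    = ennreal (arctan ((b - v) / h) - arctan ((a - v) / h))"
proof (rule nn_integral_FTC_Icc)
  fix x
  have "((\<lambda>x. arctan ((x - v) / h)) has_real_derivative 1 / h / (1 + ((x - v) / h)\<^sup>2)) (at x)"
    using assms(1) by (auto intro!: derivative_eq_intros simp: field_simps)
  moreover have "1 / h / (1 + ((x - v) / h)\<^sup>2) = poisson h (v - x)"
  proof -
    have "(x - v)\<^sup>2 + h\<^sup>2 \<noteq> 0" using assms(1) by (metis less_irrefl sum_power2_gt_zero_iff)
    then show ?thesis using assms(1)
      by (simp add: poisson_def power_divide power2_commute[of v x] add_divide_eq_iff divide_simps)
        (simp add: power2_eq_square algebra_simps)
  qed
  ultimately show "((\<lambda>x. arctan ((x - v) / h)) has_real_derivative poisson h (v - x)) (at x)"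
    by simp
  show "0 \<le> poisson h (v - x)" using poisson_pos[OF assms(1)] less_imp_le by blast
qed (use assms in auto)

lemma integrable_indicator_Icc: "integrable lborel (indicator {c..d} :: real \<Rightarrow> real)"
  by (intro integrable_real_indicator) (auto simp: emeasure_lborel_Icc_eq)

text \<open>
  The integral of the Poisson kernel is a difference of arctangents, which converges to \<open>\<pi>\<close>
  inside \<open>(c, d)\<close>, to \<open>\<pi>/2\<close> at the endpoints and to \<open>0\<close> outside.
\<close>

lemma stieltjes_inversion_interval:
  fixes f :: "real \<Rightarrow> real"
  assumes \<rho>: "prob_space \<rho>" and sets [measurable_cong]: "sets \<rho> = sets borel"
    and bound: "\<And>z. 0 < Im z \<Longrightarrow> Im (stieltjes \<rho> z) \<le> 1"
    and lim: "\<And>x. (\<lambda>n. Im (stieltjes \<rho> (Complex x (1 / Suc n)))) \<longlonglongrightarrow> pi * f x"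
    and [measurable]: "f \<in> borel_measurable borel"
    and cd: "c < d"
  shows "(\<integral>x. f x * indicator {c..d} x \<partial>lborel) = (measure \<rho> {c<..<d} + measure \<rho> {c..d}) / 2"
proof -
  interpret prob_space \<rho> by fact
  interpret lborel_pair: pair_sigma_finite lborel \<rho> by unfold_locales
  define h where "h n = 1 / real (Suc n)" for n
  have h: "0 < h n" for n by (simp add: h_def)
  define p where "p n x = (\<integral>v. poisson (h n) (v - x) \<partial>\<rho>)" for n x
  define T where "T n v = arctan ((d - v) / h n) - arctan ((c - v) / h n)" for n v
  have p_eq: "p n x = Im (stieltjes \<rho> (Complex x (1 / Suc n)))" for n x
    using stieltjes_poisson(2)[OF \<rho> sets h] by (simp add: p_def h_def)
  have p01: "0 \<le> p n x" "p n x \<le> 1" for n x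
    using bound[of "Complex x (1 / Suc n)"] stieltjes_Im_pos[OF \<rho> sets, of "Complex x (1 / Suc n)"]
    unfolding p_eq by auto
  have [measurable]: "p n \<in> borel_measurable borel" for n
    unfolding p_def[abs_def] poisson_def[abs_def] by measurable
  have T_meas [measurable]: "T n \<in> borel_measurable borel" for n
    unfolding T_def[abs_def] by measurable
  have T0: "0 \<le> T n v" for n v
    unfolding T_def using cd h[of n] by (simp add: arctan_le_iff divide_right_mono)
  have Tpi: "T n v \<le> pi" for n v
    unfolding T_def using arctan_ubound[of "(d - v) / h n"] arctan_lbound[of "(c - v) / h n"] by linarith
  have ind_int: "integrable lborel (\<lambda>x. indicator {c..d} x :: real)"
    by (rule integrable_indicator_Icc)
  have p_int: "integrable lborel (\<lambda>x. p n x * indicator {c..d} x)" for n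
    by (rule Bochner_Integration.integrable_bound[OF ind_int]) (use p01 in \<open>auto simp: indicator_def\<close>)
  have T_int: "integrable \<rho> (T n)" for n
    by (rule integrable_const_bound[of _ pi]) (use T0 Tpi in auto)
  have swap: "(\<integral>x. p n x * indicator {c..d} x \<partial>lborel) = (\<integral>v. T n v \<partial>\<rho>)" for n
  proof -
    have "ennreal (\<integral>x. p n x * indicator {c..d} x \<partial>lborel)
        = (\<integral>\<^sup>+x. ennreal (p n x * indicator {c..d} x) \<partial>lborel)"
      by (rule nn_integral_eq_integral[symmetric]) (use p_int p01 in auto)
    also have "\<dots> = (\<integral>\<^sup>+x. (\<integral>\<^sup>+v. ennreal (poisson (h n) (v - x)) * indicator {c..d} x \<partial>\<rho>) \<partial>lborel)"
    proof (rule nn_integral_cong)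
      fix x
      have "ennreal (p n x) = (\<integral>\<^sup>+v. ennreal (poisson (h n) (v - x)) \<partial>\<rho>)"
        unfolding p_def using stieltjes_poisson(1)[OF \<rho> sets h] poisson_pos[OF h, THEN less_imp_le]
        by (intro nn_integral_eq_integral[symmetric]) auto
      then show "ennreal (p n x * indicator {c..d} x)
          = (\<integral>\<^sup>+v. ennreal (poisson (h n) (v - x)) * indicator {c..d} x \<partial>\<rho>)"
        by (cases "x \<in> {c..d}") auto
    qed
    also have "\<dots> = (\<integral>\<^sup>+v. (\<integral>\<^sup>+x. ennreal (poisson (h n) (v - x)) * indicator {c..d} x \<partial>lborel) \<partial>\<rho>)"
      by (rule lborel_pair.Fubini'[symmetric]) (unfold poisson_def, measurable)
    also have "\<dots> = (\<integral>\<^sup>+v. ennreal (T n v) \<partial>\<rho>)"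
      using poisson_integral[OF h] cd by (simp add: T_def)
    also have "\<dots> = ennreal (\<integral>v. T n v \<partial>\<rho>)"
      by (rule nn_integral_eq_integral) (use T_int T0 in auto)
    finally show ?thesis
      by (subst (asm) ennreal_inj) (use p01 T0 in \<open>auto intro!: integral_nonneg_AE\<close>)
  qed
  have "(\<lambda>n. \<integral>x. p n x * indicator {c..d} x \<partial>lborel) \<longlonglongrightarrow> (\<integral>x. pi * f x * indicator {c..d} x \<partial>lborel)"
  proof (rule integral_dominated_convergence[OF _ _ ind_int])
    show "AE x in lborel. (\<lambda>n. p n x * indicator {c..d} x) \<longlonglongrightarrow> pi * f x * indicator {c..d} x"
      unfolding p_eq by (intro AE_I2 tendsto_intros lim)
    show "AE x in lborel. norm (p n x * indicator {c..d} x) \<le> indicator {c..d} x" for n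
      using p01 by (auto simp: indicator_def)
  qed measurable
  moreover have "(\<lambda>n. \<integral>v. T n v \<partial>\<rho>) \<longlonglongrightarrow>
      (\<integral>v. pi / 2 * (indicator {c<..<d} v + indicator {c..d} v) \<partial>\<rho>)"
  proof (rule integral_dominated_convergence[where w = "\<lambda>_. pi"])
    show "AE v in \<rho>. (\<lambda>n. T n v) \<longlonglongrightarrow> pi / 2 * (indicator {c<..<d} v + indicator {c..d} v)"
    proof (rule AE_I2)
      fix v
      have "(\<lambda>n. T n v) \<longlonglongrightarrow> pi / 2 * sgn (d - v) - pi / 2 * sgn (c - v)"
        unfolding T_def h_def using arctan_scaled_limit[of "d - v"] arctan_scaled_limit[of "c - v"]
        by (auto intro: tendsto_diff)
      moreover have "sgn (d - v) - sgn (c - v) = indicator {c<..<d} v + indicator {c..d} v"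
        using cd by (auto simp: sgn_if indicator_def)
      ultimately show "(\<lambda>n. T n v) \<longlonglongrightarrow> pi / 2 * (indicator {c<..<d} v + indicator {c..d} v)"
        by (metis right_diff_distrib)
    qed
    show "AE v in \<rho>. norm (T n v) \<le> pi" for n using T0 Tpi by auto
  qed auto
  ultimately have "(\<integral>x. pi * f x * indicator {c..d} x \<partial>lborel)
      = (\<integral>v. pi / 2 * (indicator {c<..<d} v + indicator {c..d} v) \<partial>\<rho>)"
    unfolding swap by (rule LIMSEQ_unique)
  also have "\<dots> = pi / 2 * (measure \<rho> {c<..<d} + measure \<rho> {c..d})"
  proof -
    have "integrable \<rho> (indicator {c<..<d} :: real \<Rightarrow> real)" "integrable \<rho> (indicator {c..d} :: real \<Rightarrow> real)"
      by (auto intro!: integrable_real_indicator simp: sets less_top[symmetric])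
    then show ?thesis by (simp add: sets sets_eq_imp_space_eq[OF sets])
  qed
  also have "(\<integral>x. pi * f x * indicator {c..d} x \<partial>lborel) = pi * (\<integral>x. f x * indicator {c..d} x \<partial>lborel)"
    unfolding mult.assoc by (rule integral_mult_right_zero)
  finally show ?thesis by simp
qed

text \<open>The formula for intervals gives the endpoints weight one half. As the density is
  bounded, no point carries mass, the weights become immaterial, and half-open intervals exhausting
  half-lines determine the measure.\<close>

lemma stieltjes_inversion:
  fixes f :: "real \<Rightarrow> real"
  assumes \<rho>: "prob_space \<rho>" and sets [measurable_cong]: "sets \<rho> = sets borel"
    and bound: "\<And>z. 0 < Im z \<Longrightarrow> Im (stieltjes \<rho> z) \<le> 1"
    and lim: "\<And>x. (\<lambda>n. Im (stieltjes \<rho> (Complex x (1 / Suc n)))) \<longlonglongrightarrow> pi * f x"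
    and f [measurable]: "f \<in> borel_measurable borel"
  shows "\<rho> = density lborel (\<lambda>x. ennreal (f x))"
proof -
  interpret prob_space \<rho> by fact
  have inv: "(\<integral>x. f x * indicator {c..d} x \<partial>lborel) = (measure \<rho> {c<..<d} + measure \<rho> {c..d}) / 2"
    if "c < d" for c d
    by (rule stieltjes_inversion_interval[OF \<rho> sets _ lim f that]) (rule bound)
  have "0 \<le> Im (stieltjes \<rho> (Complex x (1 / Suc n)))" "Im (stieltjes \<rho> (Complex x (1 / Suc n))) \<le> 1" for x n
    using bound[of "Complex x (1 / Suc n)"] stieltjes_Im_pos[OF \<rho> sets, of "Complex x (1 / Suc n)"]
    by auto
  then have pif: "0 \<le> pi * f x" "pi * f x \<le> 1" for x
    using LIMSEQ_le_const[OF lim[of x], of 0] LIMSEQ_le_const2[OF lim[of x], of 1] by blast+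
  have f0: "0 \<le> f x" for x using pif(1)[of x] pi_gt_zero by (simp add: zero_le_mult_iff)
  have f1: "f x \<le> 1" for x
    using mult_right_mono[of 1 pi "f x"] pif(2)[of x] f0[of x] pi_gt3 by simp
  have f_int: "integrable lborel (\<lambda>x. f x * indicator {c..d} x)" for c d :: real
    by (rule Bochner_Integration.integrable_bound[of _ "indicator {c..d} :: real \<Rightarrow> real"])
      (use f0 f1 integrable_indicator_Icc in \<open>auto simp: indicator_def\<close>)
  have point: "measure \<rho> {x} = 0" for x
  proof (rule ccontr)
    assume "measure \<rho> {x} \<noteq> 0"
    then have pos: "0 < measure \<rho> {x}" by (simp add: zero_less_measure_iff)
    \<comment> \<open>Since \<open>f\<close> is at most 1, the open and the closed interval of
      radius \<open>t\<close> have total mass at most \<open>4 * t\<close>, which is half of what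
      the atom alone contributes to them.\<close>
    define t where "t = measure \<rho> {x} / 4"
    have t: "0 < t" using pos by (simp add: t_def)
    have "2 * measure \<rho> {x} \<le> measure \<rho> {x - t<..<x + t} + measure \<rho> {x - t..x + t}"
      using finite_measure_mono[of "{x}" "{x - t<..<x + t}"] finite_measure_mono[of "{x}" "{x - t..x + t}"] t
      by (simp add: sets)
    also have "\<dots> = 2 * (\<integral>y. f y * indicator {x - t..x + t} y \<partial>lborel)"
      using inv[of "x - t" "x + t"] t by simp
    also have "\<dots> \<le> 2 * (\<integral>y. indicator {x - t..x + t} y \<partial>lborel)"
      using f0 f1 by (intro mult_left_mono integral_mono f_int integrable_indicator_Icc) (auto simp: indicator_def)
    also have "\<dots> = 4 * t" using t by simp
    finally show False using pos by (simp add: t_def)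
  qed
  have Icc: "measure \<rho> {c..d} = (\<integral>x. f x * indicator {c..d} x \<partial>lborel)"
    and Ioc: "measure \<rho> {c<..d} = measure \<rho> {c..d}" if "c < d" for c d
  proof -
    have "measure \<rho> {c..d} = measure \<rho> {c<..<d} + measure \<rho> {c, d}"
      using that by (subst finite_measure_Union[symmetric]) (auto simp: sets intro!: arg_cong[where f = "measure \<rho>"])
    moreover have "measure \<rho> {c, d} = 0"
      using finite_measure_Union[of "{c}" "{d}"] point that by (simp add: sets insert_is_Un[of c "{d}"])
    ultimately show 1: "measure \<rho> {c..d} = (\<integral>x. f x * indicator {c..d} x \<partial>lborel)"
      using inv[OF that] by simp
    have "measure \<rho> {c..d} = measure \<rho> {c} + measure \<rho> {c<..d}"
      using that by (subst finite_measure_Union[symmetric]) (auto simp: sets intro!: arg_cong[where f = "measure \<rho>"])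
    then show "measure \<rho> {c<..d} = measure \<rho> {c..d}" using point by simp
  qed
  let ?D = "density lborel (\<lambda>x. ennreal (f x))"
  have Ioc_eq: "emeasure ?D {c<..d} = emeasure \<rho> {c<..d}" if "c < d" for c d
  proof -
    have "emeasure ?D {c<..d} = (\<integral>\<^sup>+x. ennreal (f x) * indicator {c<..d} x \<partial>lborel)"
      by (rule emeasure_density) auto
    also have "\<dots> = (\<integral>\<^sup>+x. ennreal (f x * indicator {c..d} x) \<partial>lborel)"
    proof (rule nn_integral_cong_AE)
      show "AE x in lborel. ennreal (f x) * indicator {c<..d} x = ennreal (f x * indicator {c..d} x)"
        using AE_lborel_singleton[of c] by eventually_elim (auto simp: indicator_def)
    qed
    also have "\<dots> = ennreal (\<integral>x. f x * indicator {c..d} x \<partial>lborel)"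
      by (rule nn_integral_eq_integral) (use f_int f0 in auto)
    finally show ?thesis unfolding Icc[OF that, symmetric] Ioc[OF that, symmetric]
      by (simp add: emeasure_eq_measure)
  qed
  have eq: "emeasure \<rho> {x<..} = emeasure ?D {x<..}" for x
  proof -
    define A where "A n = {x<..x + real (Suc n)}" for n
    have U: "(\<Union>n. A n) = {x<..}"
    proof safe
      fix y assume "x < y"
      obtain n where "y - x \<le> real n" using real_arch_simple by blast
      with \<open>x < y\<close> show "y \<in> (\<Union>n. A n)" by (intro UN_I[of n]) (auto simp: A_def)
    qed (auto simp: A_def)
    have A: "range A \<subseteq> sets borel" "incseq A" by (auto simp: incseq_def A_def)
    have "(\<lambda>n. emeasure \<rho> (A n)) \<longlonglongrightarrow> emeasure \<rho> {x<..}"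
      unfolding U[symmetric] using A by (intro Lim_emeasure_incseq) (simp_all only: sets)
    moreover have "(\<lambda>n. emeasure ?D (A n)) \<longlonglongrightarrow> emeasure ?D {x<..}"
      unfolding U[symmetric] using A by (intro Lim_emeasure_incseq) (simp_all only: sets_density sets_lborel)
    moreover have "emeasure ?D (A n) = emeasure \<rho> (A n)" for n
      unfolding A_def by (rule Ioc_eq) simp
    ultimately show ?thesis using LIMSEQ_unique by simp
  qed
  show ?thesis
  proof (rule measure_eqI_lessThan[OF sets])
    show "emeasure \<rho> {x<..} < \<infinity>" for x
      using emeasure_finite[of "{x<..}"] by (simp add: less_top[symmetric])
  qed (simp_all add: eq)
qed

section \<open>Real points outside the hull and the two edges\<close>

definition resolvent_sq :: "real measure \<Rightarrow> real \<Rightarrow> real" where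
  "resolvent_sq \<mu> x = (\<integral>v. 1 / (x - v)\<^sup>2 \<partial>\<mu>)"

definition shifted_map :: "real measure \<Rightarrow> real \<Rightarrow> real" where
  "shifted_map \<mu> x = x + (\<integral>v. 1 / (x - v) \<partial>\<mu>)"

context compact_law
begin

lemma g_of_real: "g (of_real x) = resolvent_sq \<mu> x"
proof -
  have "cmod (complex_of_real v - of_real x) = \<bar>v - x\<bar>" for v
    by (metis norm_of_real of_real_diff)
  then show ?thesis by (simp add: g_def resolvent_sq_def power2_commute)
qed

lemma shifted_stieltjes_of_real:
  assumes "of_real x \<notin> hullC"
  shows "of_real x - stieltjes \<mu> (of_real x) = of_real (shifted_map \<mu> x)"
proof -
  have "1 / (complex_of_real v - of_real x) = of_real (- (1 / (x - v)))" for v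
    by (simp add: minus_divide_right flip: of_real_diff)
  then have "stieltjes \<mu> (of_real x) = of_real (- (\<integral>v. 1 / (x - v) \<partial>\<mu>))"
    unfolding stieltjes_def by (simp only: integral_complex_of_real integral_minus)
  then show ?thesis by (simp add: shifted_map_def)
qed

lemma integrable_resolvents:
  assumes "of_real x \<notin> hullC"
  shows "integrable \<mu> (\<lambda>v. 1 / (x - v))" "integrable \<mu> (\<lambda>v. 1 / (x - v)\<^sup>2)"
proof -
  have c: "cmod (complex_of_real v - of_real x) = \<bar>v - x\<bar>" for v
    by (metis norm_of_real of_real_diff)
  have r: "Re (1 / (complex_of_real v - of_real x)) = - (1 / (x - v))" for v
    by (simp add: minus_divide_right flip: of_real_diff)
  show "integrable \<mu> (\<lambda>v. 1 / (x - v))"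
    using integrable_Re[OF integrable_stieltjes[OF assms]] unfolding r by simp
  show "integrable \<mu> (\<lambda>v. 1 / (x - v)\<^sup>2)"
    using integrable_g[OF assms] unfolding c by (simp add: power2_commute)
qed

lemma right_of_hull: "b < x \<Longrightarrow> complex_of_real x \<notin> hullC"
  by auto

lemma resolvent_sq_strict_decreasing:
  assumes "b < x" "x < y"
  shows "resolvent_sq \<mu> y < resolvent_sq \<mu> x"
  unfolding resolvent_sq_def
proof (rule integral_less_AE_space)
  show "AE v in \<mu>. 1 / (y - v)\<^sup>2 < 1 / (x - v)\<^sup>2"
    using AE_bounds by eventually_elim
      (use assms in \<open>auto intro!: divide_strict_left_mono power_strict_mono\<close>)
  show "emeasure \<mu> (space \<mu>) \<noteq> 0" by (simp add: emeasure_space_1)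
qed (use assms in \<open>auto intro!: integrable_resolvents right_of_hull\<close>)

text \<open>Without differentiating under the integral: to the right of the support the kernel
  decreases, so the drop of its integral from \<open>x\<close> to \<open>y\<close> is at most
  \<open>y - x\<close> times \<open>resolvent_sq \<mu> x\<close>.\<close>

lemma shifted_map_mono:
  assumes "b < x" "x \<le> y" "resolvent_sq \<mu> x \<le> 1"
  shows "shifted_map \<mu> x \<le> shifted_map \<mu> y"
proof -
  note int = integrable_resolvents[OF right_of_hull]
  have "(\<integral>v. 1 / (x - v) - 1 / (y - v) \<partial>\<mu>) \<le> (\<integral>v. (y - x) * (1 / (x - v)\<^sup>2) \<partial>\<mu>)"
  proof (rule integral_mono_AE)
    show "AE v in \<mu>. 1 / (x - v) - 1 / (y - v) \<le> (y - x) * (1 / (x - v)\<^sup>2)"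
      using AE_bounds
    proof eventually_elim
      case (elim v)
      then have xv: "0 < x - v" "x - v \<le> y - v" using assms by auto
      have "1 / (x - v) - 1 / (y - v) = (y - x) * (1 / ((x - v) * (y - v)))"
        using xv by (simp add: divide_simps)
      also have "\<dots> \<le> (y - x) * (1 / ((x - v) * (x - v)))"
        using xv assms by (intro mult_left_mono divide_left_mono) auto
      finally show ?case by (simp add: power2_eq_square)
    qed
    show "integrable \<mu> (\<lambda>v. 1 / (x - v) - 1 / (y - v))"
      using assms by (intro Bochner_Integration.integrable_diff int) auto
    show "integrable \<mu> (\<lambda>v. (y - x) * (1 / (x - v)\<^sup>2))"
      using assms by (intro integrable_mult_right int) auto
  qed
  also have "\<dots> = (y - x) * resolvent_sq \<mu> x"
    unfolding resolvent_sq_def by (rule integral_mult_right_zero)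
  also have "\<dots> \<le> (y - x) * 1" using assms by (intro mult_left_mono) auto
  also have "(\<integral>v. 1 / (x - v) - 1 / (y - v) \<partial>\<mu>) = (\<integral>v. 1 / (x - v) \<partial>\<mu>) - (\<integral>v. 1 / (y - v) \<partial>\<mu>)"
    using assms by (intro Bochner_Integration.integral_diff int) auto
  finally show ?thesis by (simp add: shifted_map_def)
qed

lemma shifted_map_ge:
  assumes "b < x"
  shows "x \<le> shifted_map \<mu> x"
proof -
  have "0 \<le> (\<integral>v. 1 / (x - v) \<partial>\<mu>)"
  proof (rule integral_nonneg_AE)
    show "AE v in \<mu>. 0 \<le> 1 / (x - v)" using AE_bounds by eventually_elim (use assms in auto)
  qed
  then show ?thesis by (simp add: shifted_map_def)
qed

lemma continuous_on_right:
  "continuous_on {b<..} (shifted_map \<mu>)" "continuous_on {b<..} (resolvent_sq \<mu>)"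
proof -
  have sub: "complex_of_real ` {b<..} \<subseteq> - hullC" using a_le_b by auto
  have "continuous_on {b<..} (\<lambda>x. of_real x - stieltjes \<mu> (of_real x))"
    by (intro continuous_intros continuous_on_compose2[OF continuous_on_stieltjes] sub)
  then have "continuous_on {b<..} (\<lambda>x. Re (of_real x - stieltjes \<mu> (of_real x)))"
    by (rule continuous_on_Re)
  then show "continuous_on {b<..} (shifted_map \<mu>)"
    by (rule continuous_on_eq) (use shifted_stieltjes_of_real right_of_hull in force)
  have "continuous_on {b<..} (\<lambda>x. g (of_real x))"
    by (intro continuous_intros continuous_on_compose2[OF continuous_on_g] sub)
  then show "continuous_on {b<..} (resolvent_sq \<mu>)" unfolding g_of_real .
qed

lemma nn_integral_real_kernel:
  "(\<integral>\<^sup>+v. inverse (ennreal ((cmod (complex_of_real v - of_real x))\<^sup>2)) \<partial>\<mu>)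
    = (\<integral>\<^sup>+v. inverse (ennreal ((v - x)\<^sup>2)) \<partial>\<mu>)"
proof -
  have "cmod (complex_of_real v - of_real x) = \<bar>v - x\<bar>" for v
    by (metis norm_of_real of_real_diff)
  then show ?thesis by simp
qed

text \<open>By Fatou the hypothesis pushes \<open>resolvent_sq\<close> above 1 close to
  \<open>b\<close>, while at \<open>b + 2\<close> all distances are at least 2, so it equals 1 in
  between. Being decreasing, it admits exactly the \<open>y\<close> from \<open>x\<close> on, where
  \<open>shifted_map\<close> grows continuously without bound.\<close>

lemma upper_edge:
  assumes "1 < (\<integral>\<^sup>+v. inverse (ennreal ((v - b)\<^sup>2)) \<partial>\<mu>)"
  obtains x where "b < x" "resolvent_sq \<mu> x = 1"
    "{E. \<exists>y>b. resolvent_sq \<mu> y \<le> 1 \<and> E = shifted_map \<mu> y} = {shifted_map \<mu> x..}"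
proof -
  let ?E = "{E. \<exists>y>b. resolvent_sq \<mu> y \<le> 1 \<and> E = shifted_map \<mu> y}"
  have "\<exists>n. 1 < resolvent_sq \<mu> (b + 1 / real (Suc n))"
  proof (rule ccontr)
    assume "\<not> ?thesis"
    then have le: "resolvent_sq \<mu> (b + 1 / real (Suc n)) \<le> 1" for n by (auto simp: not_less)
    have "(\<integral>\<^sup>+v. inverse (ennreal ((cmod (of_real v - complex_of_real b))\<^sup>2)) \<partial>\<mu>) \<le> 1"
    proof (rule nn_kernel_lower_limit[OF sets_eq])
      have "(\<lambda>n. 1 / real (Suc n)) \<longlonglongrightarrow> 0" by (rule LIMSEQ_Suc[OF lim_1_over_n])
      from tendsto_add[OF tendsto_const[of b] this]
      show "(\<lambda>n. complex_of_real (b + 1 / real (Suc n))) \<longlonglongrightarrow> of_real b"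
        by (intro tendsto_of_real) simp
      show "(\<integral>\<^sup>+v. inverse (ennreal ((cmod (of_real v - complex_of_real (b + 1 / real (Suc n))))\<^sup>2)) \<partial>\<mu>) \<le> 1" for n
        using nn_integral_kernel[OF right_of_hull[of "b + 1 / real (Suc n)"]] le[of n]
        unfolding g_of_real by simp
    qed
    with assms show False unfolding nn_integral_real_kernel by simp
  qed
  then obtain n where n: "1 < resolvent_sq \<mu> (b + 1 / real (Suc n))" by blast
  define x1 where "x1 = b + 1 / real (Suc n)"
  have x1: "b < x1" "x1 < b + 2" by (simp_all add: x1_def field_simps)
  have "resolvent_sq \<mu> (b + 2) \<le> (\<integral>v. 1 \<partial>\<mu>)"
    unfolding resolvent_sq_def
  proof (rule integral_mono_AE)
    show "AE v in \<mu>. 1 / (b + 2 - v)\<^sup>2 \<le> 1"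
      using AE_bounds
    proof eventually_elim
      case (elim v)
      then have "1 \<le> (b + 2 - v)\<^sup>2" by (intro one_le_power) auto
      then have "1 / (b + 2 - v)\<^sup>2 \<le> 1 / 1" by (intro divide_left_mono) auto
      then show ?case by simp
    qed
    show "integrable \<mu> (\<lambda>v. 1 / (b + 2 - v)\<^sup>2)" by (rule integrable_resolvents(2)[OF right_of_hull]) simp
  qed simp
  then have "resolvent_sq \<mu> (b + 2) \<le> 1" by (simp add: prob_space)
  then obtain x where x: "x1 \<le> x" "x \<le> b + 2" "resolvent_sq \<mu> x = 1"
  proof -
    have "continuous_on {x1..b + 2} (resolvent_sq \<mu>)"
      by (rule continuous_on_subset[OF continuous_on_right(2)]) (use x1 in auto)
    then show ?thesis
      using IVT2'[of "resolvent_sq \<mu>" "b + 2" 1 x1] n x1 that \<open>resolvent_sq \<mu> (b + 2) \<le> 1\<close>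
      unfolding x1_def[symmetric] by auto
  qed
  have bx: "b < x" using x x1 by simp
  have "?E = {shifted_map \<mu> x..}"
  proof (intro set_eqI iffI)
    fix E assume "E \<in> ?E"
    then obtain y where y: "b < y" "resolvent_sq \<mu> y \<le> 1" "E = shifted_map \<mu> y" by blast
    have "x \<le> y"
      using resolvent_sq_strict_decreasing[of y x] y x(3) by (cases "x \<le> y") auto
    then show "E \<in> {shifted_map \<mu> x..}" using shifted_map_mono[OF bx] x y by auto
  next
    fix E assume "E \<in> {shifted_map \<mu> x..}"
    then have E: "shifted_map \<mu> x \<le> E" by simp
    \<comment> \<open>As \<open>shifted_map\<close> lies above the identity, \<open>max E x\<close>
      is a right endpoint for the intermediate value theorem.\<close>
    have le: "E \<le> shifted_map \<mu> (max E x)" using shifted_map_ge[of "max E x"] bx by auto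
    have "continuous_on {x..max E x} (shifted_map \<mu>)"
      by (rule continuous_on_subset[OF continuous_on_right(1)]) (use bx in auto)
    from IVT'[OF E le max.cobounded2 this]
    obtain y where y: "x \<le> y" "shifted_map \<mu> y = E" by blast
    have "resolvent_sq \<mu> y \<le> 1"
      using resolvent_sq_strict_decreasing[OF bx, of y] x y by (cases "x = y") auto
    then show "E \<in> ?E" using y bx by (auto intro!: exI[of _ y])
  qed
  with bx x that show ?thesis by blast
qed

text \<open>Reflection at the origin reduces every statement on the lower edge to the upper
  one.\<close>

lemma reflected: "compact_law (distr \<mu> borel uminus) (- b) (- a)"
proof -
  interpret R: prob_space "distr \<mu> borel uminus" by (rule prob_space_distr) measurable
  show ?thesis
  proof
    show "AE v in distr \<mu> borel uminus. - b \<le> v \<and> v \<le> - a"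
      by (subst AE_distr_iff) (use AE_bounds in auto)
  qed simp
qed

lemma reflected_maps:
  "resolvent_sq (distr \<mu> borel uminus) (- x) = resolvent_sq \<mu> x"
  "shifted_map (distr \<mu> borel uminus) (- x) = - shifted_map \<mu> x"
proof -
  show "resolvent_sq (distr \<mu> borel uminus) (- x) = resolvent_sq \<mu> x"
    unfolding resolvent_sq_def by (subst integral_distr) (auto simp: power2_commute)
  have "1 / (- x - - v) = - (1 / (x - v))" for v :: real
    by (metis minus_diff_eq minus_diff_minus minus_divide_right)
  then show "shifted_map (distr \<mu> borel uminus) (- x) = - shifted_map \<mu> x"
    unfolding shifted_map_def by (subst integral_distr) auto
qed

lemma lower_edge:
  assumes "1 < (\<integral>\<^sup>+v. inverse (ennreal ((v - a)\<^sup>2)) \<partial>\<mu>)"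
  obtains x where "x < a" "resolvent_sq \<mu> x = 1"
    "{E. \<exists>y<a. resolvent_sq \<mu> y \<le> 1 \<and> E = shifted_map \<mu> y} = {..shifted_map \<mu> x}"
proof -
  let ?E = "{E. \<exists>y<a. resolvent_sq \<mu> y \<le> 1 \<and> E = shifted_map \<mu> y}"
  let ?\<nu> = "distr \<mu> borel uminus"
  let ?F = "{E. \<exists>y>- a. resolvent_sq ?\<nu> y \<le> 1 \<and> E = shifted_map ?\<nu> y}"
  interpret R: compact_law "?\<nu>" "- b" "- a" by (rule reflected)
  have "(- v - - a)\<^sup>2 = (v - a)\<^sup>2" for v by (simp add: power2_commute)
  then have "1 < (\<integral>\<^sup>+v. inverse (ennreal ((v - (- a))\<^sup>2)) \<partial>?\<nu>)"
    using assms by (subst nn_integral_distr) auto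
  then obtain x where x: "- a < x" "resolvent_sq ?\<nu> x = 1"
    and set: "?F
      = {shifted_map ?\<nu> x..}"
    by (rule R.upper_edge)
  note refl = reflected_maps[of "- y" for y, unfolded minus_minus]
  have "?E = {..shifted_map \<mu> (- x)}"
  proof (intro set_eqI)
    fix E
    have "(E \<in> ?E)
        \<longleftrightarrow> (\<exists>y>- a. resolvent_sq \<mu> (- y) \<le> 1 \<and> E = shifted_map \<mu> (- y))"
      unfolding mem_Collect_eq by (metis minus_less_iff minus_minus neg_less_iff_less)
    also have "\<dots> \<longleftrightarrow> - E \<in> ?F"
      by (auto simp: refl)
    also have "\<dots> \<longleftrightarrow> E \<in> {..shifted_map \<mu> (- x)}" unfolding set by (simp add: refl)
    finally show "E \<in> ?E \<longleftrightarrow> E \<in> {..shifted_map \<mu> (- x)}" .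
  qed
  moreover have "- x < a" "resolvent_sq \<mu> (- x) = 1" using x by (auto simp: refl)
  ultimately show ?thesis using that by blast
qed

end

section \<open>Free convolution with the semicircle law\<close>

text \<open>A strict pointwise inequality is enough: limits of solutions satisfy the closed
  condition \<open>g \<xi> \<le> 1\<close>, which contradicts it at any point of the
  interval.\<close>

locale stable_law = compact_law +
  assumes stable: "a \<le> x \<Longrightarrow> x \<le> b \<Longrightarrow> 1 < (\<integral>\<^sup>+v. inverse (ennreal ((v - x)\<^sup>2)) \<partial>\<mu>)"
begin

text \<open>
  \<open>\<xi>\<close> is the value at \<open>z\<close> of the continuous extension of \<open>z + m(z)\<close> to the closed upper half
  plane, where \<open>m\<close> is the transform of the free convolution with the semicircle law.
\<close>

definition subordinate :: "complex \<Rightarrow> complex \<Rightarrow> bool" where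
  "subordinate z \<xi> \<longleftrightarrow> 0 \<le> Im \<xi> \<and> \<xi> \<notin> hullC \<and> g \<xi> \<le> 1 \<and> \<xi> - stieltjes \<mu> \<xi> = z"

lemma subordinate_unique: "subordinate z \<xi>\<^sub>1 \<Longrightarrow> subordinate z \<xi>\<^sub>2 \<Longrightarrow> \<xi>\<^sub>1 = \<xi>\<^sub>2"
  unfolding subordinate_def using shifted_transform_injective[of \<xi>\<^sub>1 \<xi>\<^sub>2] by auto

lemma subordinate_bound: "subordinate z \<xi> \<Longrightarrow> cmod (\<xi> - z) \<le> 1"
  unfolding subordinate_def using norm_stieltjes_le_one[of \<xi>] by force

text \<open>It is used twice: for the existence of a solution at real \<open>z\<close>, and for the
  closed graph that makes the solution continuous in \<open>z\<close>.\<close>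

lemma subordinate_limit:
  assumes sub: "\<And>n. subordinate (z n) (\<xi> n)" and z: "z \<longlonglongrightarrow> z\<^sub>0" and \<xi>: "\<xi> \<longlonglongrightarrow> \<xi>\<^sub>0"
  shows "subordinate z\<^sub>0 \<xi>\<^sub>0"
proof -
  have "(\<integral>\<^sup>+v. inverse (ennreal ((cmod (of_real v - \<xi> n))\<^sup>2)) \<partial>\<mu>) \<le> 1" for n
    using nn_integral_kernel[of "\<xi> n"] sub[of n] by (auto simp: subordinate_def)
  from nn_kernel_lower_limit[OF sets_eq \<xi> this]
  have le: "(\<integral>\<^sup>+v. inverse (ennreal ((cmod (of_real v - \<xi>\<^sub>0))\<^sup>2)) \<partial>\<mu>) \<le> 1" .
  have nin: "\<xi>\<^sub>0 \<notin> hullC"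
  proof
    assume "\<xi>\<^sub>0 \<in> hullC"
    then obtain x where x: "\<xi>\<^sub>0 = of_real x" "a \<le> x" "x \<le> b" by auto
    show False using le stable[OF x(2,3)] unfolding x(1) nn_integral_real_kernel by simp
  qed
  have "g \<xi>\<^sub>0 \<le> 1" using le unfolding nn_integral_kernel[OF nin] by simp
  moreover have "0 \<le> Im \<xi>\<^sub>0"
    using tendsto_Im[OF \<xi>] sub by (auto intro!: LIMSEQ_le_const simp: subordinate_def)
  moreover have "(\<lambda>n. stieltjes \<mu> (\<xi> n)) \<longlonglongrightarrow> stieltjes \<mu> \<xi>\<^sub>0"
    by (rule continuous_on_tendsto_compose[OF continuous_on_stieltjes \<xi>])
      (use nin sub in \<open>auto simp: subordinate_def\<close>)
  from tendsto_diff[OF \<xi> this] have "z \<longlonglongrightarrow> \<xi>\<^sub>0 - stieltjes \<mu> \<xi>\<^sub>0"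
    using sub by (simp add: subordinate_def)
  with z have "\<xi>\<^sub>0 - stieltjes \<mu> \<xi>\<^sub>0 = z\<^sub>0" by (rule LIMSEQ_unique[rotated])
  ultimately show ?thesis using nin by (simp add: subordinate_def)
qed

end

locale semicircle_sum = stable_law +
  fixes \<rho> :: "real measure"
  assumes \<rho>: "prob_space \<rho>" "sets \<rho> = sets borel"
    and fixed_point: "0 < Im z \<Longrightarrow> stieltjes \<rho> z = stieltjes \<mu> (z + stieltjes \<rho> z)"
begin

text \<open>Taking imaginary parts in the fixed point equation gives
  \<open>Im \<xi> * g \<xi> = Im \<xi> - Im z\<close>, hence \<open>g \<xi>\<close> is below
  1.\<close>

lemma subordinate_upper:
  assumes "0 < Im z"
  shows "subordinate z (z + stieltjes \<rho> z)"
proof -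
  let ?\<xi> = "z + stieltjes \<rho> z"
  have pos: "0 < Im (stieltjes \<rho> z)" by (rule stieltjes_Im_pos[OF \<rho> assms])
  then have nin: "?\<xi> \<notin> hullC" using assms by (intro notin_hullC(1)) simp
  have "Im ?\<xi> * g ?\<xi> \<le> Im ?\<xi> * 1"
    using Im_stieltjes[OF nin] fixed_point[OF assms] assms by simp
  then have "g ?\<xi> \<le> 1" using pos assms by (simp only: mult_le_cancel_left_pos plus_complex.sel add_pos_pos)
  then show ?thesis using nin pos assms fixed_point[OF assms] by (simp add: subordinate_def)
qed

lemma ex1_subordinate:
  assumes "0 \<le> Im z"
  shows "\<exists>!\<xi>. subordinate z \<xi>"
proof -
  \<comment> \<open>Solutions are known in the open half plane only. At a boundary point one is
    found as a limit point of the solutions vertically above it.\<close>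
  define w where "w n = z + \<i> * of_real (1 / real (Suc n))" for n
  have w: "0 < Im (w n)" for n using assms by (simp add: w_def add_nonneg_pos)
  define \<xi> where "\<xi> n = w n + stieltjes \<rho> (w n)" for n
  have sub: "subordinate (w n) (\<xi> n)" for n unfolding \<xi>_def by (rule subordinate_upper[OF w])
  have "(\<lambda>n. 1 / real (Suc n)) \<longlonglongrightarrow> 0" by (rule LIMSEQ_Suc[OF lim_1_over_n])
  from tendsto_add[OF tendsto_const[of z] tendsto_mult[OF tendsto_const[of \<i>] tendsto_of_real[OF this]]]
  have wz: "w \<longlonglongrightarrow> z" unfolding w_def[abs_def] by simp
  have "cmod (\<xi> n) \<le> cmod z + 2" for n
  proof -
    have "cmod (w n - z) = \<bar>1 / real (Suc n)\<bar>"
      unfolding w_def by (simp only: add_diff_cancel_left' norm_mult norm_ii norm_of_real mult_1_left)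
    then have "cmod (w n - z) \<le> 1" by simp
    moreover have "cmod (\<xi> n - w n) \<le> 1" by (rule subordinate_bound[OF sub])
    moreover have "cmod (\<xi> n) \<le> cmod (\<xi> n - w n) + cmod (w n - z) + cmod z"
      using norm_triangle_ineq[of "\<xi> n - w n" "w n"] norm_triangle_ineq[of "w n - z" z] by simp
    ultimately show ?thesis by linarith
  qed
  then have "bounded (range \<xi>)" by (auto intro!: boundedI)
  then obtain l r where r: "strict_mono (r :: nat \<Rightarrow> nat)" "(\<xi> \<circ> r) \<longlonglongrightarrow> l"
    using bounded_imp_convergent_subsequence by blast
  have "subordinate z l"
    by (rule subordinate_limit[where z = "w \<circ> r" and \<xi> = "\<xi> \<circ> r"])
      (use sub r LIMSEQ_subseq_LIMSEQ[OF wz r(1)] in auto)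
  then show ?thesis using subordinate_unique by blast
qed

definition sub :: "complex \<Rightarrow> complex" where
  "sub z = (THE \<xi>. subordinate z \<xi>)"

lemma subordinate_sub: "0 \<le> Im z \<Longrightarrow> subordinate z (sub z)"
  unfolding sub_def by (rule theI'[OF ex1_subordinate])

lemma subI: "subordinate z \<xi> \<Longrightarrow> sub z = \<xi>"
  unfolding sub_def using subordinate_unique by blast

lemma continuous_on_sub: "continuous_on {z. 0 \<le> Im z} sub"
proof -
  let ?H = "{z. 0 \<le> Im z}"
  \<comment> \<open>The closed graph criterion asks for values in a compact set; \<open>sub\<close>
    is unbounded, but it differs from the identity by at most 1.\<close>
  have "continuous_on ?H (\<lambda>z. sub z - z)"
  proof (rule continuous_from_closed_graph[of "cball 0 1"])
    show "(\<lambda>z. sub z - z) \<in> ?H \<rightarrow> cball 0 1"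
      using subordinate_bound subordinate_sub by auto
    show "closed ((\<lambda>z. (z, sub z - z)) ` ?H)"
      unfolding closed_sequential_limits
    proof (intro allI impI, elim conjE)
      fix x :: "nat \<Rightarrow> complex \<times> complex" and l
      assume x: "\<forall>n. x n \<in> (\<lambda>z. (z, sub z - z)) ` ?H" and lim: "x \<longlonglongrightarrow> l"
      define z where "z n = fst (x n)" for n
      have z: "0 \<le> Im (z n)" "snd (x n) = sub (z n) - z n" for n
        using x[rule_format, of n] by (auto simp: z_def)
      have zl: "z \<longlonglongrightarrow> fst l" unfolding z_def by (rule tendsto_fst[OF lim])
      have "(\<lambda>n. sub (z n)) \<longlonglongrightarrow> snd l + fst l"
        using tendsto_add[OF tendsto_snd[OF lim] zl] by (simp add: z)
      then have "subordinate (fst l) (snd l + fst l)"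
        by (intro subordinate_limit[OF _ zl]) (use subordinate_sub z in auto)
      then have "sub (fst l) = snd l + fst l" by (rule subI)
      moreover have "0 \<le> Im (fst l)"
        using tendsto_Im[OF zl] z by (auto intro!: LIMSEQ_le_const)
      ultimately show "l \<in> (\<lambda>z. (z, sub z - z)) ` ?H"
        by (intro image_eqI[of _ _ "fst l"]) (auto simp: prod_eq_iff)
    qed
  qed simp
  from continuous_on_add[OF this continuous_on_id] show ?thesis by simp
qed

definition dens :: "real \<Rightarrow> real" where
  "dens x = Im (sub (of_real x)) / pi"

lemma dens_nonneg: "0 \<le> dens x"
  using subordinate_sub[of "of_real x"] by (simp add: dens_def subordinate_def)

lemma continuous_on_dens: "continuous_on UNIV dens"
proof -
  have "continuous_on UNIV (\<lambda>x. sub (complex_of_real x))"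
    by (rule continuous_on_compose2[OF continuous_on_sub]) (auto intro!: continuous_intros)
  then show ?thesis unfolding dens_def[abs_def] by (intro continuous_intros) auto
qed

lemma \<rho>_density: "\<rho> = density lborel (\<lambda>x. ennreal (dens x))"
proof (rule stieltjes_inversion[OF \<rho>])
  fix z :: complex assume z: "0 < Im z"
  show "Im (stieltjes \<rho> z) \<le> 1"
    using subordinate_bound[OF subordinate_upper[OF z]] abs_Im_le_cmod[of "stieltjes \<rho> z"] by simp
next
  fix x :: real
  define w where "w n = Complex x (1 / real (Suc n))" for n
  have lim0: "(\<lambda>n. 1 / real (Suc n)) \<longlonglongrightarrow> 0" by (rule LIMSEQ_Suc[OF lim_1_over_n])
  have "(\<lambda>n. Complex x (1 / real (Suc n))) \<longlonglongrightarrow> Complex x 0"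
    by (rule tendsto_Complex[OF tendsto_const lim0])
  then have "w \<longlonglongrightarrow> of_real x" unfolding w_def complex_of_real_def .
  then have "(\<lambda>n. sub (w n)) \<longlonglongrightarrow> sub (of_real x)"
    by (rule continuous_on_tendsto_compose[OF continuous_on_sub]) (auto simp: w_def)
  from tendsto_diff[OF tendsto_Im[OF this] lim0]
  have "(\<lambda>n. Im (sub (w n)) - 1 / real (Suc n)) \<longlonglongrightarrow> pi * dens x" by (simp add: dens_def)
  moreover have "Im (stieltjes \<rho> (w n)) = Im (sub (w n)) - 1 / real (Suc n)" for n
    using subI[OF subordinate_upper[of "w n"]] by (simp add: w_def)
  ultimately show "(\<lambda>n. Im (stieltjes \<rho> (Complex x (1 / real (Suc n))))) \<longlonglongrightarrow> pi * dens x"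
    by (simp add: w_def)
next
  show "dens \<in> borel_measurable borel"
    using continuous_on_dens by (rule borel_measurable_continuous_onI)
qed

text \<open>A vanishing density means that the boundary value of the solution is real, hence a real
  point outside the interval. Conversely, each admissible real point solves the equation and, by
  uniqueness, is that boundary value.\<close>

lemma dens_zero_iff:
  "dens E = 0 \<longleftrightarrow> (\<exists>y. (y < a \<or> b < y) \<and> resolvent_sq \<mu> y \<le> 1 \<and> E = shifted_map \<mu> y)"
proof
  assume "dens E = 0"
  then have "sub (of_real E) = of_real (Re (sub (of_real E)))" by (simp add: dens_def complex_eq_iff)
  then obtain y where y: "sub (of_real E) = of_real y" by blast
  have s: "subordinate (of_real E) (of_real y)" using subordinate_sub[of "of_real E"] y by simp
  then have nin: "complex_of_real y \<notin> hullC" by (simp add: subordinate_def)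
  then have "E = shifted_map \<mu> y" "resolvent_sq \<mu> y \<le> 1"
    using s shifted_stieltjes_of_real[OF nin] by (auto simp: subordinate_def g_of_real)
  then show "\<exists>y. (y < a \<or> b < y) \<and> resolvent_sq \<mu> y \<le> 1 \<and> E = shifted_map \<mu> y"
    using nin unfolding notin_hullC(3) by blast
next
  assume "\<exists>y. (y < a \<or> b < y) \<and> resolvent_sq \<mu> y \<le> 1 \<and> E = shifted_map \<mu> y"
  then obtain y where nin: "complex_of_real y \<notin> hullC" and y: "resolvent_sq \<mu> y \<le> 1" "E = shifted_map \<mu> y"
    unfolding notin_hullC(3)[symmetric] by blast
  then have "subordinate (of_real E) (of_real y)"
    using shifted_stieltjes_of_real[OF nin] by (simp add: subordinate_def g_of_real)
  then show "dens E = 0" by (simp add: dens_def subI)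
qed

lemma one_cut_edges:
  obtains x y where "b < x" "resolvent_sq \<mu> x = 1" "y < a" "resolvent_sq \<mu> y = 1"
    "one_cut \<rho> (shifted_map \<mu> y) (shifted_map \<mu> x)"
proof -
  obtain x where x: "b < x" "resolvent_sq \<mu> x = 1"
      "{E. \<exists>y>b. resolvent_sq \<mu> y \<le> 1 \<and> E = shifted_map \<mu> y} = {shifted_map \<mu> x..}"
    using upper_edge stable[OF a_le_b order_refl] by blast
  obtain y where y: "y < a" "resolvent_sq \<mu> y = 1"
      "{E. \<exists>y<a. resolvent_sq \<mu> y \<le> 1 \<and> E = shifted_map \<mu> y} = {..shifted_map \<mu> y}"
    using lower_edge stable[OF order_refl a_le_b] by blast
  define p where "p = shifted_map \<mu> x"
  define m where "m = shifted_map \<mu> y"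
  have "dens E = 0 \<longleftrightarrow> E \<in> {E. \<exists>y<a. resolvent_sq \<mu> y \<le> 1 \<and> E = shifted_map \<mu> y} \<or>
      E \<in> {E. \<exists>y>b. resolvent_sq \<mu> y \<le> 1 \<and> E = shifted_map \<mu> y}" for E
    unfolding dens_zero_iff by blast
  then have zero: "dens E = 0 \<longleftrightarrow> E \<le> m \<or> p \<le> E" for E
    unfolding x(3) y(3) by (simp add: p_def m_def)
  \<comment> \<open>Points with positive density are dense in \<open>{m..p}\<close>; this is what
    places the two edges themselves in the support.\<close>
  have sup: "\<exists>E\<in>U. m < E \<and> E < p" if U: "open U" "e \<in> U" and e: "m \<le> e" "e \<le> p" for U e
  proof -
    \<comment> \<open>Otherwise the value \<open>m\<close> would be taken on both sides of the hull,
      at \<open>y\<close> and at some \<open>t\<close>, against uniqueness of the solution.\<close>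
    have mp: "m < p"
    proof (rule ccontr)
      assume "\<not> m < p"
      have yn: "complex_of_real y \<notin> hullC" using y(1) a_le_b by auto
      from \<open>\<not> m < p\<close> have "m \<in> {shifted_map \<mu> x..}" by (simp add: p_def)
      then obtain t where t: "b < t" "resolvent_sq \<mu> t \<le> 1" "m = shifted_map \<mu> t"
        unfolding x(3)[symmetric] by blast
      have tn: "complex_of_real t \<notin> hullC" using t(1) by auto
      have "subordinate (of_real m) (of_real t)" "subordinate (of_real m) (of_real y)"
        using shifted_stieltjes_of_real[OF tn] shifted_stieltjes_of_real[OF yn] tn yn t y(2)
        by (auto simp: subordinate_def g_of_real m_def)
      then have "complex_of_real t = of_real y" by (rule subordinate_unique)
      then have "t = y" by (simp only: of_real_eq_iff)
      with t y a_le_b show False by simp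
    qed
    obtain d where d: "0 < d" "ball e d \<subseteq> U" using openE[OF U] .
    define E where "E = (if e < p then e + min (d / 2) ((p - e) / 2) else p - min (d / 2) ((p - m) / 2))"
    have "\<bar>E - e\<bar> < d \<and> m < E \<and> E < p"
    proof (cases "e < p")
      case True
      define t where "t = min (d / 2) ((p - e) / 2)"
      have "0 < t" "t \<le> d / 2" "t \<le> (p - e) / 2" using d(1) True by (auto simp: t_def min_def)
      moreover have "E = e + t" using True by (simp add: E_def t_def)
      ultimately show ?thesis using e True d(1) by auto
    next
      case False
      define t where "t = min (d / 2) ((p - m) / 2)"
      have "0 < t" "t \<le> d / 2" "t \<le> (p - m) / 2" using d(1) mp by (auto simp: t_def min_def)
      moreover have "E = p - t" "e = p" using False e by (auto simp: E_def t_def)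
      ultimately show ?thesis using mp d(1) by auto
    qed
    then show ?thesis using d(2) by (intro bexI[of _ E]) (auto simp: dist_real_def)
  qed
  have meas: "dens \<in> borel_measurable borel"
    using continuous_on_dens by (rule borel_measurable_continuous_onI)
  have supp: "msupp \<rho> = {m..p}"
  proof (intro set_eqI iffI)
    fix e assume e: "e \<in> msupp \<rho>"
    show "e \<in> {m..p}"
    proof (rule ccontr)
      assume "e \<notin> {m..p}"
      then have "0 < emeasure \<rho> (- {m..p})"
        using e open_Compl[OF closed_atLeastAtMost, of m p] unfolding msupp_def by blast
      moreover have "emeasure \<rho> (- {m..p}) = (\<integral>\<^sup>+x. ennreal (dens x) * indicator (- {m..p}) x \<partial>lborel)"
        by (subst \<rho>_density, rule emeasure_density) (use meas in auto)
      moreover have "\<dots> = (\<integral>\<^sup>+x. 0 \<partial>(lborel :: real measure))"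
      proof (rule nn_integral_cong)
        show "ennreal (dens x) * indicator (- {m..p}) x = 0" for x
          using zero[of x] by (cases "x \<in> {m..p}") auto
      qed
      ultimately show False by simp
    qed
  next
    fix e assume e: "e \<in> {m..p}"
    show "e \<in> msupp \<rho>"
      unfolding msupp_def mem_Collect_eq
    proof (intro allI impI)
      fix U :: "real set" assume U: "open U" "e \<in> U"
      let ?O = "U \<inter> {m<..<p}"
      have O: "open ?O" "?O \<noteq> {}" using sup[OF U] e U by auto
      show "0 < emeasure \<rho> U"
      proof (rule ccontr)
        assume "\<not> 0 < emeasure \<rho> U"
        then have "emeasure \<rho> U = 0" by simp
        moreover have "emeasure \<rho> U = (\<integral>\<^sup>+x. ennreal (dens x) * indicator U x \<partial>lborel)"
          by (subst \<rho>_density, rule emeasure_density) (use meas U in auto)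
        moreover have "(\<lambda>x. ennreal (dens x) * indicator U x) \<in> borel_measurable lborel"
          using meas borel_open[OF U(1)] by simp
        ultimately have "AE x in lborel. ennreal (dens x) * indicator U x = 0"
          using nn_integral_0_iff_AE by metis
        then have "AE x in lborel. x \<notin> ?O"
        proof eventually_elim
          case (elim x)
          show ?case
          proof
            assume x: "x \<in> ?O"
            then have "0 < dens x" using zero[of x] dens_nonneg[of x] by (auto simp: less_le)
            with elim x show False by (simp add: indicator_def)
          qed
        qed
        then have "?O \<in> null_sets lborel"
          using O(1) by (subst AE_iff_null_sets) auto
        then have "negligible ?O"
          unfolding negligible_iff_null_sets by (rule null_sets_completionI)
        then show False using O open_not_negligible by blast
      qed
    qed
  qed
  have "one_cut \<rho> m p"
    unfolding one_cut_def
  proof (intro conjI exI[of _ dens] allI ballI)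
    show "continuous_on {m<..<p} dens" using continuous_on_dens continuous_on_subset by blast
    show "0 < dens x" if "x \<in> {m<..<p}" for x
      using zero[of x] dens_nonneg[of x] that by (auto simp: less_le)
  qed (use supp meas dens_nonneg \<rho>_density in auto)
  then show ?thesis using that x y by (simp add: m_def p_def)
qed

end

section \<open>Supports\<close>

text \<open>The complement of the support is covered by null open sets, and a countable basis
  reduces them to countably many.\<close>

lemma AE_msupp:
  assumes "sets \<mu> = sets borel"
  shows "AE v in \<mu>. v \<in> msupp \<mu>"
proof -
  obtain B :: "real set set" where B: "countable B" "topological_basis B"
    using ex_countable_basis by blast
  define N where "N = {U \<in> B. emeasure \<mu> U = 0}"
  have "\<Union>N \<in> null_sets \<mu>"
    using B topological_basis_open[OF B(2)] assms
    by (intro null_sets_UN'[where N = "\<lambda>U. U", simplified]) (auto simp: N_def null_sets_def)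
  moreover have "{v \<in> space \<mu>. v \<notin> msupp \<mu>} \<subseteq> \<Union>N"
  proof safe
    fix v assume "v \<notin> msupp \<mu>"
    then obtain U where U: "open U" "v \<in> U" "emeasure \<mu> U = 0" by (auto simp: msupp_def)
    obtain C where C: "C \<in> B" "v \<in> C" "C \<subseteq> U"
      using topological_basisE[OF B(2) U(1,2)] by blast
    have "emeasure \<mu> C \<le> emeasure \<mu> U"
      using C U assms by (intro emeasure_mono) auto
    then show "v \<in> \<Union>N" using C U by (auto simp: N_def)
  qed
  ultimately show ?thesis by (rule AE_I')
qed

lemma msupp_subset:
  assumes "sets \<mu> = sets borel" "closed C" "AE v in \<mu>. v \<in> C"
  shows "msupp \<mu> \<subseteq> C"
proof
  fix x assume x: "x \<in> msupp \<mu>"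
  show "x \<in> C"
  proof (rule ccontr)
    assume "x \<notin> C"
    then have "0 < emeasure \<mu> (- C)" using x assms(2) unfolding msupp_def by blast
    moreover have "- C \<in> null_sets \<mu>"
      using assms by (subst AE_iff_null_sets) auto
    ultimately show False by auto
  qed
qed

lemma closed_msupp: "closed (msupp \<mu>)"
proof -
  have "- msupp \<mu> = \<Union>{U. open U \<and> emeasure \<mu> U = 0}" by (auto simp: msupp_def)
  then show ?thesis by (metis (no_types, lifting) closed_def mem_Collect_eq open_Union)
qed

context compact_law
begin

lemma supp_hull_interval:
  obtains c d where "supp_hull \<mu> = {c..d}" "c \<in> msupp \<mu>" "d \<in> msupp \<mu>" "compact_law \<mu> c d" "a \<le> c" "d \<le> b"
proof -
  have AE: "AE v in \<mu>. v \<in> msupp \<mu>" by (rule AE_msupp[OF sets_eq])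
  have sub: "msupp \<mu> \<subseteq> {a..b}"
    by (rule msupp_subset[OF sets_eq]) (use AE_bounds in auto)
  then have comp: "compact (msupp \<mu>)"
    using closed_msupp by (metis bounded_closed_interval bounded_subset compact_eq_bounded_closed)
  have ne: "msupp \<mu> \<noteq> {}"
  proof
    assume "msupp \<mu> = {}"
    with AE have "AE v in \<mu>. False" by simp
    then show False by simp
  qed
  obtain c where c: "c \<in> msupp \<mu>" "\<And>v. v \<in> msupp \<mu> \<Longrightarrow> c \<le> v"
    using compact_attains_inf[OF comp ne] by blast
  obtain d where d: "d \<in> msupp \<mu>" "\<And>v. v \<in> msupp \<mu> \<Longrightarrow> v \<le> d"
    using compact_attains_sup[OF comp ne] by blast
  have hull: "supp_hull \<mu> = {c..d}"
    unfolding supp_hull_def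
  proof (rule hull_unique)
    show "msupp \<mu> \<subseteq> {c..d}" using c d by auto
    show "is_interval {c..d}" by (rule is_interval_cc)
    fix T assume "msupp \<mu> \<subseteq> T" "is_interval T"
    then show "{c..d} \<subseteq> T" using c(1) d(1) unfolding is_interval_1 by (meson atLeastAtMost_iff subset_iff)
  qed
  have "compact_law \<mu> c d"
  proof
    show "AE v in \<mu>. c \<le> v \<and> v \<le> d" using AE by eventually_elim (use c d in auto)
  qed (rule sets_eq)
  moreover have "a \<le> c" "d \<le> b" using c(1) d(1) sub by auto
  ultimately show ?thesis using that[OF hull c(1) d(1)] by blast
qed

lemma supported_on_compact_interval: "supported_on_compact_interval \<mu>"
proof -
  obtain c d where cd: "supp_hull \<mu> = {c..d}" "compact_law \<mu> c d" by (rule supp_hull_interval)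
  interpret cd: compact_law \<mu> c d by fact
  have "prob {c..d} = 1"
    using cd.AE_bounds by (subst prob_eq_1) (auto simp: sets_eq)
  then show ?thesis
    unfolding supported_on_compact_interval_def cd(1) using sets_eq prob_space_axioms by auto
qed

lemma stable_law_hull:
  assumes "stable_at_level c \<mu>" "1 < c"
  obtains l u where "stable_law \<mu> l u" "a \<le> l" "u \<le> b"
proof -
  obtain l u where lu: "supp_hull \<mu> = {l..u}" "compact_law \<mu> l u" "a \<le> l" "u \<le> b"
    by (rule supp_hull_interval)
  have "1 < (\<integral>\<^sup>+v. inverse (ennreal ((v - x)\<^sup>2)) \<partial>\<mu>)" if "l \<le> x" "x \<le> u" for x
  proof -
    have "1 < ennreal c" using assms(2) by simp
    also have "ennreal c \<le> (INF x\<in>supp_hull \<mu>. \<integral>\<^sup>+v. inverse (ennreal ((v - x)\<^sup>2)) \<partial>\<mu>)"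
      using assms(1) by (simp add: stable_at_level_def)
    also have "\<dots> \<le> (\<integral>\<^sup>+v. inverse (ennreal ((v - x)\<^sup>2)) \<partial>\<mu>)"
      by (rule INF_lower) (use that lu in auto)
    finally show ?thesis .
  qed
  then have "stable_law \<mu> l u"
    using lu(2) by (simp add: stable_law_def stable_law_axioms_def)
  then show ?thesis using that lu by blast
qed

end

section \<open>The smeared measure\<close>

lemma nn_integral_two_point:
  assumes [measurable]: "f \<in> borel_measurable borel"
  shows "(\<integral>\<^sup>+y. f y \<partial>two_point e) = (f e + f (- e)) / 2"
  unfolding two_point_def uniform_count_measure_def
  by (subst nn_integral_distr)
    (auto simp: nn_integral_point_measure_finite divide_ennreal_def distrib_left add.commute mult.commute)

lemma integral_two_point:
  fixes f :: "real \<Rightarrow> 'a::{banach, second_countable_topology}"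
  assumes [measurable]: "f \<in> borel_measurable borel"
  shows "(\<integral>y. f y \<partial>two_point e) = (f e + f (- e)) /\<^sub>R 2"
  unfolding two_point_def uniform_count_measure_def
  by (subst integral_distr, simp, simp, subst lebesgue_integral_point_measure_finite)
    (simp_all add: scaleR_add_right add.commute)

lemma two_point_props: "prob_space (two_point e)" "sets (two_point e) = sets borel"
proof -
  interpret prob_space "uniform_count_measure {- 1, 1 :: real}"
    by (rule prob_space_uniform_count_measure) auto
  show "prob_space (two_point e)" unfolding two_point_def
    by (rule prob_space_distr) (auto simp: measurable_def space_uniform_count_measure sets_uniform_count_measure)
  show "sets (two_point e) = sets borel" by (simp add: two_point_def)
qed

context compact_law
begin

lemma nn_integral_smeared:
  assumes [measurable]: "f \<in> borel_measurable borel"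
  shows "(\<integral>\<^sup>+w. f w \<partial>smeared l e \<mu>) = (\<integral>\<^sup>+v. (f (l * v + e) + f (l * v - e)) / 2 \<partial>\<mu>)"
proof -
  interpret T: prob_space "two_point e" by (rule two_point_props)
  interpret D: prob_space "distr \<mu> borel (\<lambda>x. l * x)" by (rule prob_space_distr) measurable
  have "(\<integral>\<^sup>+w. f w \<partial>smeared l e \<mu>)
      = (\<integral>\<^sup>+x. \<integral>\<^sup>+y. f (x + y) \<partial>two_point e \<partial>distr \<mu> borel (\<lambda>x. l * x))"
    unfolding smeared_def
    by (rule nn_integral_convolution) (auto simp: two_point_props T.finite_measure_axioms D.finite_measure_axioms)
  also have "\<dots> = (\<integral>\<^sup>+x. (f (x + e) + f (x - e)) / 2 \<partial>distr \<mu> borel (\<lambda>x. l * x))"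
    by (intro nn_integral_cong) (subst nn_integral_two_point, auto)
  also have "\<dots> = (\<integral>\<^sup>+v. (f (l * v + e) + f (l * v - e)) / 2 \<partial>\<mu>)"
    by (subst nn_integral_distr) auto
  finally show ?thesis .
qed

lemma integral_smeared:
  fixes f :: "real \<Rightarrow> 'c::{banach, second_countable_topology}"
  assumes int: "integrable (smeared l e \<mu>) f" and [measurable]: "f \<in> borel_measurable borel"
  shows "(\<integral>w. f w \<partial>smeared l e \<mu>) = (\<integral>v. (f (l * v + e) + f (l * v - e)) /\<^sub>R 2 \<partial>\<mu>)"
proof -
  let ?D = "distr \<mu> borel (\<lambda>x. l * x)"
  interpret T: prob_space "two_point e" by (rule two_point_props)
  interpret D: prob_space ?D by (rule prob_space_distr) measurable
  interpret P: pair_sigma_finite ?D "two_point e" by unfold_locales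
  have [measurable_cong]: "sets (two_point e) = sets borel" by (rule two_point_props)
  have plus: "(\<lambda>(x, y). x + y) \<in> ?D \<Otimes>\<^sub>M two_point e \<rightarrow>\<^sub>M borel"
    by (simp add: split_beta') 
  have "(\<integral>w. f w \<partial>smeared l e \<mu>) = (\<integral>p. f (case p of (x, y) \<Rightarrow> x + y) \<partial>(?D \<Otimes>\<^sub>M two_point e))"
    unfolding smeared_def convolution_def by (rule integral_distr[OF plus]) measurable
  also have "\<dots> = (\<integral>x. \<integral>y. f (x + y) \<partial>two_point e \<partial>?D)"
  proof -
    have "integrable (?D \<Otimes>\<^sub>M two_point e) (\<lambda>p. f (case p of (x, y) \<Rightarrow> x + y))"
      using int unfolding smeared_def convolution_def by (subst (asm) integrable_distr_eq[OF plus]) auto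
    from P.integral_fst'[OF this] show ?thesis by simp
  qed
  also have "\<dots> = (\<integral>x. (f (x + e) + f (x - e)) /\<^sub>R 2 \<partial>?D)"
    by (intro Bochner_Integration.integral_cong refl) (subst integral_two_point, auto)
  also have "\<dots> = (\<integral>v. (f (l * v + e) + f (l * v - e)) /\<^sub>R 2 \<partial>\<mu>)"
    by (subst integral_distr) auto
  finally show ?thesis .
qed

lemma compact_law_smeared:
  assumes "0 \<le> l" "0 \<le> e"
  shows "compact_law (smeared l e \<mu>) (l * a - e) (l * b + e)"
proof -
  have sets: "sets (smeared l e \<mu>) = sets borel" by (simp add: smeared_def)
  have "emeasure (smeared l e \<mu>) (space (smeared l e \<mu>)) = (\<integral>\<^sup>+w. 1 \<partial>smeared l e \<mu>)" by simp
  also have "\<dots> = 1"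
    by (subst nn_integral_smeared) (auto simp: emeasure_space_1)
  finally interpret S: prob_space "smeared l e \<mu>" by (rule prob_spaceI)
  let ?I = "{l * a - e..l * b + e}"
  have "emeasure (smeared l e \<mu>) (- ?I) = (\<integral>\<^sup>+w. indicator (- ?I) w \<partial>smeared l e \<mu>)"
    by (rule nn_integral_indicator[symmetric]) (simp add: sets)
  also have "\<dots> = (\<integral>\<^sup>+v. (indicator (- ?I) (l * v + e) + indicator (- ?I) (l * v - e)) / 2 \<partial>\<mu>)"
    by (rule nn_integral_smeared) simp
  also have "\<dots> = (\<integral>\<^sup>+v. 0 \<partial>\<mu>)"
  proof (rule nn_integral_cong_AE)
    show "AE v in \<mu>. (indicator (- ?I) (l * v + e) + indicator (- ?I) (l * v - e)) / 2 = (0 :: ennreal)"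
      using AE_bounds
    proof eventually_elim
      case (elim v)
      then have "l * a \<le> l * v" "l * v \<le> l * b" using assms(1) by (auto intro: mult_left_mono)
      then have "l * v + e \<in> ?I" "l * v - e \<in> ?I" using assms(2) by auto
      then show ?case by simp
    qed
  qed
  finally have "- ?I \<in> null_sets (smeared l e \<mu>)" by (simp add: null_sets_def sets)
  then have "AE w in smeared l e \<mu>. w \<notin> - ?I" by (rule AE_not_in)
  then show ?thesis by unfold_locales (auto simp: sets)
qed

lemma integrable_bounded_measurable:
  fixes f :: "real \<Rightarrow> 'c::{banach, second_countable_topology}"
  assumes "f \<in> borel_measurable borel" "\<And>v. a \<le> v \<Longrightarrow> v \<le> b \<Longrightarrow> norm (f v) \<le> B"
  shows "integrable \<mu> f"
proof (rule integrable_const_bound[of _ B])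
  show "AE v in \<mu>. norm (f v) \<le> B" using AE_bounds by eventually_elim (use assms in auto)
qed (use assms sets_eq in \<open>simp cong: measurable_cong_sets\<close>)

lemma integrable_power: "integrable \<mu> (\<lambda>v. v ^ k)"
proof (rule integrable_bounded_measurable)
  show "norm (v ^ k) \<le> (\<bar>a\<bar> + \<bar>b\<bar>) ^ k" if "a \<le> v" "v \<le> b" for v
    unfolding norm_power by (rule power_mono) (use that in auto)
qed simp

lemma smeared_moment:
  assumes "0 \<le> l" "0 \<le> e"
  shows "moment (smeared l e \<mu>) k = (\<integral>v. ((l * v + e) ^ k + (l * v - e) ^ k) / 2 \<partial>\<mu>)"
proof -
  interpret S: compact_law "smeared l e \<mu>" "l * a - e" "l * b + e" by (rule compact_law_smeared[OF assms])
  have "x /\<^sub>R 2 = x / 2" for x :: real by simp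
  then show ?thesis unfolding moment_def by (subst integral_smeared[OF S.integrable_power]) simp_all
qed

text \<open>Averaging over the two shifts cancels the odd powers of \<open>e\<close>. The fifth
  moment is included because it enters the error of the edge expansion.\<close>

lemma smeared_moment_values:
  assumes "0 \<le> l" "0 \<le> e"
  defines "m \<equiv> moment (smeared l e \<mu>)"
  shows "m 1 = l * moment \<mu> 1"
    and "m 2 = l\<^sup>2 * moment \<mu> 2 + e\<^sup>2"
    and "m 3 = l ^ 3 * moment \<mu> 3 + 3 * l * e\<^sup>2 * moment \<mu> 1"
    and "m 4 = l ^ 4 * moment \<mu> 4 + 6 * l\<^sup>2 * e\<^sup>2 * moment \<mu> 2 + e ^ 4"
    and "m 5 = l ^ 5 * moment \<mu> 5 + 10 * l ^ 3 * e\<^sup>2 * moment \<mu> 3 + 5 * l * e ^ 4 * moment \<mu> 1"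
proof -
  note int = integrable_power integrable_power[of 1, simplified]
  have "((l * v + e) ^ 1 + (l * v - e) ^ 1) / 2 = l * v ^ 1" for v by simp
  then show "m 1 = l * moment \<mu> 1"
    unfolding m_def smeared_moment[OF assms(1,2)] unfolding moment_def using int by simp
  have "((l * v + e) ^ 2 + (l * v - e) ^ 2) / 2 = l\<^sup>2 * v ^ 2 + e\<^sup>2" for v
    by (simp add: power2_eq_square algebra_simps)
  then show "m 2 = l\<^sup>2 * moment \<mu> 2 + e\<^sup>2"
    unfolding m_def smeared_moment[OF assms(1,2)] unfolding moment_def using int by (simp add: prob_space)
  have "((l * v + e) ^ 3 + (l * v - e) ^ 3) / 2 = l ^ 3 * v ^ 3 + 3 * l * e\<^sup>2 * v ^ 1" for v
    by (simp add: power2_eq_square power3_eq_cube algebra_simps)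
  then show "m 3 = l ^ 3 * moment \<mu> 3 + 3 * l * e\<^sup>2 * moment \<mu> 1"
    unfolding m_def smeared_moment[OF assms(1,2)] unfolding moment_def using int by simp
  have "((l * v + e) ^ 4 + (l * v - e) ^ 4) / 2 = l ^ 4 * v ^ 4 + 6 * l\<^sup>2 * e\<^sup>2 * v ^ 2 + e ^ 4" for v
    by (simp add: eval_nat_numeral algebra_simps)
  then show "m 4 = l ^ 4 * moment \<mu> 4 + 6 * l\<^sup>2 * e\<^sup>2 * moment \<mu> 2 + e ^ 4"
    unfolding m_def smeared_moment[OF assms(1,2)] unfolding moment_def using int by (simp add: prob_space)
  have "((l * v + e) ^ 5 + (l * v - e) ^ 5) / 2
      = l ^ 5 * v ^ 5 + 10 * l ^ 3 * e\<^sup>2 * v ^ 3 + 5 * l * e ^ 4 * v ^ 1" for v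
    by (simp add: eval_nat_numeral algebra_simps)
  then show "m 5 = l ^ 5 * moment \<mu> 5 + 10 * l ^ 3 * e\<^sup>2 * moment \<mu> 3 + 5 * l * e ^ 4 * moment \<mu> 1"
    unfolding m_def smeared_moment[OF assms(1,2)] unfolding moment_def using int by simp
qed

lemma smeared_moments:
  assumes "0 \<le> l" "0 \<le> s" "0 < q"
  shows "smeared_moments l s q \<mu>"
proof -
  have e: "0 \<le> sqrt s / q" "(sqrt s / q)\<^sup>2 = s / q\<^sup>2" "(sqrt s / q) ^ 4 = s\<^sup>2 / q ^ 4"
  proof -
    show "(sqrt s / q)\<^sup>2 = s / q\<^sup>2" using assms by (simp add: power_divide)
    have "(sqrt s / q) ^ 4 = ((sqrt s / q)\<^sup>2)\<^sup>2" by simp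
    also have "\<dots> = s\<^sup>2 / q ^ 4" using assms by (simp add: power_divide)
    finally show "(sqrt s / q) ^ 4 = s\<^sup>2 / q ^ 4" .
  qed (use assms in auto)
  show ?thesis
    unfolding smeared_moments_def Let_def smeared_moment_values[OF assms(1) e(1)] e(2,3)
    by (simp add: field_simps)
qed

text \<open>With \<open>y = l * v - \<xi>\<close>, the mean of \<open>1 / (y + e)\<close> and
  \<open>1 / (y - e)\<close> is \<open>y / (y^2 - e^2)\<close>, that is, the inverse of
  \<open>y - e^2 / y\<close>.\<close>

lemma stieltjes_smeared:
  assumes l: "0 \<le> l" "0 \<le> e" and \<xi>: "0 < Im \<xi>"
  shows "stieltjes (smeared l e \<mu>) \<xi>
    = (\<integral>v. inverse (of_real (l * v) - \<xi> - of_real (e\<^sup>2) * (1 / (of_real (l * v) - \<xi>))) \<partial>\<mu>)"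
proof -
  interpret S: compact_law "smeared l e \<mu>" "l * a - e" "l * b + e" by (rule compact_law_smeared[OF l])
  have "stieltjes (smeared l e \<mu>) \<xi>
      = (\<integral>v. (1 / (complex_of_real (l * v + e) - \<xi>) + 1 / (complex_of_real (l * v - e) - \<xi>)) /\<^sub>R 2 \<partial>\<mu>)"
    unfolding stieltjes_def
    by (rule integral_smeared[OF S.integrable_stieltjes[OF S.notin_hullC(1)[OF \<xi>]]]) measurable
  also have "(\<lambda>v. (1 / (complex_of_real (l * v + e) - \<xi>) + 1 / (complex_of_real (l * v - e) - \<xi>)) /\<^sub>R 2)
      = (\<lambda>v. inverse (of_real (l * v) - \<xi> - of_real (e\<^sup>2) * (1 / (of_real (l * v) - \<xi>))))"
  proof
    fix v
    define y where "y = complex_of_real (l * v) - \<xi>"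
    have im: "Im y \<noteq> 0" using \<xi> by (simp add: y_def)
    then have nz: "y \<noteq> 0" "y + of_real e \<noteq> 0" "y - of_real e \<noteq> 0" by (auto simp: complex_eq_iff)
    have d: "complex_of_real (l * v + e) - \<xi> = y + of_real e" "complex_of_real (l * v - e) - \<xi> = y - of_real e"
      by (simp_all add: y_def)
    have "(1 / (y + of_real e) + 1 / (y - of_real e)) /\<^sub>R 2 = y / ((y + of_real e) * (y - of_real e))"
      using nz by (simp add: scaleR_conv_of_real field_simps)
    also have "(y + of_real e) * (y - of_real e) = y * (y - of_real (e\<^sup>2) * (1 / y))"
      using nz by (simp add: field_simps power2_eq_square)
    also have "y / \<dots> = inverse (y - of_real (e\<^sup>2) * (1 / y))"
      using nz by (simp add: inverse_eq_divide)
    finally show "(1 / (complex_of_real (l * v + e) - \<xi>) + 1 / (complex_of_real (l * v - e) - \<xi>)) /\<^sub>R 2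
      = inverse (of_real (l * v) - \<xi> - of_real (e\<^sup>2) * (1 / (of_real (l * v) - \<xi>)))"
      unfolding d y_def[symmetric] .
  qed
  finally show ?thesis .
qed

end

section \<open>Expansion of the edges\<close>

text \<open>These bounds serve the test point \<open>1 + \<delta>\<close> with
  \<open>2 * \<delta> = 3 * m 2\<close>. The last one says that, up to the first and third moments,
  the derivative of \<open>shifted_map\<close> there is of second order in
  \<open>\<delta>\<close>.\<close>

lemma bernoulli_inverse:
  fixes \<delta> t :: real
  assumes "0 \<le> \<delta>" "t = 1 / (1 + \<delta>)"
  shows "0 < t" "t \<le> 1" "\<bar>t ^ n - 1\<bar> \<le> real n * \<delta>" "\<bar>t ^ 3 - 1 + 3 * \<delta>\<bar> \<le> 6 * \<delta>\<^sup>2"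
    "\<bar>1 - t\<^sup>2 - 2 * \<delta> * t ^ 4\<bar> \<le> 6 * \<delta>\<^sup>2"
proof -
  show t: "0 < t" "t \<le> 1" using assms by auto
  have td: "(1 + \<delta>) * t = 1" using assms by auto
  have lower: "1 - real n * \<delta> \<le> t ^ n" for n
  proof -
    have "1 - \<delta> \<le> t"
    proof -
      have "(1 - \<delta>) * (1 + \<delta>) \<le> t * (1 + \<delta>)" using td by (simp add: algebra_simps)
      then show ?thesis using assms(1) by (simp only: mult_le_cancel_right_pos add_pos_nonneg zero_less_one)
    qed
    moreover have "1 + real n * (t - 1) \<le> (1 + (t - 1)) ^ n"
      using t by (intro Bernoulli_inequality) auto
    moreover have "real n * (- \<delta>) \<le> real n * (t - 1)" using calculation(1) by (intro mult_left_mono) auto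
    ultimately show ?thesis by simp
  qed
  show "\<bar>t ^ n - 1\<bar> \<le> real n * \<delta>"
    using lower[of n] power_le_one[of t n] t assms(1) by (simp add: abs_le_iff)
  show "\<bar>t ^ 3 - 1 + 3 * \<delta>\<bar> \<le> 6 * \<delta>\<^sup>2"
  proof -
    \<comment> \<open>Clearing the denominator of \<open>t ^ 3\<close> leaves a polynomial in
      \<open>\<delta>\<close> without negative coefficients.\<close>
    have "(1 - 3 * \<delta> + 6 * \<delta>\<^sup>2) * (1 + \<delta>) ^ 3 = 1 + 10 * \<delta> ^ 3 + 15 * \<delta> ^ 4 + 6 * \<delta> ^ 5"
      by (simp add: eval_nat_numeral algebra_simps)
    then have "1 \<le> (1 - 3 * \<delta> + 6 * \<delta>\<^sup>2) * (1 + \<delta>) ^ 3" using assms(1) by simp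
    then have "1 * t ^ 3 \<le> (1 - 3 * \<delta> + 6 * \<delta>\<^sup>2) * (1 + \<delta>) ^ 3 * t ^ 3"
      using t by (intro mult_right_mono) auto
    also have "\<dots> = (1 - 3 * \<delta> + 6 * \<delta>\<^sup>2) * ((1 + \<delta>) * t) ^ 3" by (simp add: power_mult_distrib)
    finally have "t ^ 3 \<le> 1 - 3 * \<delta> + 6 * \<delta>\<^sup>2" using td by simp
    then show ?thesis using lower[of 3] by (simp add: abs_le_iff)
  qed
  \<comment> \<open>The relation \<open>1 - t = \<delta> * t\<close> extracts one factor
    \<open>\<delta>\<close>; the bracket that remains is itself bounded by a multiple of
    \<open>\<delta>\<close>.\<close>
  have "1 - t\<^sup>2 - 2 * \<delta> * t ^ 4 = \<delta> * (t * ((1 - t ^ 3) * 2 - (1 - t)))"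
    using td by algebra
  moreover have "\<bar>t * ((1 - t ^ 3) * 2 - (1 - t))\<bar> \<le> 6 * \<delta>"
  proof -
    have "0 \<le> (1 - t ^ 3) * 2 - (1 - t)" using power_decreasing[of 1 3 t] t by simp
    moreover have "(1 - t ^ 3) * 2 - (1 - t) \<le> 6 * \<delta>" using lower[of 3] t by simp
    ultimately show ?thesis using t
      by (simp add: abs_mult) (meson mult_left_le_one_le order.trans less_imp_le)
  qed
  ultimately show "\<bar>1 - t\<^sup>2 - 2 * \<delta> * t ^ 4\<bar> \<le> 6 * \<delta>\<^sup>2"
    using mult_left_mono[of _ _ \<delta>] assms(1) by (fastforce simp: abs_mult power2_eq_square)
qed

context compact_law
begin

lemma integral_close:
  fixes f h :: "real \<Rightarrow> real"
  assumes "integrable \<mu> f" "integrable \<mu> h" "\<And>v. a \<le> v \<Longrightarrow> v \<le> b \<Longrightarrow> \<bar>f v - h v\<bar> \<le> c"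
  shows "\<bar>(\<integral>v. f v \<partial>\<mu>) - (\<integral>v. h v \<partial>\<mu>)\<bar> \<le> c"
proof -
  have int: "integrable \<mu> (\<lambda>v. f v - h v)" using assms by simp
  have "\<bar>\<integral>v. f v - h v \<partial>\<mu>\<bar> \<le> (\<integral>v. \<bar>f v - h v\<bar> \<partial>\<mu>)"
    using integral_norm_bound[of \<mu> "\<lambda>v. f v - h v"] by simp
  also have "\<dots> \<le> (\<integral>v. c \<partial>\<mu>)"
  proof (rule integral_mono_AE)
    show "AE v in \<mu>. \<bar>f v - h v\<bar> \<le> c" using AE_bounds by eventually_elim (use assms(3) in auto)
  qed (use int in auto)
  finally show ?thesis using assms by (simp add: prob_space)
qed

lemma moment_bound:
  assumes "\<bar>a\<bar> \<le> \<kappa>" "\<bar>b\<bar> \<le> \<kappa>"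
  shows "\<bar>moment \<mu> k\<bar> \<le> \<kappa> ^ k"
proof -
  have "\<bar>(\<integral>v. v ^ k \<partial>\<mu>) - (\<integral>v. 0 \<partial>\<mu>)\<bar> \<le> \<kappa> ^ k"
  proof (rule integral_close)
    show "\<bar>v ^ k - 0\<bar> \<le> \<kappa> ^ k" if "a \<le> v" "v \<le> b" for v
      unfolding diff_zero power_abs by (rule power_mono) (use that assms in auto)
  qed (auto intro: integrable_power)
  then show ?thesis by (simp add: moment_def)
qed

text \<open>
  The point \<open>x\<close> minimizes \<open>shifted_map\<close> to the right of the support, so that the value at any
  other point exceeds the minimum by the square of the derivative there, up to constants.
\<close>

lemma shifted_map_near_minimum:
  assumes x: "b < x" "resolvent_sq \<mu> x = 1"
    and x0: "\<And>v. a \<le> v \<Longrightarrow> v \<le> b \<Longrightarrow> 1 / 2 \<le> x0 - v" "\<And>v. a \<le> v \<Longrightarrow> v \<le> b \<Longrightarrow> x0 - v \<le> 2"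
  shows "0 \<le> shifted_map \<mu> x0 - shifted_map \<mu> x"
    and "shifted_map \<mu> x0 - shifted_map \<mu> x \<le> 8 * (1 - resolvent_sq \<mu> x0)\<^sup>2"
proof -
  have bx0: "b < x0" using x0(1)[OF a_le_b order_refl] by simp
  note int = integrable_resolvents[OF right_of_hull[OF x(1)]] integrable_resolvents[OF right_of_hull[OF bx0]]
  let ?d = "x0 - x"
  \<comment> \<open>Because \<open>resolvent_sq\<close> is 1 at \<open>x\<close>, the displacement
    \<open>?d\<close> can be written under the integral. The linear terms then cancel and
    \<open>?h v\<close> equals \<open>?d^2 / ((x - v)^2 * (x0 - v))\<close>.\<close>
  let ?h = "\<lambda>v. ?d * (1 / (x - v)\<^sup>2) + (1 / (x0 - v) - 1 / (x - v))"
  have h_int: "integrable \<mu> ?h"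
    by (intro Bochner_Integration.integrable_add Bochner_Integration.integrable_diff integrable_mult_right int)
  have one: "(\<integral>v. c * (1 / (x - v)\<^sup>2) \<partial>\<mu>) = c" for c
    using x(2) unfolding integral_mult_right_zero resolvent_sq_def by simp
  have "(\<integral>v. ?h v \<partial>\<mu>) = (\<integral>v. ?d * (1 / (x - v)\<^sup>2) \<partial>\<mu>) + ((\<integral>v. 1 / (x0 - v) \<partial>\<mu>) - (\<integral>v. 1 / (x - v) \<partial>\<mu>))"
    unfolding Bochner_Integration.integral_add[OF integrable_mult_right[OF int(2)]
        Bochner_Integration.integrable_diff[OF int(3) int(1)]]
      Bochner_Integration.integral_diff[OF int(3) int(1)] ..
  then have diff: "shifted_map \<mu> x0 - shifted_map \<mu> x = (\<integral>v. ?h v \<partial>\<mu>)"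
    unfolding one by (simp add: shifted_map_def)
  have h: "0 \<le> ?h v \<and> ?h v \<le> 2 * ?d\<^sup>2 * (1 / (x - v)\<^sup>2)" if "a \<le> v" "v \<le> b" for v
  proof -
    define P where "P = x - v"
    define Q where "Q = x0 - v"
    have P: "0 < P" using that x by (simp add: P_def)
    have Q: "1 / 2 \<le> Q" using x0 that by (simp add: Q_def)
    have eq: "?h v = ?d\<^sup>2 * (1 / P\<^sup>2) * (1 / Q)"
    proof -
      have d: "?d = Q - P" by (simp add: P_def Q_def)
      have "(Q - P) * (1 / P\<^sup>2) + (1 / Q - 1 / P) = (Q - P)\<^sup>2 * (1 / P\<^sup>2) * (1 / Q)"
        using P Q by (simp add: field_simps power2_eq_square)
      then show ?thesis unfolding P_def[symmetric] Q_def[symmetric] d .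
    qed
    have "1 / Q \<le> 2" using Q by (simp add: field_simps)
    then have "?d\<^sup>2 * (1 / P\<^sup>2) * (1 / Q) \<le> ?d\<^sup>2 * (1 / P\<^sup>2) * 2" by (intro mult_left_mono) auto
    also have "\<dots> = 2 * ?d\<^sup>2 * (1 / (x - v)\<^sup>2)" by (simp add: P_def)
    finally show ?thesis unfolding eq using P Q by simp
  qed
  show "0 \<le> shifted_map \<mu> x0 - shifted_map \<mu> x"
    unfolding diff
  proof (rule integral_nonneg_AE)
    show "AE v in \<mu>. 0 \<le> ?h v" using AE_bounds by eventually_elim (use h in blast)
  qed
  have "(\<integral>v. ?h v \<partial>\<mu>) \<le> (\<integral>v. 2 * ?d\<^sup>2 * (1 / (x - v)\<^sup>2) \<partial>\<mu>)"
  proof (rule integral_mono_AE[OF h_int integrable_mult_right[OF int(2)]])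
    show "AE v in \<mu>. ?h v \<le> 2 * ?d\<^sup>2 * (1 / (x - v)\<^sup>2)" using AE_bounds by eventually_elim (use h in blast)
  qed
  then have le: "shifted_map \<mu> x0 - shifted_map \<mu> x \<le> 2 * ?d\<^sup>2" unfolding diff one .
  have r: "(P + Q) / Q\<^sup>2 \<ge> 1 / 2" if "0 < P" "1 / 2 \<le> Q" "Q \<le> 2" for P Q :: real
  proof -
    have "1 / 2 \<le> 1 / Q" using that by (intro divide_left_mono) auto
    also have "1 / Q = Q / Q\<^sup>2" using that by (simp add: power2_eq_square)
    also have "\<dots> \<le> (P + Q) / Q\<^sup>2" using that by (intro divide_right_mono) auto
    finally show ?thesis .
  qed
  \<comment> \<open>The last factor is at least 1/2, so \<open>resolvent_sq\<close> changes at rate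
    at least 1/2 between the two points and \<open>\<bar>?d\<bar>\<close> is at most twice
    \<open>\<bar>1 - resolvent_sq \<mu> x0\<bar>\<close>. Inserted into the bound
    \<open>2 * ?d^2\<close>, this gives the constant 8.\<close>
  have kd: "1 / (x - v)\<^sup>2 - 1 / (x0 - v)\<^sup>2 = ?d * ((1 / (x - v)\<^sup>2) * (((x - v) + (x0 - v)) / (x0 - v)\<^sup>2))"
    if "a \<le> v" "v \<le> b" for v
  proof -
    define P where "P = x - v"
    define Q where "Q = x0 - v"
    have PQ: "0 < P" "0 < Q" and d: "?d = Q - P" using that x bx0 by (auto simp: P_def Q_def)
    have "1 / P\<^sup>2 - 1 / Q\<^sup>2 = (Q - P) * ((1 / P\<^sup>2) * ((P + Q) / Q\<^sup>2))"
      using PQ by (simp add: field_simps power2_eq_square)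
    then show ?thesis unfolding P_def[symmetric] Q_def[symmetric] d .
  qed
  have ratio: "1 / 2 * (1 / (x - v)\<^sup>2) \<le> (1 / (x - v)\<^sup>2) * (((x - v) + (x0 - v)) / (x0 - v)\<^sup>2)"
    if "a \<le> v" "v \<le> b" for v
  proof -
    have "(1 / (x - v)\<^sup>2) * (1 / 2) \<le> (1 / (x - v)\<^sup>2) * (((x - v) + (x0 - v)) / (x0 - v)\<^sup>2)"
    proof (intro mult_left_mono r)
      show "0 < x - v" using x that by simp
    qed (use x0 that in auto)
    then show ?thesis by simp
  qed
  have "1 - resolvent_sq \<mu> x0 = (\<integral>v. 1 / (x - v)\<^sup>2 - 1 / (x0 - v)\<^sup>2 \<partial>\<mu>)"
    using x(2) int by (simp add: resolvent_sq_def)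
  moreover have "?d / 2 \<le> (\<integral>v. 1 / (x - v)\<^sup>2 - 1 / (x0 - v)\<^sup>2 \<partial>\<mu>)" if "0 \<le> ?d"
  proof -
    have "(\<integral>v. ?d / 2 * (1 / (x - v)\<^sup>2) \<partial>\<mu>) \<le> (\<integral>v. 1 / (x - v)\<^sup>2 - 1 / (x0 - v)\<^sup>2 \<partial>\<mu>)"
    proof (rule integral_mono_AE)
      show "AE v in \<mu>. ?d / 2 * (1 / (x - v)\<^sup>2) \<le> 1 / (x - v)\<^sup>2 - 1 / (x0 - v)\<^sup>2"
        using AE_bounds
      proof eventually_elim
        case (elim v)
        then show ?case using mult_left_mono[OF ratio[of v] that] kd[of v] by (simp add: mult.assoc)
      qed
      show "integrable \<mu> (\<lambda>v. ?d / 2 * (1 / (x - v)\<^sup>2))" by (rule integrable_mult_right[OF int(2)])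
    qed (intro Bochner_Integration.integrable_diff int)
    then show ?thesis unfolding one .
  qed
  moreover have "(\<integral>v. 1 / (x - v)\<^sup>2 - 1 / (x0 - v)\<^sup>2 \<partial>\<mu>) \<le> ?d / 2" if "?d \<le> 0"
  proof -
    have "(\<integral>v. 1 / (x - v)\<^sup>2 - 1 / (x0 - v)\<^sup>2 \<partial>\<mu>) \<le> (\<integral>v. ?d / 2 * (1 / (x - v)\<^sup>2) \<partial>\<mu>)"
    proof (rule integral_mono_AE)
      show "AE v in \<mu>. 1 / (x - v)\<^sup>2 - 1 / (x0 - v)\<^sup>2 \<le> ?d / 2 * (1 / (x - v)\<^sup>2)"
        using AE_bounds
      proof eventually_elim
        case (elim v)
        then show ?case using mult_left_mono_neg[OF ratio[of v] that] kd[of v] by (simp add: mult.assoc)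
      qed
      show "integrable \<mu> (\<lambda>v. ?d / 2 * (1 / (x - v)\<^sup>2))" by (rule integrable_mult_right[OF int(2)])
    qed (intro Bochner_Integration.integrable_diff int)
    then show ?thesis unfolding one .
  qed
  ultimately have "\<bar>?d\<bar> \<le> \<bar>2 * (1 - resolvent_sq \<mu> x0)\<bar>" by (cases "0 \<le> ?d") auto
  then have "?d\<^sup>2 \<le> (2 * (1 - resolvent_sq \<mu> x0))\<^sup>2" by (simp only: abs_le_square_iff)
  then have "2 * ?d\<^sup>2 \<le> 8 * (1 - resolvent_sq \<mu> x0)\<^sup>2" unfolding power_mult_distrib by simp
  with le show "shifted_map \<mu> x0 - shifted_map \<mu> x \<le> 8 * (1 - resolvent_sq \<mu> x0)\<^sup>2" by linarith
qed

end

text \<open>The geometric series of \<open>1 / (x - v)\<close> in powers of \<open>v / x\<close>,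
  and the series of its square, both with exact remainders.\<close>

lemma kernel_expansion:
  fixes t u v x :: real
  assumes "x * t = 1" "(x - v) * u = 1"
  shows "u - (t + v * t ^ 2 + v ^ 2 * t ^ 3 + v ^ 3 * t ^ 4 + v ^ 4 * t ^ 5 + v ^ 5 * t ^ 6) = v ^ 6 * t ^ 6 * u"
    and "u\<^sup>2 - (t ^ 2 + 2 * v * t ^ 3 + 3 * v ^ 2 * t ^ 4 + 4 * v ^ 3 * t ^ 5) = v ^ 4 * t ^ 4 * (5 - 4 * (v * t)) * u\<^sup>2"
  using assms by algebra+

text \<open>
  The test point \<open>1 + 3/2 m\<^sub>2\<close> is the minimizer of \<open>shifted_map\<close> up to errors whose squares are
  negligible.
\<close>

lemma edge_point_expansion:
  fixes \<mu> :: "real measure" and \<kappa> x :: real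
  defines "m \<equiv> moment \<mu>"
  assumes law: "compact_law \<mu> (- \<kappa>) \<kappa>" and \<kappa>: "\<kappa> \<le> 1 / 4" and x: "\<kappa> < x" "resolvent_sq \<mu> x = 1"
  shows "\<bar>shifted_map \<mu> x - (2 + m 1 + m 2 + m 3 + (m 4 - 9 / 4 * (m 2)\<^sup>2))\<bar>
    \<le> 20000 * (\<kappa> ^ 6 + \<bar>m 5\<bar> + \<bar>m 3\<bar> * m 2 + \<bar>m 1\<bar> * (\<bar>m 1\<bar> + m 2))"
proof -
  interpret compact_law \<mu> "- \<kappa>" \<kappa> by (rule law)
  have \<kappa>0: "0 \<le> \<kappa>" using a_le_b by simp
  have mb: "\<bar>m k\<bar> \<le> \<kappa> ^ k" for k unfolding m_def by (rule moment_bound) (use \<kappa>0 in auto)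
  have m2: "0 \<le> m 2" unfolding m_def moment_def by (rule integral_nonneg_AE) auto
  have \<kappa>2: "\<kappa>\<^sup>2 \<le> 1 / 16" using power_mono[OF \<kappa> \<kappa>0, of 2] by (simp add: power_divide)
  \<comment> \<open>Up to the first and third moments, \<open>resolvent_sq\<close> at
    \<open>1 + \<delta>\<close> is \<open>1 - 2 * \<delta> + 3 * m 2\<close> to leading order; this
    choice makes it 1.\<close>
  define \<delta> where "\<delta> = 3 / 2 * m 2"
  define t where "t = 1 / (1 + \<delta>)"
  have \<delta>0: "0 \<le> \<delta>" using m2 by (simp add: \<delta>_def)
  have \<delta>\<kappa>: "\<delta> \<le> 3 / 2 * \<kappa>\<^sup>2" using mb[of 2] m2 by (simp add: \<delta>_def)
  have \<delta>1: "\<delta> \<le> 1 / 8" using \<delta>\<kappa> \<kappa>2 by simp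
  note bern = bernoulli_inverse[OF \<delta>0 t_def]
  have xt: "(1 + \<delta>) * t = 1" using \<delta>0 by (simp add: t_def)
  have dist: "3 / 4 \<le> 1 + \<delta> - v" "1 + \<delta> - v \<le> 2" if "- \<kappa> \<le> v" "v \<le> \<kappa>" for v
    using that \<delta>0 \<delta>1 \<kappa> by auto
  have nin: "complex_of_real (1 + \<delta>) \<notin> hullC" by (rule right_of_hull) (use \<delta>0 \<kappa> in auto)
  note int = integrable_resolvents[OF nin]
  have pow: "\<bar>v ^ k\<bar> \<le> \<kappa> ^ k" if "- \<kappa> \<le> v" "v \<le> \<kappa>" for v k
    unfolding power_abs by (rule power_mono) (use that in auto)
  have tp: "0 \<le> t ^ k" "t ^ k \<le> 1" for k using bern(1,2) by (auto intro: power_le_one)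
  have u: "0 \<le> 1 / (1 + \<delta> - v)" "1 / (1 + \<delta> - v) \<le> 4 / 3" "(1 + \<delta> - v) * (1 / (1 + \<delta> - v)) = 1"
    if "- \<kappa> \<le> v" "v \<le> \<kappa>" for v
    using dist(1)[OF that] by (auto simp: field_simps)
  let ?p = "\<lambda>v. t + v * t ^ 2 + v ^ 2 * t ^ 3 + v ^ 3 * t ^ 4 + v ^ 4 * t ^ 5 + v ^ 5 * t ^ 6"
  let ?q = "\<lambda>v. t ^ 2 + 2 * v * t ^ 3 + 3 * v ^ 2 * t ^ 4 + 4 * v ^ 3 * t ^ 5"
  note intp = integrable_power integrable_power[of 1, simplified]
  have "\<bar>(\<integral>v. 1 / (1 + \<delta> - v) \<partial>\<mu>) - (\<integral>v. ?p v \<partial>\<mu>)\<bar> \<le> 2 * \<kappa> ^ 6"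
  proof (rule integral_close[OF int(1)])
    show "integrable \<mu> ?p" using intp by simp
    fix v assume v: "- \<kappa> \<le> v" "v \<le> \<kappa>"
    have "\<bar>1 / (1 + \<delta> - v) - ?p v\<bar> = \<bar>v ^ 6\<bar> * (t ^ 6 * (1 / (1 + \<delta> - v)))"
      unfolding kernel_expansion(1)[OF xt u(3)[OF v]] using tp u(1)[OF v] by (simp add: abs_mult)
    also have "\<dots> \<le> \<kappa> ^ 6 * (1 * 2)"
      using pow[OF v, of 6] tp[of 6] u[OF v] \<kappa>0 by (intro mult_mono) auto
    finally show "\<bar>1 / (1 + \<delta> - v) - ?p v\<bar> \<le> 2 * \<kappa> ^ 6" by simp
  qed
  moreover have "(\<integral>v. ?p v \<partial>\<mu>) = t + m 1 * t ^ 2 + m 2 * t ^ 3 + m 3 * t ^ 4 + m 4 * t ^ 5 + m 5 * t ^ 6"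
    unfolding m_def moment_def using intp by (simp add: prob_space)
  ultimately have exp1: "\<bar>shifted_map \<mu> (1 + \<delta>) - (1 + \<delta> + t + m 1 * t ^ 2 + m 2 * t ^ 3 + m 3 * t ^ 4 + m 4 * t ^ 5 + m 5 * t ^ 6)\<bar> \<le> 2 * \<kappa> ^ 6"
    by (simp add: shifted_map_def)
  have "\<bar>resolvent_sq \<mu> (1 + \<delta>) - (\<integral>v. ?q v \<partial>\<mu>)\<bar> \<le> 12 * \<kappa> ^ 4"
    unfolding resolvent_sq_def
  proof (rule integral_close[OF int(2)])
    show "integrable \<mu> ?q" using intp by simp
    fix v assume v: "- \<kappa> \<le> v" "v \<le> \<kappa>"
    have "\<bar>v * t\<bar> \<le> 1 / 4 * 1" unfolding abs_mult using v \<kappa> bern by (intro mult_mono) auto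
    then have vt: "\<bar>5 - 4 * (v * t)\<bar> \<le> 6" by (auto simp: abs_le_iff)
    have u2: "(1 / (1 + \<delta> - v))\<^sup>2 \<le> 2" using power_mono[OF u(2,1)[OF v], of 2] by (simp add: power_divide)
    have "\<bar>1 / (1 + \<delta> - v)\<^sup>2 - ?q v\<bar> = \<bar>v ^ 4\<bar> * (t ^ 4 * (\<bar>5 - 4 * (v * t)\<bar> * (1 / (1 + \<delta> - v))\<^sup>2))"
      using kernel_expansion(2)[OF xt u(3)[OF v]] tp by (simp add: abs_mult power_divide)
    also have "\<dots> \<le> \<kappa> ^ 4 * (1 * (6 * 2))"
      using pow[OF v, of 4] tp[of 4] u[OF v] \<kappa>0 vt u2 by (intro mult_mono) auto
    finally show "\<bar>1 / (1 + \<delta> - v)\<^sup>2 - ?q v\<bar> \<le> 12 * \<kappa> ^ 4" by simp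
  qed
  moreover have "(\<integral>v. ?q v \<partial>\<mu>) = t ^ 2 + 2 * m 1 * t ^ 3 + 3 * m 2 * t ^ 4 + 4 * m 3 * t ^ 5"
    unfolding m_def moment_def using intp by (simp add: prob_space)
  moreover have "\<bar>1 - (t ^ 2 + 2 * m 1 * t ^ 3 + 3 * m 2 * t ^ 4 + 4 * m 3 * t ^ 5)\<bar> \<le> 14 * \<kappa> ^ 4 + 2 * \<bar>m 1\<bar> + 4 * \<bar>m 3\<bar>"
  proof -
    have "\<delta>\<^sup>2 \<le> (3 / 2 * \<kappa>\<^sup>2)\<^sup>2" using \<delta>\<kappa> \<delta>0 by (intro power_mono) auto
    then have "6 * \<delta>\<^sup>2 \<le> 27 / 2 * \<kappa> ^ 4" by (simp add: power_mult_distrib power_divide)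
    moreover have "0 \<le> \<kappa> ^ 4" using \<kappa>0 by simp
    ultimately have "6 * \<delta>\<^sup>2 \<le> 14 * \<kappa> ^ 4" by linarith
    then have "\<bar>1 - t\<^sup>2 - 3 * m 2 * t ^ 4\<bar> \<le> 14 * \<kappa> ^ 4" using bern(5) by (simp add: \<delta>_def)
    moreover have "\<bar>2 * m 1 * t ^ 3\<bar> \<le> 2 * \<bar>m 1\<bar>" "\<bar>4 * m 3 * t ^ 5\<bar> \<le> 4 * \<bar>m 3\<bar>"
      using tp[of 3] tp[of 5] by (simp_all add: abs_mult mult_left_le)
    ultimately show ?thesis by linarith
  qed
  ultimately have r: "\<bar>1 - resolvent_sq \<mu> (1 + \<delta>)\<bar> \<le> 26 * \<kappa> ^ 4 + 2 * \<bar>m 1\<bar> + 4 * \<bar>m 3\<bar>" by linarith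
  \<comment> \<open>The squares of the \<open>\<kappa> ^ 4\<close> and \<open>m 3\<close> terms are
    absorbed into \<open>\<kappa> ^ 6\<close>. The square of \<open>m 1\<close> is kept, as it
    vanishes for centered measures.\<close>
  have r2: "(1 - resolvent_sq \<mu> (1 + \<delta>))\<^sup>2 \<le> 2100 * \<kappa> ^ 6 + 12 * (m 1)\<^sup>2"
  proof -
    have sq3: "(A + B + C)\<^sup>2 \<le> 3 * (A\<^sup>2 + B\<^sup>2 + C\<^sup>2)" for A B C :: real
      using zero_le_power2[of "A - B"] zero_le_power2[of "A - C"] zero_le_power2[of "B - C"]
      by (simp add: power2_eq_square algebra_simps)
    have "(1 - resolvent_sq \<mu> (1 + \<delta>))\<^sup>2 \<le> (26 * \<kappa> ^ 4 + 2 * \<bar>m 1\<bar> + 4 * \<bar>m 3\<bar>)\<^sup>2"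
      using r by (metis abs_ge_zero power2_abs power_mono)
    also have "\<dots> \<le> 3 * ((26 * \<kappa> ^ 4)\<^sup>2 + (2 * \<bar>m 1\<bar>)\<^sup>2 + (4 * \<bar>m 3\<bar>)\<^sup>2)" by (rule sq3)
    also have "\<dots> = 2028 * (\<kappa>\<^sup>2 * \<kappa> ^ 6) + 12 * (m 1)\<^sup>2 + 48 * (\<bar>m 3\<bar>)\<^sup>2"
      by (simp add: power_mult_distrib flip: power_add power_mult)
    finally have *: "(1 - resolvent_sq \<mu> (1 + \<delta>))\<^sup>2 \<le> 2028 * (\<kappa>\<^sup>2 * \<kappa> ^ 6) + 12 * (m 1)\<^sup>2 + 48 * (\<bar>m 3\<bar>)\<^sup>2" .
    have "(\<bar>m 3\<bar>)\<^sup>2 \<le> (\<kappa> ^ 3)\<^sup>2" using mb[of 3] by (intro power_mono) auto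
    then have "(\<bar>m 3\<bar>)\<^sup>2 \<le> \<kappa> ^ 6" by (simp flip: power_mult)
    moreover have "\<kappa>\<^sup>2 * \<kappa> ^ 6 \<le> 1 * \<kappa> ^ 6" using \<kappa>2 \<kappa>0 by (intro mult_right_mono) auto
    moreover have "0 \<le> \<kappa> ^ 6" using \<kappa>0 by simp
    ultimately show ?thesis using * by linarith
  qed
  have near: "0 \<le> shifted_map \<mu> (1 + \<delta>) - shifted_map \<mu> x"
      "shifted_map \<mu> (1 + \<delta>) - shifted_map \<mu> x \<le> 8 * (1 - resolvent_sq \<mu> (1 + \<delta>))\<^sup>2"
    by (rule shifted_map_near_minimum[OF x]; use dist in force)+
  have poly: "\<bar>1 + \<delta> + t + m 1 * t ^ 2 + m 2 * t ^ 3 + m 3 * t ^ 4 + m 4 * t ^ 5 + m 5 * t ^ 6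
      - (2 + m 1 + m 2 + m 3 + (m 4 - 9 / 4 * (m 2)\<^sup>2))\<bar>
      \<le> 100 * \<kappa> ^ 6 + \<bar>m 5\<bar> + 6 * (\<bar>m 3\<bar> * m 2) + 3 * (\<bar>m 1\<bar> * m 2)"
  proof -
    \<comment> \<open>The coefficient -9/4 arises here: \<open>\<delta>^2\<close> comes from
      \<open>1 + \<delta> + t\<close> and \<open>- 3 * \<delta> * m 2\<close> from
      \<open>m 2 * t ^ 3\<close>, which together are \<open>(9/4 - 9/2) * (m 2)^2\<close>.\<close>
    have id: "1 + \<delta> + t + m 1 * t ^ 2 + m 2 * t ^ 3 + m 3 * t ^ 4 + m 4 * t ^ 5 + m 5 * t ^ 6
      - (2 + m 1 + m 2 + m 3 + (m 4 - 9 / 4 * (m 2)\<^sup>2))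
      = (- (\<delta> ^ 3 * t)) + m 1 * (t ^ 2 - 1) + m 2 * (t ^ 3 - 1 + 3 * \<delta>) + m 3 * (t ^ 4 - 1) + m 4 * (t ^ 5 - 1) + m 5 * t ^ 6"
    proof -
      have "1 + \<delta> + t = 2 + \<delta>\<^sup>2 - \<delta> ^ 3 * t" using xt by algebra
      moreover have "\<delta>\<^sup>2 + 9 / 4 * (m 2)\<^sup>2 = 3 * \<delta> * m 2" by (simp add: \<delta>_def power2_eq_square)
      ultimately show ?thesis by (simp add: algebra_simps)
    qed
    have b1: "\<bar>\<delta> ^ 3 * t\<bar> \<le> 4 * \<kappa> ^ 6"
    proof -
      have "\<delta> ^ 3 \<le> (3 / 2 * \<kappa>\<^sup>2) ^ 3" using \<delta>\<kappa> \<delta>0 by (intro power_mono) auto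
      also have "\<dots> \<le> 4 * \<kappa> ^ 6" by (simp add: power_mult_distrib power_divide flip: power_mult)
      finally have "\<delta> ^ 3 \<le> 4 * \<kappa> ^ 6" .
      moreover have "\<delta> ^ 3 * t \<le> \<delta> ^ 3" using bern \<delta>0 by (simp add: mult_left_le)
      ultimately show ?thesis using bern \<delta>0 by simp
    qed
    have b2: "\<bar>m 1 * (t ^ 2 - 1)\<bar> \<le> 3 * (\<bar>m 1\<bar> * m 2)"
    proof -
      have "\<bar>m 1 * (t ^ 2 - 1)\<bar> \<le> \<bar>m 1\<bar> * (2 * \<delta>)"
        unfolding abs_mult using bern(3)[of 2] by (intro mult_left_mono) auto
      then show ?thesis by (simp add: \<delta>_def)
    qed
    have b3: "\<bar>m 2 * (t ^ 3 - 1 + 3 * \<delta>)\<bar> \<le> 14 * \<kappa> ^ 6"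
    proof -
      have "6 * \<delta>\<^sup>2 \<le> 6 * (3 / 2 * \<kappa>\<^sup>2)\<^sup>2" using \<delta>\<kappa> \<delta>0 by (intro mult_left_mono power_mono) auto
      then have "\<bar>t ^ 3 - 1 + 3 * \<delta>\<bar> \<le> 27 / 2 * \<kappa> ^ 4" using bern(4) by (simp add: power_mult_distrib power_divide)
      then have "\<bar>m 2\<bar> * \<bar>t ^ 3 - 1 + 3 * \<delta>\<bar> \<le> \<kappa>\<^sup>2 * (27 / 2 * \<kappa> ^ 4)"
        using mb[of 2] by (intro mult_mono) auto
      also have "\<dots> = 27 / 2 * \<kappa> ^ 6" by (simp flip: power_add)
      also have "\<dots> \<le> 14 * \<kappa> ^ 6" using \<kappa>0 by (intro mult_right_mono) auto
      finally show ?thesis by (simp add: abs_mult)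
    qed
    have b4: "\<bar>m 3 * (t ^ 4 - 1)\<bar> \<le> 6 * (\<bar>m 3\<bar> * m 2)"
    proof -
      have "\<bar>m 3 * (t ^ 4 - 1)\<bar> \<le> \<bar>m 3\<bar> * (4 * \<delta>)"
        unfolding abs_mult using bern(3)[of 4] by (intro mult_left_mono) auto
      then show ?thesis by (simp add: \<delta>_def)
    qed
    have b5: "\<bar>m 4 * (t ^ 5 - 1)\<bar> \<le> 8 * \<kappa> ^ 6"
    proof -
      have "\<bar>t ^ 5 - 1\<bar> \<le> 15 / 2 * \<kappa>\<^sup>2" using bern(3)[of 5] \<delta>\<kappa> by simp
      then have "\<bar>m 4\<bar> * \<bar>t ^ 5 - 1\<bar> \<le> \<kappa> ^ 4 * (15 / 2 * \<kappa>\<^sup>2)"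
        using mb[of 4] \<kappa>0 by (intro mult_mono) auto
      also have "\<dots> = 15 / 2 * \<kappa> ^ 6" by (simp flip: power_add)
      also have "\<dots> \<le> 8 * \<kappa> ^ 6" using \<kappa>0 by (intro mult_right_mono) auto
      finally show ?thesis by (simp add: abs_mult)
    qed
    have b6: "\<bar>m 5 * t ^ 6\<bar> \<le> \<bar>m 5\<bar>" using tp[of 6] by (simp add: abs_mult mult_left_le)
    have tri: "\<bar>- x1 + x2 + x3 + x4 + x5 + x6\<bar> \<le> c1 + c2 + c3 + c4 + c5 + c6"
      if "\<bar>x1\<bar> \<le> c1" "\<bar>x2\<bar> \<le> c2" "\<bar>x3\<bar> \<le> c3" "\<bar>x4\<bar> \<le> c4" "\<bar>x5\<bar> \<le> c5" "\<bar>x6\<bar> \<le> c6"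
      for x1 x2 x3 x4 x5 x6 c1 c2 c3 c4 c5 c6 :: real
      using that unfolding abs_le_iff by simp
    have "0 \<le> \<kappa> ^ 6" using \<kappa>0 by simp
    then show ?thesis unfolding id by (intro order_trans[OF tri[OF b1 b2 b3 b4 b5 b6]]) simp
  qed
  have nn: "0 \<le> \<kappa> ^ 6" "0 \<le> \<bar>m 5\<bar>" "0 \<le> \<bar>m 3\<bar> * m 2" "0 \<le> \<bar>m 1\<bar> * m 2" "0 \<le> (m 1)\<^sup>2"
    using \<kappa>0 m2 by auto
  have m1: "\<bar>m 1\<bar> * (\<bar>m 1\<bar> + m 2) = (m 1)\<^sup>2 + \<bar>m 1\<bar> * m 2"
    by (simp add: algebra_simps power2_eq_square flip: abs_mult)
  \<comment> \<open>The coefficient of \<open>k\<close> adds up to 2 + 100 + 8 * 2100 = 16902; all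
    the others are far smaller than 20000.\<close>
  have combine: "\<bar>S - T\<bar> \<le> 20000 * (k + p5 + p3 + (s + p1))"
    if "\<bar>A - B\<bar> \<le> 2 * k" "0 \<le> A - S" "A - S \<le> 8 * R" "R \<le> 2100 * k + 12 * s"
      "\<bar>B - T\<bar> \<le> 100 * k + p5 + 6 * p3 + 3 * p1" "0 \<le> k" "0 \<le> p5" "0 \<le> p3" "0 \<le> p1" "0 \<le> s"
    for S T A B R k p5 p3 s p1 :: real
  proof -
    define c where "c = 102 * k + p5 + 6 * p3 + 3 * p1"
    have "S - T \<le> c" "T - S \<le> c + 8 * R" using that(1,2,3,5) by (simp_all add: abs_le_iff c_def)
    moreover have "c \<le> 20000 * (k + p5 + p3 + (s + p1))"
      unfolding c_def using that(6-10) by simp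
    moreover have "c + 8 * R \<le> 20000 * (k + p5 + p3 + (s + p1))"
      unfolding c_def using that(4,6-10) by simp
    ultimately show ?thesis by linarith
  qed
  show ?thesis unfolding m1 by (rule combine[OF exp1 near r2 poly nn])
qed

lemma add_power6_le:
  fixes x y :: real
  assumes "0 \<le> x" "0 \<le> y"
  shows "(x + y) ^ 6 \<le> 64 * (x ^ 6 + y ^ 6)"
proof -
  have "(x + y) ^ 6 \<le> (2 * max x y) ^ 6" using assms by (intro power_mono) auto
  also have "\<dots> = 64 * (max x y) ^ 6" by (simp add: power_mult_distrib)
  also have "(max x y) ^ 6 \<le> x ^ 6 + y ^ 6" using assms by (cases "x \<le> y") (auto simp: max_def)
  finally show ?thesis by simp
qed

text \<open>The error terms of the general expansion are reduced to the quantities that appear in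
  \<open>edge_error\<close>, with a constant depending on the support only.\<close>

lemma smeared_error_bound:
  fixes l e K :: real
  assumes law: "compact_law \<mu> (- K) K" and l: "0 \<le> l" "l \<le> 1" and e: "0 \<le> e" "e \<le> 1"
  defines "m \<equiv> moment (smeared l e \<mu>)"
  shows "(l * K + e) ^ 6 + \<bar>m 5\<bar> + \<bar>m 3\<bar> * m 2 + \<bar>m 1\<bar> * (\<bar>m 1\<bar> + m 2)
    \<le> (100 + 64 * K ^ 6 + 2 * K ^ 5 + 3 * K\<^sup>2) * (l ^ 5 + e ^ 6 + \<bar>m 3\<bar> * e\<^sup>2 + \<bar>m 1\<bar> * (\<bar>m 1\<bar> + m 2))"
proof -
  interpret compact_law \<mu> "- K" K by (rule law)
  have K: "0 \<le> K" using a_le_b by simp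
  have vb: "\<bar>moment \<mu> k\<bar> \<le> K ^ k" for k by (rule moment_bound) (use K in auto)
  have v2: "0 \<le> moment \<mu> 2" unfolding moment_def by (rule integral_nonneg_AE) auto
  note mv = smeared_moment_values[OF l(1) e(1), folded m_def]
  have m2: "e\<^sup>2 \<le> m 2" unfolding mv(2) using v2 by simp
  then have m2_0: "0 \<le> m 2" by (meson order.trans zero_le_power2)
  have e4: "e ^ 4 \<le> m 2"
    using m2 power_decreasing[of 2 4 e] e by simp
  define p where "p = \<bar>m 1\<bar> * m 2"
  define r where "r = \<bar>m 3\<bar> * e\<^sup>2"
  have pr: "0 \<le> p" "0 \<le> r" using m2_0 by (auto simp: p_def r_def)
  have l65: "l ^ 6 \<le> l ^ 5" using l by (intro power_decreasing) auto
  have b1: "(l * K + e) ^ 6 \<le> 64 * (K ^ 6 * l ^ 5) + 64 * e ^ 6"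
  proof -
    have "(l * K + e) ^ 6 \<le> 64 * ((l * K) ^ 6 + e ^ 6)" using l e K by (intro add_power6_le) auto
    moreover have "(l * K) ^ 6 \<le> K ^ 6 * l ^ 5"
      unfolding power_mult_distrib mult.commute[of "l ^ 6"] using l65 K by (intro mult_left_mono) auto
    then have "64 * ((l * K) ^ 6 + e ^ 6) \<le> 64 * (K ^ 6 * l ^ 5 + e ^ 6)"
      by (intro mult_left_mono add_mono) auto
    ultimately show ?thesis unfolding distrib_left by (rule order_trans)
  qed
  have b2: "\<bar>m 5\<bar> \<le> K ^ 5 * l ^ 5 + 10 * r + 25 * p"
  proof -
    \<comment> \<open>The mixed term \<open>10 * l^3 * e^2\<close> of the fifth moment is traded for
      the smeared third moment; since \<open>m 3\<close> carries \<open>3 * l * e^2\<close> times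
      the mean, the coefficient 5 of the mean turns into 5 - 30 = -25.\<close>
    have "m 5 = l ^ 5 * moment \<mu> 5 + 10 * (m 3 * e\<^sup>2) - 25 * (m 1 * e ^ 4)"
      unfolding mv by (simp add: eval_nat_numeral algebra_simps)
    moreover have "\<bar>l ^ 5 * moment \<mu> 5\<bar> \<le> K ^ 5 * l ^ 5"
      unfolding abs_mult using vb[of 5] l by (simp add: mult.commute[of "K ^ 5"] mult_left_mono)
    moreover have "\<bar>m 3 * e\<^sup>2\<bar> = r" by (simp add: r_def abs_mult)
    moreover have "\<bar>m 1 * e ^ 4\<bar> \<le> p" unfolding p_def abs_mult using e4 e by (intro mult_left_mono) auto
    ultimately show ?thesis by linarith
  qed
  have b3: "\<bar>m 3\<bar> * m 2 \<le> K ^ 5 * l ^ 5 + 3 * K\<^sup>2 * p + r"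
  proof -
    have "\<bar>m 3\<bar> \<le> l ^ 3 * K ^ 3 + 3 * (e\<^sup>2 * \<bar>m 1\<bar>)"
    proof -
      have "m 3 = l ^ 3 * moment \<mu> 3 + 3 * (e\<^sup>2 * m 1)" unfolding mv by (simp add: algebra_simps)
      moreover have "\<bar>l ^ 3 * moment \<mu> 3\<bar> \<le> l ^ 3 * K ^ 3"
        unfolding abs_mult using vb[of 3] l by (simp add: mult_left_mono)
      moreover have "\<bar>e\<^sup>2 * m 1\<bar> = e\<^sup>2 * \<bar>m 1\<bar>" by (simp add: abs_mult)
      ultimately show ?thesis by linarith
    qed
    \<comment> \<open>Only the part \<open>l^2 * K^2\<close> of the bound on \<open>m 2\<close> is
      combined with the bound on \<open>m 3\<close>; the part \<open>e^2\<close> gives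
      \<open>r\<close> as it stands.\<close>
    then have "\<bar>m 3\<bar> * (l\<^sup>2 * K\<^sup>2) \<le> (l ^ 3 * K ^ 3 + 3 * (e\<^sup>2 * \<bar>m 1\<bar>)) * (l\<^sup>2 * K\<^sup>2)"
      by (intro mult_right_mono) auto
    also have "\<dots> = K ^ 5 * l ^ 5 + 3 * K\<^sup>2 * (l\<^sup>2 * (\<bar>m 1\<bar> * e\<^sup>2))"
      by (simp add: eval_nat_numeral algebra_simps)
    also have "l\<^sup>2 * (\<bar>m 1\<bar> * e\<^sup>2) \<le> 1 * p"
      unfolding p_def using l m2 by (intro mult_mono) (auto intro: mult_left_mono power_le_one)
    finally have "\<bar>m 3\<bar> * (l\<^sup>2 * K\<^sup>2) \<le> K ^ 5 * l ^ 5 + 3 * K\<^sup>2 * p" by (simp add: mult_left_mono)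
    moreover have "m 2 \<le> l\<^sup>2 * K\<^sup>2 + e\<^sup>2" unfolding mv(2) using vb[of 2] v2 by (simp add: mult_left_mono)
    then have "\<bar>m 3\<bar> * m 2 \<le> \<bar>m 3\<bar> * (l\<^sup>2 * K\<^sup>2 + e\<^sup>2)" by (intro mult_left_mono) auto
    ultimately show ?thesis by (simp add: r_def distrib_left)
  qed
  define c where "c = \<bar>m 1\<bar> * (\<bar>m 1\<bar> + m 2)"
  have cp: "p \<le> c" by (simp add: c_def p_def distrib_left)
  define X where "X = 64 * K ^ 6 + 2 * K ^ 5 + 3 * K\<^sup>2"
  have "(l * K + e) ^ 6 + \<bar>m 5\<bar> + \<bar>m 3\<bar> * m 2 + c
      \<le> (64 * K ^ 6 + 2 * K ^ 5) * l ^ 5 + 64 * e ^ 6 + 11 * r + (25 + 3 * K\<^sup>2) * p + c"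
    using b1 b2 b3 by (simp add: algebra_simps)
  also have "\<dots> \<le> (100 + X) * l ^ 5 + (100 + X) * e ^ 6 + (100 + X) * r + (100 + X) * c"
  proof -
    have X: "0 \<le> X" "64 * K ^ 6 + 2 * K ^ 5 \<le> 100 + X" "25 + 3 * K\<^sup>2 \<le> 99 + X" using K by (auto simp: X_def)
    have "(25 + 3 * K\<^sup>2) * p \<le> (99 + X) * c" using X cp pr by (intro mult_mono) auto
    moreover have "(64 * K ^ 6 + 2 * K ^ 5) * l ^ 5 \<le> (100 + X) * l ^ 5"
      using X l by (intro mult_right_mono) auto
    moreover have "64 * e ^ 6 \<le> (100 + X) * e ^ 6" "11 * r \<le> (100 + X) * r"
      using X e pr by (intro mult_right_mono; simp)+
    ultimately show ?thesis by (simp add: distrib_right)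
  qed
  finally show ?thesis unfolding X_def r_def c_def by (simp add: algebra_simps)
qed

text \<open>If \<open>x\<close> were at most \<open>\<kappa>\<close>, all distances to the support
  would be at most 1/2 and \<open>resolvent_sq\<close> at least 4. This moves the edge beyond the
  larger symmetric interval in which the expansion is made.\<close>

lemma (in compact_law) edge_outside:
  assumes "b < x" "resolvent_sq \<mu> x = 1" "- \<kappa> \<le> a" "\<kappa> \<le> 1 / 4"
  shows "\<kappa> < x"
proof (rule ccontr)
  assume "\<not> \<kappa> < x"
  have "(\<integral>v. 4 \<partial>\<mu>) \<le> resolvent_sq \<mu> x"
    unfolding resolvent_sq_def
  proof (rule integral_mono_AE)
    show "AE v in \<mu>. 4 \<le> 1 / (x - v)\<^sup>2"
      using AE_bounds
    proof eventually_elim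
      case (elim v)
      then have v: "0 < x - v" "x - v \<le> 1 / 2" using assms \<open>\<not> \<kappa> < x\<close> by auto
      then have "(x - v)\<^sup>2 \<le> (1 / 2)\<^sup>2" by (intro power_mono) auto
      then have "1 / (1 / 2)\<^sup>2 \<le> 1 / (x - v)\<^sup>2" using v by (intro divide_left_mono) auto
      then show ?case by (simp add: power_divide)
    qed
    show "integrable \<mu> (\<lambda>v. 1 / (x - v)\<^sup>2)" by (rule integrable_resolvents(2)[OF right_of_hull[OF assms(1)]])
  qed simp
  with assms(2) show False by (simp add: prob_space)
qed

lemma (in compact_law) reflected_moment: "moment (distr \<mu> borel uminus) k = (- 1) ^ k * moment \<mu> k"
proof -
  have "moment (distr \<mu> borel uminus) k = (\<integral>v. (- 1) ^ k * v ^ k \<partial>\<mu>)"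
    unfolding moment_def by (subst integral_distr) (auto simp flip: power_mult_distrib)
  then show ?thesis by (simp add: moment_def)
qed

lemma (in compact_law) upper_edge_expansion:
  assumes \<kappa>: "- \<kappa> \<le> a" "b \<le> \<kappa>" "\<kappa> \<le> 1 / 4" and x: "b < x" "resolvent_sq \<mu> x = 1"
  defines "m \<equiv> moment \<mu>"
  shows "\<bar>shifted_map \<mu> x - (2 + m 1 + m 2 + m 3 + (m 4 - 9 / 4 * (m 2)\<^sup>2))\<bar>
    \<le> 20000 * (\<kappa> ^ 6 + \<bar>m 5\<bar> + \<bar>m 3\<bar> * m 2 + \<bar>m 1\<bar> * (\<bar>m 1\<bar> + m 2))"
  unfolding m_def
proof (rule edge_point_expansion)
  show "compact_law \<mu> (- \<kappa>) \<kappa>"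
  proof
    show "AE v in \<mu>. - \<kappa> \<le> v \<and> v \<le> \<kappa>" using AE_bounds by eventually_elim (use \<kappa> in auto)
  qed (rule sets_eq)
  show "\<kappa> < x" by (rule edge_outside) (use assms in auto)
qed (use assms in auto)

lemma (in compact_law) lower_edge_expansion:
  assumes \<kappa>: "- \<kappa> \<le> a" "b \<le> \<kappa>" "\<kappa> \<le> 1 / 4" and x: "x < a" "resolvent_sq \<mu> x = 1"
  defines "m \<equiv> moment \<mu>"
  shows "\<bar>shifted_map \<mu> x - (- 2 + m 1 - m 2 + m 3 - (m 4 - 9 / 4 * (m 2)\<^sup>2))\<bar>
    \<le> 20000 * (\<kappa> ^ 6 + \<bar>m 5\<bar> + \<bar>m 3\<bar> * m 2 + \<bar>m 1\<bar> * (\<bar>m 1\<bar> + m 2))"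
proof -
  interpret R: compact_law "distr \<mu> borel uminus" "- b" "- a" by (rule reflected)
  have "\<bar>shifted_map (distr \<mu> borel uminus) (- x) -
      (2 + - m 1 + m 2 + - m 3 + (m 4 - 9 / 4 * (m 2)\<^sup>2))\<bar>
    \<le> 20000 * (\<kappa> ^ 6 + \<bar>m 5\<bar> + \<bar>m 3\<bar> * m 2 + \<bar>m 1\<bar> * (\<bar>m 1\<bar> + m 2))"
    using R.upper_edge_expansion[of \<kappa> "- x"] \<kappa> x
    unfolding reflected_moment reflected_maps m_def by simp
  then show ?thesis unfolding reflected_maps abs_le_iff by simp
qed

section \<open>Fixed point equation and edges for the smeared measure\<close>

lemma smeared_fixed_point:
  assumes "compact_law \<mu> a b" "0 \<le> l" "0 \<le> s" "0 < q"
    and conv: "is_free_add_conv semicircle (smeared l (sqrt s / q) \<mu>) \<rho>" and z: "0 < Im z"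
  shows "0 < Im (stieltjes \<rho> z)"
    and "stieltjes \<rho> z = (\<integral>v. inverse (of_real (l * v) - z - stieltjes \<rho> z -
      of_real (s / q\<^sup>2) * (1 / (of_real (l * v) - z - stieltjes \<rho> z))) \<partial>\<mu>)"
proof -
  interpret compact_law \<mu> a b by fact
  have \<rho>: "prob_space \<rho>" "sets \<rho> = sets borel" using conv by (auto simp: is_free_add_conv_def)
  show pos: "0 < Im (stieltjes \<rho> z)" by (rule stieltjes_Im_pos[OF \<rho> z])
  have e: "0 \<le> sqrt s / q" "(sqrt s / q)\<^sup>2 = s / q\<^sup>2" using assms by (auto simp: power_divide)
  show "stieltjes \<rho> z = (\<integral>v. inverse (of_real (l * v) - z - stieltjes \<rho> z -
      of_real (s / q\<^sup>2) * (1 / (of_real (l * v) - z - stieltjes \<rho> z))) \<partial>\<mu>)"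
    using semicircle_free_convolution_fixed_point[OF conv z]
      stieltjes_smeared[OF assms(2) e(1), of "z + stieltjes \<rho> z"] z pos
    unfolding e(2) by (simp add: diff_diff_eq)
qed

text \<open>Two intervals occur: the hull of the support, where stability yields the one-cut
  property, and the symmetric interval of radius \<open>l * K + e\<close>, whose size controls the
  expansion.\<close>

lemma smeared_one_cut:
  assumes law: "compact_law \<mu> (- K) K" and l: "0 \<le> l" and s: "0 \<le> s" and q: "0 < q"
    and stable: "stable_at_level c (smeared l (sqrt s / q) \<mu>)" "1 < c"
    and conv: "is_free_add_conv semicircle (smeared l (sqrt s / q) \<mu>) \<rho>"
  defines "m \<equiv> moment (smeared l (sqrt s / q) \<mu>)"
  shows "\<exists>Lm Lp. one_cut \<rho> Lm Lp \<and>
    (l \<le> 1 \<longrightarrow> l * K + sqrt s / q \<le> 1 / 4 \<longrightarrow> s \<le> S \<longrightarrow>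
      \<bar>Lp - (2 + m 1 + m 2 + m 3 + (m 4 - 9 / 4 * (m 2)\<^sup>2))\<bar>
        \<le> 20000 * (100 + 64 * K ^ 6 + 2 * K ^ 5 + 3 * K\<^sup>2) * (1 + S + S ^ 3) * edge_error l q m \<and>
      \<bar>Lm - (- 2 + m 1 - m 2 + m 3 - (m 4 - 9 / 4 * (m 2)\<^sup>2))\<bar>
        \<le> 20000 * (100 + 64 * K ^ 6 + 2 * K ^ 5 + 3 * K\<^sup>2) * (1 + S + S ^ 3) * edge_error l q m)"
proof -
  interpret M: compact_law \<mu> "- K" K by (rule law)
  define e where "e = sqrt s / q"
  have e: "0 \<le> e" "e\<^sup>2 = s / q\<^sup>2" using s q by (auto simp: e_def power_divide)
  have K: "0 \<le> K" using M.a_le_b by simp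
  let ?\<mu> = "smeared l e \<mu>"
  define \<kappa> where "\<kappa> = l * K + e"
  interpret T: compact_law ?\<mu> "l * (- K) - e" "l * K + e" by (rule M.compact_law_smeared[OF l e(1)])
  obtain a b where ab: "stable_law ?\<mu> a b" "l * (- K) - e \<le> a" "b \<le> l * K + e"
    using T.stable_law_hull stable unfolding e_def[symmetric] by blast
  interpret B: stable_law ?\<mu> a b by (rule ab)
  interpret R: semicircle_sum ?\<mu> a b \<rho>
  proof (rule semicircle_sum.intro, rule ab(1), rule semicircle_sum_axioms.intro)
    show "prob_space \<rho>" "sets \<rho> = sets borel" using conv unfolding is_free_add_conv_def by blast+
    show "stieltjes \<rho> z = stieltjes ?\<mu> (z + stieltjes \<rho> z)" if "0 < Im z" for z
      using semicircle_free_convolution_fixed_point[OF conv that] unfolding e_def .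
  qed
  obtain x y where xy: "b < x" "resolvent_sq ?\<mu> x = 1" "y < a" "resolvent_sq ?\<mu> y = 1"
    "one_cut \<rho> (shifted_map ?\<mu> y) (shifted_map ?\<mu> x)" by (rule R.one_cut_edges)
  show ?thesis
  proof (intro exI conjI impI)
    show "one_cut \<rho> (shifted_map ?\<mu> y) (shifted_map ?\<mu> x)" by (rule xy)
    assume l1: "l \<le> 1" and small: "l * K + sqrt s / q \<le> 1 / 4" and S: "s \<le> S"
    have \<kappa>: "- \<kappa> \<le> a" "b \<le> \<kappa>" "\<kappa> \<le> 1 / 4" using ab small by (auto simp: \<kappa>_def e_def)
    have "0 \<le> l * K" using l K by simp
    then have e1: "e \<le> 1" using small unfolding e_def by linarith
    have m_e: "m = moment ?\<mu>" by (simp add: m_def e_def)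
    define E where "E = l ^ 5 + e ^ 6 + \<bar>m 3\<bar> * e\<^sup>2 + \<bar>m 1\<bar> * (\<bar>m 1\<bar> + m 2)"
    define c where "c = 100 + 64 * K ^ 6 + 2 * K ^ 5 + 3 * K\<^sup>2"
    have c0: "0 \<le> c" using K by (simp add: c_def)
    have m2: "0 \<le> m 2" unfolding m_e moment_def by (rule integral_nonneg_AE) auto
    \<comment> \<open>In passing from \<open>e^2 = s / q^2\<close> to \<open>q\<close>, the
      third-moment term costs a factor \<open>S\<close> and the sixth power a factor
      \<open>S^3\<close>; the other two terms cost nothing.\<close>
    have EE: "E \<le> (1 + S + S ^ 3) * edge_error l q m"
    proof -
      have S0: "0 \<le> S" using S s by simp
      define A where "A = 1 + S + S ^ 3"
      have A: "1 \<le> A" "S \<le> A" "S ^ 3 \<le> A" using S0 by (auto simp: A_def)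
      have e2: "e\<^sup>2 \<le> S / q\<^sup>2" unfolding e(2) using S by (intro divide_right_mono) auto
      have "(e\<^sup>2) ^ 3 \<le> (S / q\<^sup>2) ^ 3" using e2 by (intro power_mono) auto
      then have "e ^ 6 \<le> S ^ 3 * (1 / q ^ 6)" by (simp add: power_divide flip: power_mult)
      also have "\<dots> \<le> A * (1 / q ^ 6)" using A q by (intro mult_right_mono) auto
      finally have 1: "e ^ 6 \<le> A * (1 / q ^ 6)" .
      have "\<bar>m 3\<bar> * e\<^sup>2 \<le> \<bar>m 3\<bar> * (S / q\<^sup>2)" using e2 by (intro mult_left_mono) auto
      also have "\<dots> = S * (\<bar>m 3\<bar> / q\<^sup>2)" by simp
      also have "\<dots> \<le> A * (\<bar>m 3\<bar> / q\<^sup>2)" using A by (intro mult_right_mono) auto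
      finally have 2: "\<bar>m 3\<bar> * e\<^sup>2 \<le> A * (\<bar>m 3\<bar> / q\<^sup>2)" .
      have 3: "1 * l ^ 5 \<le> A * l ^ 5" using A l by (intro mult_right_mono) auto
      have 4: "1 * (\<bar>m 1\<bar> * (\<bar>m 1\<bar> + m 2)) \<le> A * (\<bar>m 1\<bar> * (\<bar>m 1\<bar> + m 2))"
        using A m2 by (intro mult_right_mono) auto
      show ?thesis unfolding A_def[symmetric] edge_error_def E_def distrib_left[of A]
        using 1 2 3 4 by linarith
    qed
    have err: "20000 * (\<kappa> ^ 6 + \<bar>m 5\<bar> + \<bar>m 3\<bar> * m 2 + \<bar>m 1\<bar> * (\<bar>m 1\<bar> + m 2))
      \<le> 20000 * c * (1 + S + S ^ 3) * edge_error l q m"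
    proof -
      have "\<kappa> ^ 6 + \<bar>m 5\<bar> + \<bar>m 3\<bar> * m 2 + \<bar>m 1\<bar> * (\<bar>m 1\<bar> + m 2) \<le> c * E"
        unfolding \<kappa>_def m_e c_def E_def by (rule smeared_error_bound[OF law l l1 e(1) e1])
      also have "\<dots> \<le> c * ((1 + S + S ^ 3) * edge_error l q m)" using EE c0 by (rule mult_left_mono)
      finally show ?thesis by simp
    qed
    show "\<bar>shifted_map ?\<mu> x - (2 + m 1 + m 2 + m 3 + (m 4 - 9 / 4 * (m 2)\<^sup>2))\<bar>
        \<le> 20000 * (100 + 64 * K ^ 6 + 2 * K ^ 5 + 3 * K\<^sup>2) * (1 + S + S ^ 3) * edge_error l q m"
      using B.upper_edge_expansion[OF \<kappa> xy(1,2)] err unfolding m_e c_def by linarith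
    show "\<bar>shifted_map ?\<mu> y - (- 2 + m 1 - m 2 + m 3 - (m 4 - 9 / 4 * (m 2)\<^sup>2))\<bar>
        \<le> 20000 * (100 + 64 * K ^ 6 + 2 * K ^ 5 + 3 * K\<^sup>2) * (1 + S + S ^ 3) * edge_error l q m"
      using B.lower_edge_expansion[OF \<kappa> xy(3,4)] err unfolding m_e c_def by linarith
  qed
qed

section \<open>Stability of the smeared measure\<close>

lemma stable_at_levelI:
  assumes "compact_law \<mu> a b"
    and "\<And>x. a \<le> x \<Longrightarrow> x \<le> b \<Longrightarrow> ennreal c \<le> (\<integral>\<^sup>+v. inverse (ennreal ((v - x)\<^sup>2)) \<partial>\<mu>)"
  shows "stable_at_level c \<mu>"
proof -
  interpret compact_law \<mu> a b by fact
  obtain l u where "supp_hull \<mu> = {l..u}" "a \<le> l" "u \<le> b" by (rule supp_hull_interval)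
  then show ?thesis unfolding stable_at_level_def using assms(2) by (intro INF_greatest) auto
qed

text \<open>On a support of length at most 1/2 the kernel is at least 4. This settles the case of a
  decaying coupling.\<close>

lemma stable_at_level_small_support:
  assumes "compact_law \<mu> a b" "b - a \<le> 1 / 2"
  shows "stable_at_level 2 \<mu>"
proof (rule stable_at_levelI[OF assms(1)])
  interpret compact_law \<mu> a b by fact
  fix x assume x: "a \<le> x" "x \<le> b"
  have "ennreal 2 = (\<integral>\<^sup>+v. ennreal 2 \<partial>\<mu>)" by (simp add: emeasure_space_1)
  also have "\<dots> \<le> (\<integral>\<^sup>+v. inverse (ennreal ((v - x)\<^sup>2)) \<partial>\<mu>)"
  proof (rule nn_integral_mono_AE)
    show "AE v in \<mu>. ennreal 2 \<le> inverse (ennreal ((v - x)\<^sup>2))"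
      using AE_bounds
    proof eventually_elim
      case (elim v)
      show ?case
      proof (cases "v = x")
        case False
        have "\<bar>v - x\<bar> \<le> 1 / 2" unfolding abs_le_iff using elim x assms(2) by auto
        then have "(v - x)\<^sup>2 \<le> (1 / 2)\<^sup>2" by (simp add: abs_le_square_iff[symmetric])
        then have "1 / (1 / 2)\<^sup>2 \<le> 1 / (v - x)\<^sup>2" using False by (intro divide_left_mono) auto
        then have "2 \<le> 1 / (v - x)\<^sup>2" by (simp add: power_divide)
        then show ?thesis using False by (simp add: inverse_ennreal inverse_eq_divide ennreal_leI)
      qed simp
    qed
  qed
  finally show "ennreal 2 \<le> (\<integral>\<^sup>+v. inverse (ennreal ((v - x)\<^sup>2)) \<partial>\<mu>)" .
qed

text \<open>Regularizing lowers the kernel. At \<open>r = 0\<close> the right-hand side is infinite,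
  so atoms do no harm.\<close>

lemma inverse_kernel_lower:
  fixes l r w x y h :: real
  assumes "0 < l" "r = l * (w - y)" "0 < h"
  shows "ennreal (1 / l\<^sup>2 * (1 / (cmod (of_real w - Complex y h))\<^sup>2)) \<le> inverse (ennreal (r\<^sup>2))"
proof (cases "r = 0")
  case False
  have "(cmod (of_real w - Complex y h))\<^sup>2 = (w - y)\<^sup>2 + h\<^sup>2" by (simp add: cmod_power2)
  then have "1 / l\<^sup>2 * (1 / (cmod (of_real w - Complex y h))\<^sup>2) \<le> 1 / l\<^sup>2 * (1 / (w - y)\<^sup>2)"
  proof -
    have pos: "0 < (w - y)\<^sup>2" "0 < h\<^sup>2" using False assms by auto
    assume "(cmod (of_real w - Complex y h))\<^sup>2 = (w - y)\<^sup>2 + h\<^sup>2"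
    then show ?thesis using pos add_pos_pos[OF pos] by (intro mult_left_mono divide_left_mono mult_pos_pos) auto
  qed
  also have "\<dots> = 1 / r\<^sup>2" by (simp add: assms(2) power_mult_distrib)
  finally show ?thesis using False by (simp add: inverse_ennreal inverse_eq_divide ennreal_leI)
qed simp

context compact_law
begin

lemma nn_integral_kernel_lower:
  assumes l: "0 < l" and h: "0 < h" and c: "c \<le> Im (stieltjes \<mu> (Complex y h)) / h" and r: "\<And>w. r w = l * (w - y)"
  shows "ennreal (c / l\<^sup>2) \<le> (\<integral>\<^sup>+w. inverse (ennreal ((r w)\<^sup>2)) \<partial>\<mu>)"
proof -
  have nin: "Complex y h \<notin> hullC" by (rule notin_hullC(1)) (use h in simp)
  have "c \<le> g (Complex y h)" using c h by (simp add: Im_stieltjes[OF nin])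
  then have "ennreal (c / l\<^sup>2) \<le> ennreal (\<integral>w. 1 / l\<^sup>2 * (1 / (cmod (of_real w - Complex y h))\<^sup>2) \<partial>\<mu>)"
    using l unfolding integral_mult_right_zero g_def[symmetric] by (intro ennreal_leI) (simp add: divide_right_mono)
  also have "\<dots> = (\<integral>\<^sup>+w. ennreal (1 / l\<^sup>2 * (1 / (cmod (of_real w - Complex y h))\<^sup>2)) \<partial>\<mu>)"
    by (rule nn_integral_eq_integral[symmetric, OF integrable_mult_right[OF integrable_g[OF nin]]]) simp
  also have "\<dots> \<le> (\<integral>\<^sup>+w. inverse (ennreal ((r w)\<^sup>2)) \<partial>\<mu>)"
    by (intro nn_integral_mono inverse_kernel_lower l r h)
  finally show ?thesis .
qed

text \<open>Each of the two shifted copies alone reaches the level: rescaling takes \<open>x\<close>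
  to \<open>(x - e) / l\<close> or \<open>(x + e) / l\<close>, which the condition on
  \<open>e\<close> keeps within \<open>d\<close> of the original interval, and contributes the
  factor \<open>1 / l^2\<close>.\<close>

lemma stable_at_level_smeared:
  assumes l: "0 < l" and e: "0 \<le> e" "2 * e \<le> l * d" and h: "0 < h" and c: "0 \<le> c"
    and reg: "\<And>y. a - d \<le> y \<Longrightarrow> y \<le> b + d \<Longrightarrow> c \<le> Im (stieltjes \<mu> (Complex y h)) / h"
  shows "stable_at_level (c / l\<^sup>2) (smeared l e \<mu>)"
proof (rule stable_at_levelI)
  show "compact_law (smeared l e \<mu>) (l * a - e) (l * b + e)"
    by (rule compact_law_smeared) (use l e in auto)
  fix x assume x: "l * a - e \<le> x" "x \<le> l * b + e"
  let ?k = "\<lambda>r. inverse (ennreal (r\<^sup>2))"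
  have 1: "ennreal (c / l\<^sup>2) \<le> (\<integral>\<^sup>+w. ?k (l * w + e - x) \<partial>\<mu>)"
  proof (rule nn_integral_kernel_lower[OF l h])
    have "l * (a - d) \<le> x - e" "x - e \<le> l * (b + d)" using x e by (auto simp: algebra_simps)
    then have "a - d \<le> (x - e) / l" "(x - e) / l \<le> b + d" using l by (auto simp: field_simps)
    then show "c \<le> Im (stieltjes \<mu> (Complex ((x - e) / l) h)) / h" by (rule reg)
    show "l * w + e - x = l * (w - (x - e) / l)" for w using l by (simp add: field_simps)
  qed
  have 2: "ennreal (c / l\<^sup>2) \<le> (\<integral>\<^sup>+w. ?k (l * w - e - x) \<partial>\<mu>)"
  proof (rule nn_integral_kernel_lower[OF l h])
    have "l * (a - d) \<le> x + e" "x + e \<le> l * (b + d)" using x e by (auto simp: algebra_simps)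
    then have "a - d \<le> (x + e) / l" "(x + e) / l \<le> b + d" using l by (auto simp: field_simps)
    then show "c \<le> Im (stieltjes \<mu> (Complex ((x + e) / l) h)) / h" by (rule reg)
    show "l * w - e - x = l * (w - (x + e) / l)" for w using l by (simp add: field_simps)
  qed
  have "ennreal (c / l\<^sup>2) = (ennreal (c / l\<^sup>2) + ennreal (c / l\<^sup>2)) / 2"
  proof -
    have "ennreal r = (ennreal r + ennreal r) / 2" if "0 \<le> r" for r
    proof -
      have "ennreal r = ennreal ((r + r) / 2)" by simp
      also have "\<dots> = ennreal (r + r) / ennreal 2" by (rule divide_ennreal[symmetric]) (use that in auto)
      finally show ?thesis by (simp only: ennreal_plus[OF that that] ennreal_numeral)
    qed
    then show ?thesis using c by simp
  qed
  also have "\<dots> \<le> ((\<integral>\<^sup>+w. ?k (l * w + e - x) \<partial>\<mu>) + (\<integral>\<^sup>+w. ?k (l * w - e - x) \<partial>\<mu>)) / 2"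
    by (intro divide_right_mono_ennreal add_mono 1 2)
  also have "\<dots> = (\<integral>\<^sup>+w. (?k (l * w + e - x) + ?k (l * w - e - x)) / 2 \<partial>\<mu>)"
    by (simp add: nn_integral_divide nn_integral_add)
  also have "\<dots> = (\<integral>\<^sup>+w. ?k (w - x) \<partial>smeared l e \<mu>)"
    by (rule nn_integral_smeared[symmetric]) measurable
  finally show "ennreal (c / l\<^sup>2) \<le> (\<integral>\<^sup>+w. ?k (w - x) \<partial>smeared l e \<mu>)" .
qed

text \<open>
  If the regularized integrals were small at points \<open>x\<^sub>n + i h\<^sub>n\<close> approaching the hull, then the
  integral would be small at a limit point, by Fatou's lemma.
\<close>

lemma regularized_stability:
  assumes hull: "supp_hull \<mu> = {a..b}" and stable: "stable_at_level c \<mu>" and c': "0 \<le> c'" "c' < c"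
  obtains h where "0 < h" "\<And>y. a - h \<le> y \<Longrightarrow> y \<le> b + h \<Longrightarrow> c' < Im (stieltjes \<mu> (Complex y h)) / h"
proof (rule ccontr)
  assume neg: "\<not> thesis"
  \<comment> \<open>One parameter is both the height above the axis and the width by which the hull
    is enlarged, so both tend to 0 together.\<close>
  define h where "h n = 1 / real (Suc n)" for n
  have h0: "0 < h n" "h n \<le> 1" for n by (auto simp: h_def)
  have "\<exists>y. a - h n \<le> y \<and> y \<le> b + h n \<and> Im (stieltjes \<mu> (Complex y (h n))) / h n \<le> c'" for n
    using neg that[of "h n"] h0[of n] by (meson not_less)
  then obtain y where y: "\<And>n. a - h n \<le> y n" "\<And>n. y n \<le> b + h n"
    "\<And>n. Im (stieltjes \<mu> (Complex (y n) (h n))) / h n \<le> c'" by metis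
  have "norm (y n) \<le> \<bar>a\<bar> + \<bar>b\<bar> + 1" for n using y(1,2)[of n] h0[of n] by auto
  then have "bounded (range y)" by (auto intro!: boundedI)
  then obtain x r where r: "strict_mono (r :: nat \<Rightarrow> nat)" "(y \<circ> r) \<longlonglongrightarrow> x"
    using bounded_imp_convergent_subsequence by blast
  have "h \<longlonglongrightarrow> 0" unfolding h_def by (rule LIMSEQ_Suc[OF lim_1_over_n])
  then have hr: "(\<lambda>n. h (r n)) \<longlonglongrightarrow> 0" using LIMSEQ_subseq_LIMSEQ[OF _ r(1)] by (auto simp: o_def)
  have yr: "(\<lambda>n. y (r n)) \<longlonglongrightarrow> x" using r(2) by (simp add: o_def)
  have "a - 0 \<le> x" by (rule LIMSEQ_le[OF tendsto_diff[OF tendsto_const hr] yr]) (use y(1) in auto)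
  moreover have "x \<le> b + 0" by (rule LIMSEQ_le[OF yr tendsto_add[OF tendsto_const hr]]) (use y(2) in auto)
  ultimately have x: "x \<in> {a..b}" by simp
  have "(\<lambda>n. Complex (y (r n)) (h (r n))) \<longlonglongrightarrow> of_real x"
    using tendsto_Complex[OF yr hr] by (simp add: complex_of_real_def)
  then have "(\<integral>\<^sup>+v. inverse (ennreal ((cmod (of_real v - complex_of_real x))\<^sup>2)) \<partial>\<mu>) \<le> ennreal c'"
  proof (rule nn_kernel_lower_limit[OF sets_eq])
    fix n
    have nin: "Complex (y (r n)) (h (r n)) \<notin> hullC" by (rule notin_hullC(1)) (use h0 in simp)
    show "(\<integral>\<^sup>+v. inverse (ennreal ((cmod (of_real v - Complex (y (r n)) (h (r n))))\<^sup>2)) \<partial>\<mu>) \<le> ennreal c'"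
      unfolding nn_integral_kernel[OF nin]
      using y(3)[of "r n"] h0(1)[of "r n"] by (simp add: Im_stieltjes[OF nin] ennreal_leI)
  qed
  then have "(\<integral>\<^sup>+v. inverse (ennreal ((v - x)\<^sup>2)) \<partial>\<mu>) \<le> ennreal c'" unfolding nn_integral_real_kernel .
  moreover have "ennreal c \<le> (\<integral>\<^sup>+v. inverse (ennreal ((v - x)\<^sup>2)) \<partial>\<mu>)"
    using stable x unfolding stable_at_level_def hull by (meson INF_lower order_trans)
  moreover have "ennreal c' < ennreal c" using c' by (simp add: ennreal_less_iff)
  ultimately show False by (meson leD order_trans)
qed

lemma norm_stieltjes_outside:
  assumes "0 < d" "x \<le> a - d \<or> b + d \<le> x"
  shows "cmod (stieltjes \<mu> (of_real x)) \<le> 1 / d"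
proof -
  have nin: "complex_of_real x \<notin> hullC" unfolding notin_hullC(3) using assms by auto
  have "cmod (stieltjes \<mu> (of_real x)) \<le> (\<integral>v. cmod (1 / (complex_of_real v - of_real x)) \<partial>\<mu>)"
    unfolding stieltjes_def by (rule integral_norm_bound)
  also have "\<dots> \<le> (\<integral>v. 1 / d \<partial>\<mu>)"
  proof (rule integral_mono_AE[OF integrable_norm[OF integrable_stieltjes[OF nin]]])
    show "AE v in \<mu>. cmod (1 / (complex_of_real v - of_real x)) \<le> 1 / d"
      using AE_bounds
    proof eventually_elim
      case (elim v)
      have "cmod (complex_of_real v - of_real x) = \<bar>v - x\<bar>" by (metis norm_of_real of_real_diff)
      then show ?case using assms elim by (auto simp: norm_divide intro!: divide_left_mono)
    qed
  qed simp
  finally show ?thesis by (simp add: prob_space)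
qed

end

section \<open>Empirical measures: location of the atoms and stability\<close>

lemma empirical_compact_law:
  assumes "0 < N" "\<And>i. i < N \<Longrightarrow> a \<le> v i \<and> v i \<le> b"
  shows "compact_law (empirical N v) a b"
proof -
  have meas: "v \<in> uniform_count_measure {..<N} \<rightarrow>\<^sub>M borel"
    by (auto simp: measurable_def space_uniform_count_measure sets_uniform_count_measure)
  interpret U: prob_space "uniform_count_measure {..<N}"
    by (rule prob_space_uniform_count_measure) (use assms(1) in auto)
  interpret prob_space "empirical N v" unfolding empirical_def by (rule U.prob_space_distr[OF meas])
  show ?thesis
  proof
    show "sets (empirical N v) = sets borel" by (simp add: empirical_def)
    show "AE x in empirical N v. a \<le> x \<and> x \<le> b"
      unfolding empirical_def
      by (subst AE_distr_iff[OF meas]) (use assms(2) in \<open>auto simp: space_uniform_count_measure\<close>)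
  qed
qed

lemma stieltjes_empirical:
  assumes "0 < N"
  shows "stieltjes (empirical N v) z = (\<Sum>i<N. 1 / (complex_of_real (v i) - z)) / of_nat N"
proof -
  have meas: "v \<in> uniform_count_measure {..<N} \<rightarrow>\<^sub>M borel"
    by (auto simp: measurable_def space_uniform_count_measure sets_uniform_count_measure)
  have "stieltjes (empirical N v) z = (\<integral>i. 1 / (complex_of_real (v i) - z) \<partial>uniform_count_measure {..<N})"
    unfolding stieltjes_def empirical_def by (rule integral_distr[OF meas]) measurable
  also have "\<dots> = (\<Sum>i<N. (1 / N) *\<^sub>R (1 / (complex_of_real (v i) - z)))"
    unfolding uniform_count_measure_def by (subst lebesgue_integral_point_measure_finite) auto
  finally show ?thesis by (simp add: scaleR_conv_of_real sum_divide_distrib mult.commute)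
qed

text \<open>
  \<open>\<sigma> = 1\<close> is the case of the largest atom and \<open>\<sigma> = -1\<close> that of the smallest one.
\<close>

lemma stieltjes_empirical_blowup:
  assumes j: "j < N" and \<sigma>: "\<sigma> = 1 \<or> \<sigma> = - 1" and extreme: "\<And>i. i < N \<Longrightarrow> \<sigma> * v i \<le> \<sigma> * v j"
    and bound: "\<And>t. 0 < t \<Longrightarrow> t \<le> 1 \<Longrightarrow> cmod (stieltjes (empirical N v) (of_real (v j + \<sigma> * t))) \<le> C"
  shows False
proof -
  have N: "0 < N" using j by simp
  have C: "0 \<le> C" using bound[of 1] norm_ge_zero order_trans by (metis zero_less_one order_refl)
  \<comment> \<open>Beyond the extreme atom all summands have the same sign, so its contribution
    \<open>1 / (N * t)\<close> is not cancelled; this \<open>t\<close> makes it exceed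
    \<open>C\<close>.\<close>
  define t where "t = 1 / (real N * C + 1)"
  have den: "1 \<le> real N * C + 1" using C by simp
  then have t: "0 < t" "t \<le> 1" by (auto simp: t_def)
  define x where "x = v j + \<sigma> * t"
  have gap: "t \<le> \<sigma> * (x - v i)" if "i < N" for i
    using extreme[OF that] \<sigma> by (auto simp: x_def algebra_simps)
  have eq: "1 / (complex_of_real (v i) - of_real x) = of_real (- (\<sigma> * (1 / (\<sigma> * (x - v i)))))" if "i < N" for i
  proof -
    have "1 / (v i - x) = - (\<sigma> * (1 / (\<sigma> * (x - v i))))"
      using \<sigma> gap[OF that] t by (auto simp: divide_simps)
    then show ?thesis by (metis of_real_1 of_real_diff of_real_divide)
  qed
  have "stieltjes (empirical N v) (of_real x) = of_real (- (\<sigma> * (\<Sum>i<N. 1 / (\<sigma> * (x - v i))))) / of_nat N"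
    unfolding stieltjes_empirical[OF N] using eq by (simp add: sum_distrib_left sum_negf)
  then have "cmod (stieltjes (empirical N v) (of_real x)) = \<bar>- (\<sigma> * (\<Sum>i<N. 1 / (\<sigma> * (x - v i))))\<bar> / real N"
    by (simp only: norm_divide norm_of_real norm_of_nat)
  also have "\<dots> = \<bar>\<Sum>i<N. 1 / (\<sigma> * (x - v i))\<bar> / real N" using \<sigma> by auto
  also have "\<dots> \<ge> (1 / (\<sigma> * (x - v j))) / real N"
  proof -
    have "1 / (\<sigma> * (x - v j)) \<le> (\<Sum>i<N. 1 / (\<sigma> * (x - v i)))"
      by (rule member_le_sum) (use j gap t in \<open>auto intro!: order_trans[OF less_imp_le gap]\<close>)
    then show ?thesis by (intro divide_right_mono) auto
  qed
  finally have "(1 / (\<sigma> * (x - v j))) / real N \<le> C" using bound[OF t] by (simp add: x_def)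
  moreover have "\<sigma> * (x - v j) = t" using \<sigma> by (auto simp: x_def)
  ultimately have "1 / t \<le> C * real N" using N by (simp only: pos_divide_le_eq of_nat_0_less_iff)
  then show False by (simp add: t_def mult.commute)
qed

lemma limiting_law_interval:
  assumes "limiting_potential_law \<nu> lmax varpi"
  obtains a b where "supp_hull \<nu> = {a..b}" "compact_law \<nu> a b" "msupp \<nu> \<subseteq> {a..b}"
proof -
  interpret prob_space \<nu> using assms by (simp add: limiting_potential_law_def)
  have sets: "sets \<nu> = sets borel" and comp: "compact (msupp \<nu>)"
    using assms by (auto simp: limiting_potential_law_def)
  obtain R where R: "\<And>v. v \<in> msupp \<nu> \<Longrightarrow> \<bar>v\<bar> \<le> R"
    using compact_imp_bounded[OF comp] unfolding bounded_real by blast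
  interpret C: compact_law \<nu> "- R" R
  proof
    show "AE v in \<nu>. - R \<le> v \<and> v \<le> R"
      using AE_msupp[OF sets] by eventually_elim (use R in \<open>auto simp: abs_le_iff dest!: R\<close>)
  qed (rule sets)
  obtain a b where ab: "supp_hull \<nu> = {a..b}" "compact_law \<nu> a b" by (rule C.supp_hull_interval)
  have "msupp \<nu> \<subseteq> supp_hull \<nu>" unfolding supp_hull_def by (rule hull_subset)
  then have "msupp \<nu> \<subseteq> {a..b}" unfolding ab(1) .
  then show ?thesis by (rule that[OF ab])
qed

text \<open>If the largest or smallest atom lay outside the neighbourhood, one could approach it
  from further out, where both transforms are under control, and it would make its own transform
  blow up. The margin 1 beyond \<open>K\<close> leaves room for the approach.\<close>

lemma empirical_in_neighbourhood:
  assumes law: "compact_law \<nu> a b" and d: "0 < d" and K: "\<And>i. i < N \<Longrightarrow> \<bar>v i\<bar> \<le> K"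
    and right: "\<And>x. b + d \<le> x \<Longrightarrow> x \<le> K + 1 \<Longrightarrow>
      cmod (stieltjes (empirical N v) (of_real x) - stieltjes \<nu> (of_real x)) \<le> C"
    and left: "\<And>x. - K - 1 \<le> x \<Longrightarrow> x \<le> a - d \<Longrightarrow>
      cmod (stieltjes (empirical N v) (of_real x) - stieltjes \<nu> (of_real x)) \<le> C"
    and i: "i < N"
  shows "a - d \<le> v i \<and> v i \<le> b + d"
proof -
  interpret compact_law \<nu> a b by (rule law)
  have bound: "cmod (stieltjes (empirical N v) (of_real x)) \<le> C + 1 / d"
    if "b + d \<le> x \<and> x \<le> K + 1 \<or> - K - 1 \<le> x \<and> x \<le> a - d" for x
  proof -
    have "cmod (stieltjes (empirical N v) (of_real x) - stieltjes \<nu> (of_real x)) \<le> C"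
      using that right left by blast
    moreover have "cmod (stieltjes \<nu> (of_real x)) \<le> 1 / d"
      by (rule norm_stieltjes_outside[OF d]) (use that in auto)
    ultimately show ?thesis
      using norm_triangle_ineq[of "stieltjes (empirical N v) (of_real x) - stieltjes \<nu> (of_real x)" "stieltjes \<nu> (of_real x)"]
      by simp
  qed
  have fin: "finite (v ` {..<N})" "v ` {..<N} \<noteq> {}" using i by auto
  obtain j where j: "j < N" "v j = Max (v ` {..<N})" using Max_in[OF fin] by auto
  obtain k where k: "k < N" "v k = Min (v ` {..<N})" using Min_in[OF fin] by auto
  have jmax: "v i \<le> v j" if "i < N" for i using fin that by (simp add: j(2))
  have kmin: "v k \<le> v i" if "i < N" for i using fin that by (simp add: k(2))
  have "v j \<le> b + d"
  proof (rule ccontr)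
    assume "\<not> v j \<le> b + d"
    then show False
      using K[OF j(1)] jmax
      by (intro stieltjes_empirical_blowup[OF j(1), of 1 v "C + 1 / d"] bound) auto
  qed
  moreover have "a - d \<le> v k"
  proof (rule ccontr)
    assume "\<not> a - d \<le> v k"
    then show False
      using K[OF k(1)] kmin
      by (intro stieltjes_empirical_blowup[OF k(1), of "- 1" v "C + 1 / d"] bound) auto
  qed
  ultimately show ?thesis using jmax[OF i] kmin[OF i] by simp
qed

text \<open>Half of the width \<open>h\<close> pays for the distance of the atoms from the hull of
  \<open>\<nu>\<close>, the other half for the shift by \<open>e\<close>; hence the factor
  4.\<close>

lemma empirical_smeared_stable:
  assumes law: "compact_law \<nu> a b" and h: "0 < h" and K: "\<And>i. i < N \<Longrightarrow> \<bar>v i\<bar> \<le> K" and N: "0 < N"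
    and right: "\<And>x. b + h / 2 \<le> x \<Longrightarrow> x \<le> K + 1 \<Longrightarrow>
      cmod (stieltjes (empirical N v) (of_real x) - stieltjes \<nu> (of_real x)) \<le> C"
    and left: "\<And>x. - K - 1 \<le> x \<Longrightarrow> x \<le> a - h / 2 \<Longrightarrow>
      cmod (stieltjes (empirical N v) (of_real x) - stieltjes \<nu> (of_real x)) \<le> C"
    and reg: "\<And>y. a - h \<le> y \<Longrightarrow> y \<le> b + h \<Longrightarrow> c + \<epsilon> \<le> Im (stieltjes \<nu> (Complex y h)) / h"
    and close: "\<And>y. a - h \<le> y \<Longrightarrow> y \<le> b + h \<Longrightarrow>
      cmod (stieltjes (empirical N v) (Complex y h) - stieltjes \<nu> (Complex y h)) \<le> h * \<epsilon>"
    and l: "0 < l" and e: "0 \<le> e" "4 * e \<le> l * h" and c: "0 \<le> c"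
  shows "stable_at_level (c / l\<^sup>2) (smeared l e (empirical N v))"
proof -
  have "a - h / 2 \<le> v i \<and> v i \<le> b + h / 2" if "i < N" for i
    by (rule empirical_in_neighbourhood[OF law _ K right left that]) (use h in auto)
  from empirical_compact_law[OF N this]
  interpret E: compact_law "empirical N v" "a - h / 2" "b + h / 2" by simp
  show ?thesis
  proof (rule E.stable_at_level_smeared[OF l e(1) _ h c])
    show "2 * e \<le> l * (h / 2)" using e by simp
    fix y assume y: "a - h / 2 - h / 2 \<le> y" "y \<le> b + h / 2 + h / 2"
    have y: "a - h \<le> y" "y \<le> b + h" using y by simp_all
    have "Im (stieltjes \<nu> (Complex y h)) - Im (stieltjes (empirical N v) (Complex y h)) \<le> h * \<epsilon>"
      using close[OF y] abs_Im_le_cmod[of "stieltjes (empirical N v) (Complex y h) - stieltjes \<nu> (Complex y h)"]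
      by simp
    then have "Im (stieltjes \<nu> (Complex y h)) / h - Im (stieltjes (empirical N v) (Complex y h)) / h \<le> \<epsilon>"
      using h by (simp add: field_simps)
    then show "c \<le> Im (stieltjes (empirical N v) (Complex y h)) / h" using reg[OF y] by simp
  qed
qed

text \<open>The potential is bounded only almost surely. For random potentials the sample points
  violating the bound form a null set, which serves as exceptional event for every \<open>D\<close>.
  A deterministic value bounded almost surely under a probability measure is bounded, so nothing is
  left out.\<close>

lemma holds_onI:
  fixes V :: "nat \<Rightarrow> nat \<Rightarrow> 'w \<Rightarrow> real"
  assumes prob: "\<And>N. prob_space (M N)" and sets: "\<And>N. \<Xi> N \<in> sets (M N)"
    and meas: "\<And>N i. i < N \<Longrightarrow> V N i \<in> borel_measurable (M N)"
    and AE: "\<And>N i. i < N \<Longrightarrow> AE \<omega> in M N. \<bar>V N i \<omega>\<bar> \<le> K"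
    and det: "\<not> rnd \<Longrightarrow> \<exists>v. \<forall>N i. i < N \<longrightarrow> (\<forall>\<omega>\<in>space (M N). V N i \<omega> = v N i)"
    and ev: "\<forall>\<^sub>F N in sequentially. \<forall>\<omega>\<in>\<Xi> N. (\<forall>i<N. \<bar>V N i \<omega>\<bar> \<le> K) \<longrightarrow> P N \<omega>"
  shows "holds_on rnd M \<Xi> P"
proof (cases rnd)
  case True
  have "\<forall>\<^sub>F N in sequentially. \<exists>A\<in>sets (M N). {\<omega>\<in>\<Xi> N. \<not> P N \<omega>} \<subseteq> A \<and> measure (M N) A \<le> real N powr - D" for D
    using ev
  proof eventually_elim
    case (elim N)
    interpret prob_space "M N" by (rule prob)
    define A where "A = {\<omega> \<in> space (M N). \<exists>i\<in>{..<N}. K < \<bar>V N i \<omega>\<bar>}"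
    have "{\<omega> \<in> space (M N). K < \<bar>V N i \<omega>\<bar>} \<in> sets (M N)" if "i < N" for i
    proof -
      have "(\<lambda>\<omega>. \<bar>V N i \<omega>\<bar>) \<in> borel_measurable (M N)" using meas[OF that] by simp
      then show ?thesis unfolding borel_measurable_iff_greater by blast
    qed
    then have A: "A \<in> sets (M N)"
      unfolding A_def by (intro sets.sets_Collect_finite_Ex) auto
    have "AE \<omega> in M N. \<forall>i\<in>{..<N}. \<bar>V N i \<omega>\<bar> \<le> K"
      using AE by (intro AE_finite_allI) auto
    then have "AE \<omega> in M N. \<omega> \<notin> A" by eventually_elim (auto simp: A_def not_le[symmetric])
    then have "A \<in> null_sets (M N)" using AE_iff_null_sets[OF A] by blast
    then have "measure (M N) A = 0" by (simp add: measure_def null_setsD1)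
    moreover have "{\<omega>\<in>\<Xi> N. \<not> P N \<omega>} \<subseteq> A"
    proof safe
      fix \<omega> assume \<omega>: "\<omega> \<in> \<Xi> N" "\<not> P N \<omega>"
      then have "\<not> (\<forall>i<N. \<bar>V N i \<omega>\<bar> \<le> K)" using elim by blast
      then show "\<omega> \<in> A" using \<omega>(1) sets.sets_into_space[OF sets] by (auto simp: A_def not_le)
    qed
    ultimately show ?case using A by (intro bexI[of _ A]) auto
  qed
  then show ?thesis using True by (simp add: holds_on_def)
next
  case False
  obtain v where v: "\<And>N i \<omega>. i < N \<Longrightarrow> \<omega> \<in> space (M N) \<Longrightarrow> V N i \<omega> = v N i" using det[OF False] by blast
  have vK: "\<bar>v N i\<bar> \<le> K" if "i < N" for N i
  proof -
    interpret prob_space "M N" by (rule prob)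
    have "AE \<omega> in M N. \<bar>v N i\<bar> \<le> K"
      using AE[OF that] AE_space by eventually_elim (use v[OF that] in auto)
    then show ?thesis by simp
  qed
  have "\<forall>\<^sub>F N in sequentially. \<forall>\<omega>\<in>\<Xi> N. P N \<omega>"
    using ev
  proof eventually_elim
    case (elim N)
    show ?case
    proof
      fix \<omega> assume "\<omega> \<in> \<Xi> N"
      moreover from this have "\<omega> \<in> space (M N)" using sets.sets_into_space[OF sets] by blast
      ultimately show "P N \<omega>" using elim v vK by simp
    qed
  qed
  then show ?thesis using False by (simp add: holds_on_def)
qed

theorem proposition2p11:
  fixes M :: "nat \<Rightarrow> 'w measure"
    and W :: "nat \<Rightarrow> nat \<Rightarrow> nat \<Rightarrow> 'w \<Rightarrow> real"
    and V :: "nat \<Rightarrow> nat \<Rightarrow> 'w \<Rightarrow> real"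
    and \<nu> :: "real measure"
    and \<Xi> :: "nat \<Rightarrow> 'w set"
    and q s lam :: "nat \<Rightarrow> real"
    and rnd :: bool
    and \<delta> \<phi> \<beta> lam\<^sub>0 lmax varpi a\<^sub>0 \<epsilon>\<^sub>0 :: real
  assumes M: "\<And>N. prob_space (M N)"
    and \<phi>: "0 < \<delta>" "\<delta> \<le> \<phi>" "\<phi> \<le> 1 / 2"
    and W: "sparse_matrix M W \<phi>"
    and q: "\<And>N. q N = sparsity \<phi> N"
    and s: "\<And>N. s N = scaled_cumulant M W \<phi> 4 N"
    and coupling: "0 \<le> \<beta>" "0 < lam\<^sub>0" "\<And>N. lam N = lam\<^sub>0 * real N powr - \<beta>"
    and lmax: "0 \<le> lmax" "\<beta> = 0 \<longrightarrow> lmax = lam\<^sub>0"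
    and varpi: "0 < varpi"
    and \<nu>: "limiting_potential_law \<nu> lmax varpi"
    and V: "bounded_potential M V"
    and exponents: "0 < a\<^sub>0" "0 < \<epsilon>\<^sub>0" "\<epsilon>\<^sub>0 < 1 / 2"
    and det: "\<not> rnd \<Longrightarrow> deterministic_potential M V \<nu> lmax varpi a\<^sub>0"
    and rand: "rnd \<Longrightarrow> random_potential M W V \<nu> lmax varpi"
    and \<Xi>: "event_Xi rnd M V \<nu> lam lmax varpi (if rnd then 1 / 2 - \<epsilon>\<^sub>0 else a\<^sub>0) \<Xi>"
  shows
    "(\<exists>varpi'>0. \<exists>C. holds_on rnd M \<Xi> (\<lambda>N \<omega>.
        let \<mu> = empirical N (\<lambda>i. V N i \<omega>);
            \<mu>t = smeared (lam N) (sqrt (s N) / q N) \<mu>;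
            m = moment \<mu>t
        in supported_on_compact_interval \<mu>t \<and>
           stable_at_level (1 + varpi') \<mu>t \<and>
           smeared_moments (lam N) (s N) (q N) \<mu> \<and>
           (\<forall>\<rho>. is_free_add_conv semicircle \<mu>t \<rho> \<longrightarrow>
              (\<forall>z. 0 < Im z \<longrightarrow>
                 0 < Im (stieltjes \<rho> z) \<and>
                 stieltjes \<rho> z =
                   (\<integral>v. inverse (of_real (lam N * v) - z - stieltjes \<rho> z -
                        of_real (s N / (q N)\<^sup>2) * (1 / (of_real (lam N * v) - z - stieltjes \<rho> z))) \<partial>\<mu>)) \<and>
              (\<exists>Lm Lp. one_cut \<rho> Lm Lp \<and>
                 (lam \<longlonglongrightarrow> 0 \<longrightarrow>
                    \<bar>Lp - (2 + m 1 + m 2 + m 3 + (m 4 - 9 / 4 * (m 2)\<^sup>2))\<bar>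
                      \<le> C * edge_error (lam N) (q N) m \<and>
                    \<bar>Lm - (- 2 + m 1 - m 2 + m 3 - (m 4 - 9 / 4 * (m 2)\<^sup>2))\<bar>
                      \<le> C * edge_error (lam N) (q N) m))))) \<and>
     (\<exists>varpi'>0. \<forall>\<^sub>F N in sequentially.
        let \<mu>b = smeared (lam N) (sqrt (s N) / q N) \<nu>
        in supported_on_compact_interval \<mu>b \<and>
           stable_at_level (1 + varpi') \<mu>b \<and>
           smeared_moments (lam N) (s N) (q N) \<nu> \<and>
           (\<forall>\<rho>. is_free_add_conv semicircle \<mu>b \<rho> \<longrightarrow>
              (\<exists>Lm Lp. one_cut \<rho> Lm Lp) \<and>
              (\<forall>z. 0 < Im z \<longrightarrow>
                 stieltjes \<rho> z =
                   (\<integral>v. inverse (of_real (lam N * v) - z - stieltjes \<rho> z -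
                        of_real (s N / (q N)\<^sup>2) * (1 / (of_real (lam N * v) - z - stieltjes \<rho> z))) \<partial>\<nu>))))"
proof -
  obtain a b where hull: "supp_hull \<nu> = {a..b}" and law: "compact_law \<nu> a b" and msupp: "msupp \<nu> \<subseteq> {a..b}"
    using limiting_law_interval[OF \<nu>] by blast
  interpret nu: compact_law \<nu> a b by (rule law)
  obtain K\<^sub>0 where K0: "\<And>N i. i < N \<Longrightarrow> AE \<omega> in M N. \<bar>V N i \<omega>\<bar> \<le> K\<^sub>0"
    and meas: "\<And>N i. i < N \<Longrightarrow> V N i \<in> borel_measurable (M N)"
    using V unfolding bounded_potential_def by blast
  \<comment> \<open>One symmetric interval for both the atoms and \<open>\<nu>\<close>, so that the
    lemmas on \<open>compact_law\<close> apply to either with the same constants.\<close>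
  define K where "K = max K\<^sub>0 (\<bar>a\<bar> + \<bar>b\<bar>)"
  have K: "AE \<omega> in M N. \<bar>V N i \<omega>\<bar> \<le> K" if "i < N" for N i
    using K0[OF that] by eventually_elim (simp add: K_def)
  have nuK: "compact_law \<nu> (- K) K"
  proof
    show "AE v in \<nu>. - K \<le> v \<and> v \<le> K" using nu.AE_bounds by eventually_elim (auto simp: K_def)
  qed (rule nu.sets_eq)
  have empK: "compact_law (empirical N (\<lambda>i. V N i \<omega>)) (- K) K"
    if "0 < N" "\<forall>i<N. \<bar>V N i \<omega>\<bar> \<le> K" for N \<omega>
    by (rule empirical_compact_law) (use that in \<open>auto simp: abs_le_iff\<close>)
  obtain S where S: "\<And>N. 2 \<le> N \<Longrightarrow> s N \<le> S"
  proof -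
    have "\<forall>k\<ge>1. \<exists>C. \<forall>N\<ge>2. \<bar>scaled_cumulant M W \<phi> k N\<bar> \<le> C"
      using W unfolding sparse_matrix_def by blast
    moreover have "(1 :: nat) \<le> 4" by simp
    ultimately obtain C where "\<And>N. 2 \<le> N \<Longrightarrow> \<bar>s N\<bar> \<le> C" unfolding s by blast
    then show ?thesis using that abs_le_D1 by blast
  qed
  have s0: "0 \<le> s N" if "2 \<le> N" for N
  proof -
    have "\<exists>c>0. \<forall>N\<ge>2. c \<le> scaled_cumulant M W \<phi> 4 N" using W unfolding sparse_matrix_def by blast
    then show ?thesis using that unfolding s by (meson less_imp_le order_trans)
  qed
  have q0: "0 < q N" if "2 \<le> N" for N using that by (simp add: q sparsity_def)
  have lam0: "0 < lam N" if "2 \<le> N" for N using that coupling by simp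
  \<comment> \<open>From \<open>N = 2\<close> on the entry \<open>(0, 1)\<close>, from which
    \<open>s\<close> is read off, exists. Moreover \<open>0 powr x\<close> is 0, so both
    \<open>q\<close> and \<open>lam\<close> vanish at \<open>N = 0\<close>.\<close>
  have ev2: "\<forall>\<^sub>F N in sequentially. 2 \<le> N" by (rule eventually_ge_at_top)
  define e where "e N = sqrt (s N) / q N" for N
  have e0: "0 \<le> e N" if "2 \<le> N" for N using s0[OF that] q0[OF that] by (simp add: e_def)
  have e_lim: "e \<longlonglongrightarrow> 0"
  proof (rule tendsto_sandwich[OF _ _ tendsto_const])
    show "\<forall>\<^sub>F N in sequentially. 0 \<le> e N" using ev2 by eventually_elim (rule e0)
    show "\<forall>\<^sub>F N in sequentially. e N \<le> sqrt S * real N powr - \<phi>"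
      using ev2
    proof eventually_elim
      case (elim N)
      have "e N \<le> sqrt S / q N"
        unfolding e_def using S[OF elim] q0[OF elim] by (intro divide_right_mono) auto
      then show ?case by (simp add: q sparsity_def powr_minus divide_inverse)
    qed
    have "(\<lambda>N. real N powr - \<phi>) \<longlonglongrightarrow> 0"
      by (rule tendsto_neg_powr[OF _ filterlim_real_sequentially]) (use \<phi> in auto)
    from tendsto_mult_right_zero[OF this]
    show "(\<lambda>N. sqrt S * real N powr - \<phi>) \<longlonglongrightarrow> 0" .
  qed
  have small: "\<forall>\<^sub>F N in sequentially. lam N \<le> 1 \<and> lam N * K + e N \<le> 1 / 4" if lim: "lam \<longlonglongrightarrow> 0"
  proof -
    have "(\<lambda>N. lam N * K + e N) \<longlonglongrightarrow> 0 * K + 0" by (intro tendsto_intros lim e_lim)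
    then have "\<forall>\<^sub>F N in sequentially. lam N * K + e N < 1 / 4"
      by (rule order_tendstoD) simp
    moreover have "\<forall>\<^sub>F N in sequentially. lam N < 1" by (rule order_tendstoD[OF lim]) simp
    ultimately show ?thesis by eventually_elim auto
  qed
  let ?Q = "\<lambda>N \<omega>. \<forall>i<N. \<bar>V N i \<omega>\<bar> \<le> K"
  obtain w where w: "0 < w"
    and ev_emp: "\<forall>\<^sub>F N in sequentially. \<forall>\<omega>\<in>\<Xi> N. ?Q N \<omega> \<longrightarrow>
      stable_at_level (1 + w) (smeared (lam N) (e N) (empirical N (\<lambda>i. V N i \<omega>)))"
    and ev_nu: "\<forall>\<^sub>F N in sequentially. stable_at_level (1 + w) (smeared (lam N) (e N) \<nu>)"
  proof (cases "\<beta> = 0")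
    \<comment> \<open>The coupling decays, so the smeared supports eventually have length at most
      1/2 and the level is 2 = 1 + 1.\<close>
    case False
    have "lam \<longlonglongrightarrow> lam\<^sub>0 * 0"
      unfolding coupling(3)[abs_def] using False coupling
      by (intro tendsto_mult tendsto_const tendsto_neg_powr filterlim_real_sequentially) auto
    from small[unfolded mult_zero_right] this
    have small: "\<forall>\<^sub>F N in sequentially. lam N \<le> 1 \<and> lam N * K + e N \<le> 1 / 4" by simp
    have level: "stable_at_level (1 + 1) (smeared (lam N) (e N) \<mu>)"
      if "compact_law \<mu> (- K) K" "2 \<le> N" "lam N * K + e N \<le> 1 / 4" for \<mu> N
    proof -
      interpret compact_law \<mu> "- K" K by fact
      have "compact_law (smeared (lam N) (e N) \<mu>) (lam N * (- K) - e N) (lam N * K + e N)"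
        by (rule compact_law_smeared) (use e0 lam0[of N] that(2) in auto)
      then have "stable_at_level 2 (smeared (lam N) (e N) \<mu>)"
        by (rule stable_at_level_small_support) (use that(3) in \<open>simp add: algebra_simps\<close>)
      then show ?thesis by simp
    qed
    show thesis
    proof (rule that[of 1])
      show "\<forall>\<^sub>F N in sequentially. \<forall>\<omega>\<in>\<Xi> N. ?Q N \<omega> \<longrightarrow>
          stable_at_level (1 + 1) (smeared (lam N) (e N) (empirical N (\<lambda>i. V N i \<omega>)))"
        using small ev2 by eventually_elim (use empK level in auto)
      show "\<forall>\<^sub>F N in sequentially. stable_at_level (1 + 1) (smeared (lam N) (e N) \<nu>)"
        using small ev2 by eventually_elim (use nuK level in auto)
    qed simp
  next
    case True
    \<comment> \<open>For a constant coupling, \<open>lmax = lam\<^sub>0\<close> places the coupling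
      itself among the values at which \<open>\<nu>\<close> is assumed stable.\<close>
    then have lmax0: "lmax = lam\<^sub>0" and lam_eq: "\<And>N. 2 \<le> N \<Longrightarrow> lam N = lam\<^sub>0" using lmax coupling by auto
    let ?L = "lam\<^sub>0\<^sup>2"
    have L: "0 < ?L" using coupling by simp
    have "stable_at_level ((1 + varpi) * ?L) \<nu>"
      using \<nu> coupling(2) unfolding limiting_potential_law_def lmax0 by simp
    moreover have "(1 + varpi / 2) * ?L < (1 + varpi) * ?L" using varpi L by simp
    ultimately obtain h where h: "0 < h"
      and reg: "\<And>y. a - h \<le> y \<Longrightarrow> y \<le> b + h \<Longrightarrow> (1 + varpi / 2) * ?L < Im (stieltjes \<nu> (Complex y h)) / h"
      using nu.regularized_stability[OF hull, of "(1 + varpi) * ?L" "(1 + varpi / 2) * ?L"] varpi L by auto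
    \<comment> \<open>Regularizing has used up half of \<open>varpi\<close>. A quarter, scaled to
      \<open>\<epsilon>\<close>, covers the distance between the transforms, and the last quarter
      remains in the conclusion.\<close>
    define w where "w = varpi / 4"
    define \<epsilon> where "\<epsilon> = w * ?L"
    have w: "0 < w" and \<epsilon>: "0 < \<epsilon>" and split: "(1 + w) * ?L + \<epsilon> = (1 + varpi / 2) * ?L"
      using varpi L by (auto simp: w_def \<epsilon>_def algebra_simps)
    have reg: "(1 + w) * ?L + \<epsilon> \<le> Im (stieltjes \<nu> (Complex y h)) / h" if "a - h \<le> y" "y \<le> b + h" for y
      using reg[OF that] unfolding split by simp
    have level: "(1 + w) * ?L / ?L = 1 + w" using L by simp
    have "\<forall>\<^sub>F N in sequentially. e N < lam\<^sub>0 * h / 4"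
      using h coupling by (intro order_tendstoD[OF e_lim]) simp
    then have e_small: "\<forall>\<^sub>F N in sequentially. 4 * e N \<le> lam\<^sub>0 * h" by eventually_elim simp
    define \<alpha> where "\<alpha> = (if rnd then 1 / 2 - \<epsilon>\<^sub>0 else a\<^sub>0)"
    have \<alpha>: "0 < \<alpha>" using exponents by (simp add: \<alpha>_def)
    have decay: "(\<lambda>N. c * real N powr - \<alpha>) \<longlonglongrightarrow> 0" for c
      by (intro tendsto_mult_right_zero tendsto_neg_powr filterlim_real_sequentially) (use \<alpha> in auto)
    have unif: "\<exists>C. \<forall>\<^sub>F N in sequentially. \<forall>\<omega>\<in>\<Xi> N. \<forall>z\<in>D.
        cmod (stieltjes (empirical N (\<lambda>i. V N i \<omega>)) z - stieltjes \<nu> z) \<le> C * real N powr - \<alpha>"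
      if "stieltjes_domain \<nu> D" for D
      using \<Xi> that unfolding event_Xi_def \<alpha>_def[symmetric] by blast
    \<comment> \<open>Convergence is needed on three compact sets: a segment at height
      \<open>h\<close> over the enlarged hull, and two real segments from distance
      \<open>h / 2\<close> outside the hull to 1 beyond all atoms.\<close>
    have D0: "stieltjes_domain \<nu> ((\<lambda>y. Complex y h) ` {a - h..b + h})"
    proof -
      have "continuous_on {a - h..b + h} (\<lambda>y. Complex y h)"
        unfolding Complex_eq by (intro continuous_intros)
      then have "compact ((\<lambda>y. Complex y h) ` {a - h..b + h})" by (rule compact_continuous_image) simp
      then show ?thesis using h unfolding stieltjes_domain_def by (auto simp: complex_eq_iff)
    qed
    have D1: "stieltjes_domain \<nu> (complex_of_real ` {x..y})" if "{x..y} \<inter> {a..b} = {}" for x y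
    proof -
      have "compact (complex_of_real ` {x..y})"
        by (intro compact_continuous_image continuous_intros) simp
      then show ?thesis using msupp that unfolding stieltjes_domain_def by auto
    qed
    obtain C\<^sub>0 where C0: "\<forall>\<^sub>F N in sequentially. \<forall>\<omega>\<in>\<Xi> N. \<forall>z\<in>(\<lambda>y. Complex y h) ` {a - h..b + h}.
        cmod (stieltjes (empirical N (\<lambda>i. V N i \<omega>)) z - stieltjes \<nu> z) \<le> C\<^sub>0 * real N powr - \<alpha>"
      using unif[OF D0] by blast
    have "{b + h / 2..K + 1} \<inter> {a..b} = {}" "{- K - 1..a - h / 2} \<inter> {a..b} = {}" using h by auto
    then obtain C\<^sub>1 C\<^sub>2
      where C1: "\<forall>\<^sub>F N in sequentially. \<forall>\<omega>\<in>\<Xi> N. \<forall>z\<in>complex_of_real ` {b + h / 2..K + 1}.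
        cmod (stieltjes (empirical N (\<lambda>i. V N i \<omega>)) z - stieltjes \<nu> z) \<le> C\<^sub>1 * real N powr - \<alpha>"
      and C2: "\<forall>\<^sub>F N in sequentially. \<forall>\<omega>\<in>\<Xi> N. \<forall>z\<in>complex_of_real ` {- K - 1..a - h / 2}.
        cmod (stieltjes (empirical N (\<lambda>i. V N i \<omega>)) z - stieltjes \<nu> z) \<le> C\<^sub>2 * real N powr - \<alpha>"
      using unif[OF D1] by meson
    \<comment> \<open>At height \<open>h\<close> the error is divided by \<open>h\<close> and must
      stay below \<open>\<epsilon>\<close>. On the real segments any finite bound would do, because
      an atom there makes the transform unbounded.\<close>
    have "\<forall>\<^sub>F N in sequentially. C\<^sub>0 * real N powr - \<alpha> < h * \<epsilon>"
      using h \<epsilon> by (intro order_tendstoD[OF decay]) simp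
    moreover have "\<forall>\<^sub>F N in sequentially. C\<^sub>1 * real N powr - \<alpha> < 1" "\<forall>\<^sub>F N in sequentially. C\<^sub>2 * real N powr - \<alpha> < 1"
      by (intro order_tendstoD[OF decay]; simp)+
    ultimately have emp: "\<forall>\<^sub>F N in sequentially. \<forall>\<omega>\<in>\<Xi> N. ?Q N \<omega> \<longrightarrow>
        stable_at_level (1 + w) (smeared (lam N) (e N) (empirical N (\<lambda>i. V N i \<omega>)))"
      using C0 C1 C2 ev2 e_small
    proof eventually_elim
      case (elim N)
      show ?case
      proof (intro ballI impI)
        fix \<omega> assume \<omega>: "\<omega> \<in> \<Xi> N" and Q: "?Q N \<omega>"
        let ?d = "\<lambda>z. cmod (stieltjes (empirical N (\<lambda>i. V N i \<omega>)) z - stieltjes \<nu> z)"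
        have d0: "?d (Complex y h) \<le> h * \<epsilon>" if "a - h \<le> y" "y \<le> b + h" for y
          using elim(1) elim(4)[rule_format, OF \<omega>, of "Complex y h"] that by force
        have d1: "?d (of_real x) \<le> 1" if "b + h / 2 \<le> x" "x \<le> K + 1" for x
          using elim(2) elim(5)[rule_format, OF \<omega>, of "of_real x"] that by force
        have d2: "?d (of_real x) \<le> 1" if "- K - 1 \<le> x" "x \<le> a - h / 2" for x
          using elim(3) elim(6)[rule_format, OF \<omega>, of "of_real x"] that by force
        have "stable_at_level ((1 + w) * ?L / lam\<^sub>0\<^sup>2) (smeared lam\<^sub>0 (e N) (empirical N (\<lambda>i. V N i \<omega>)))"
          by (rule empirical_smeared_stable[OF law h _ _ d1 d2 reg d0 coupling(2) e0 elim(8)])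
            (use Q elim(7) w L in auto)
        then show "stable_at_level (1 + w) (smeared (lam N) (e N) (empirical N (\<lambda>i. V N i \<omega>)))"
          unfolding level lam_eq[OF elim(7)] .
      qed
    qed
    have nu: "\<forall>\<^sub>F N in sequentially. stable_at_level (1 + w) (smeared (lam N) (e N) \<nu>)"
      using ev2 e_small
    proof eventually_elim
      case (elim N)
      have "stable_at_level ((1 + w) * ?L / lam\<^sub>0\<^sup>2) (smeared lam\<^sub>0 (e N) \<nu>)"
      proof (rule nu.stable_at_level_smeared[OF coupling(2) e0 _ h])
        show "2 * e N \<le> lam\<^sub>0 * h" using elim(2) e0[OF elim(1)] by simp
        show "(1 + w) * ?L \<le> Im (stieltjes \<nu> (Complex y h)) / h" if "a - h \<le> y" "y \<le> b + h" for y
          using reg[OF that] \<epsilon> by simp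
      qed (use elim w L in auto)
      then show ?case unfolding level lam_eq[OF elim(1)] .
    qed
    show thesis by (rule that[OF w emp nu])
  qed
  define C where "C = 20000 * (100 + 64 * K ^ 6 + 2 * K ^ 5 + 3 * K\<^sup>2) * (1 + S + S ^ 3)"
  \<comment> \<open>The decay of the coupling is a property of the whole sequence, while the
    conclusion is stated for each \<open>N\<close>; so the smallness at \<open>N\<close> is recorded
    as an implication.\<close>
  have ev_small: "\<forall>\<^sub>F N in sequentially. lam \<longlonglongrightarrow> 0 \<longrightarrow> lam N \<le> 1 \<and> lam N * K + e N \<le> 1 / 4"
    using small by (cases "lam \<longlonglongrightarrow> 0") auto
  have \<Xi>_sets: "\<Xi> N \<in> sets (M N)" for N using \<Xi> by (simp add: event_Xi_def)
  have det': "\<exists>v. \<forall>N i. i < N \<longrightarrow> (\<forall>\<omega>\<in>space (M N). V N i \<omega> = v N i)" if "\<not> rnd"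
    using det[OF that] unfolding deterministic_potential_def by blast
  have supported: "supported_on_compact_interval (smeared (lam N) (sqrt (s N) / q N) \<mu>)"
    and moments: "smeared_moments (lam N) (s N) (q N) \<mu>"
    if "compact_law \<mu> (- K) K" "2 \<le> N" for \<mu> N
  proof -
    interpret compact_law \<mu> "- K" K by fact
    interpret T: compact_law "smeared (lam N) (sqrt (s N) / q N) \<mu>" "lam N * (- K) - sqrt (s N) / q N" "lam N * K + sqrt (s N) / q N"
      by (rule compact_law_smeared) (use e0[OF that(2)] lam0[OF that(2)] in \<open>auto simp: e_def\<close>)
    show "supported_on_compact_interval (smeared (lam N) (sqrt (s N) / q N) \<mu>)"
      by (rule T.supported_on_compact_interval)
    show "smeared_moments (lam N) (s N) (q N) \<mu>"
      by (rule smeared_moments) (use lam0[OF that(2)] s0[OF that(2)] q0[OF that(2)] in auto)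
  qed
  have w1: "1 < 1 + w" using w by simp
  have on_event: "holds_on rnd M \<Xi> P"
    if P: "\<And>N \<omega>. 2 \<le> N \<Longrightarrow> ?Q N \<omega> \<Longrightarrow>
        stable_at_level (1 + w) (smeared (lam N) (sqrt (s N) / q N) (empirical N (\<lambda>i. V N i \<omega>))) \<Longrightarrow>
        (lam \<longlonglongrightarrow> 0 \<Longrightarrow> lam N \<le> 1 \<and> lam N * K + sqrt (s N) / q N \<le> 1 / 4) \<Longrightarrow> P N \<omega>" for P
  proof (rule holds_onI[OF M \<Xi>_sets meas K det'])
    show "\<forall>\<^sub>F N in sequentially. \<forall>\<omega>\<in>\<Xi> N. ?Q N \<omega> \<longrightarrow> P N \<omega>"
      using ev2 ev_emp ev_small unfolding e_def by eventually_elim (use P in blast)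
  qed
  show ?thesis
  proof (rule conjI, rule exI[of _ w], rule conjI[OF w], rule exI[of _ C], rule on_event, goal_cases)
    case (1 N \<omega>)
    note N = 1(1) and Q = 1(2) and st = 1(3) and sm = 1(4)
    have E: "compact_law (empirical N (\<lambda>i. V N i \<omega>)) (- K) K" using empK N Q by simp
    note fixed = smeared_fixed_point[OF E less_imp_le[OF lam0[OF N]] s0[OF N] q0[OF N]]
    note cut = smeared_one_cut[OF E less_imp_le[OF lam0[OF N]] s0[OF N] q0[OF N] st w1, where S = S, folded C_def]
    show ?case
      unfolding Let_def
    proof (intro conjI allI impI)
      fix \<rho> assume conv: "is_free_add_conv semicircle (smeared (lam N) (sqrt (s N) / q N) (empirical N (\<lambda>i. V N i \<omega>))) \<rho>"
      let ?m = "moment (smeared (lam N) (sqrt (s N) / q N) (empirical N (\<lambda>i. V N i \<omega>)))"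
      show "\<exists>Lm Lp. one_cut \<rho> Lm Lp \<and> (lam \<longlonglongrightarrow> 0 \<longrightarrow>
          \<bar>Lp - (2 + ?m 1 + ?m 2 + ?m 3 + (?m 4 - 9 / 4 * (?m 2)\<^sup>2))\<bar> \<le> C * edge_error (lam N) (q N) ?m \<and>
          \<bar>Lm - (- 2 + ?m 1 - ?m 2 + ?m 3 - (?m 4 - 9 / 4 * (?m 2)\<^sup>2))\<bar> \<le> C * edge_error (lam N) (q N) ?m)"
        (is "\<exists>Lm Lp. ?cut Lm Lp \<and> (_ \<longrightarrow> ?up Lp \<and> ?lo Lm)")
      proof -
        obtain Lm Lp where "?cut Lm Lp"
          "lam N \<le> 1 \<longrightarrow> lam N * K + sqrt (s N) / q N \<le> 1 / 4 \<longrightarrow> s N \<le> S \<longrightarrow> ?up Lp \<and> ?lo Lm"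
          using cut[OF conv] by blast
        then show ?thesis using sm S[OF N] by blast
      qed
    qed (use supported[OF E N] moments[OF E N] st fixed in blast)+
  next
    case 2
    show ?case
    proof (rule exI[of _ w], rule conjI[OF w], use ev2 ev_nu[unfolded e_def] in eventually_elim)
      case (elim N)
      note N = elim(1)
      note fixed = smeared_fixed_point[OF nuK less_imp_le[OF lam0[OF N]] s0[OF N] q0[OF N]]
      note cut = smeared_one_cut[OF nuK less_imp_le[OF lam0[OF N]] s0[OF N] q0[OF N] elim(2) w1]
      show ?case
        unfolding Let_def
        by (intro conjI allI impI) (use supported[OF nuK N] moments[OF nuK N] elim(2) fixed cut in blast)+
    qed
  qed
qed

end
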